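(* Let $A$ and $B$ be two positive invertible elements in $\mathcal{A}$, which is a $C^*$-algebra or a real $C^*$-algebra or a JC-algebra, with a unit, and let $\alpha\geq 0$, $\beta>0$. (i) If $\delta\geq 1$ and $\delta A^{\beta}\leq B$, then $$\mathrm{I}\leq \mathrm{II}\leq \mathrm{II}'\leq S_{\alpha,\beta}(A|B)\leq \mathrm{III}'\leq \mathrm{V}'\leq \mathrm{V}.$$ (ii) If $0<\delta\leq 1$ and $\delta A^{\beta}\geq B$, then $$\mathrm{V}\leq \mathrm{V}'\leq \mathrm{III}'\leq S_{\alpha,\beta}(A|B)\leq \mathrm{II}'\leq \mathrm{II}\leq \mathrm{I}.$$
   Context: A JC-algebra is a norm-closed Jordan subalgebra of $B(H)_{sa}$, the self-adjoint bounded operators on a complex Hilbert space $H$, with Jordan product $A\circ B=\frac12(AB+BA)$, ordered by the cone of positive operators. In the JC case, products are computed in the ambient $B(H)$ (with $ABA=2(A\circ B)\circ A-A^2\circ B$), and all expressions below belong to $\mathcal{A}$. For self-adjoint elements, $X\leq Y$ means $Y-X$ is positive. Real powers, logarithms and inverses are taken by continuous functional calculus for self-adjoint elements; scalars are identified with multiples of the unit $1$ of $\mathcal{A}$. For positive invertible $A,B\in\mathcal{A}$ put $X=A^{-\frac{\beta}{2}}BA^{-\frac{\beta}{2}}$. For real $\alpha,\beta$, the relative operator $(\alpha,\beta)$-entropy is $S_{\alpha,\beta}(A|B)=A^{\frac{\beta}{2}}\left[X^{\alpha}\log X\right]A^{\frac{\beta}{2}}$ and the operator $(\alpha,\beta)$-geometric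 mean is $A\#_{(\alpha,\beta)}B=A^{\frac{\beta}{2}}X^{\alpha}A^{\frac{\beta}{2}}$. For $\alpha\geq 0$, $\beta>0$, $\delta>0$ set $$\mathrm{I}=2A^{\frac{\beta}{2}}\left[\left(1-2(1+X)^{-1}\right)X^{\alpha}\right]A^{\frac{\beta}{2}},$$ $$\mathrm{II}=4A\#_{(\alpha,\beta)}B-8A^{\frac{\beta}{2}}\left[X^{\alpha}\left(X^{\frac12}+1\right)^{-1}\right]A^{\frac{\beta}{2}},$$ $$\mathrm{V}=\tfrac12\left(A\#_{(\alpha+1,\beta)}B-A\#_{(\alpha-1,\beta)}B\right),$$ $$\mathrm{II}'=(\ln\delta+4)A\#_{(\alpha,\beta)}B-8\sqrt{\delta}\,A^{\frac{\beta}{2}}\left[\left(X^{\frac12}+\sqrt{\delta}\right)^{-1}X^{\alpha}\right]A^{\frac{\beta}{2}},$$ $$\mathrm{III}'=\left(\tfrac{1}{\sqrt{\delta}}A\#_{(\alpha+\frac12,\beta)}B-\sqrt{\delta}\,A\#_{(\alpha-\frac12,\beta)}B\right)+(\ln\delta)\, A\#_{(\alpha,\beta)}B,$$ $$\mathrm{V}'=\tfrac12\left(\tfrac{1}{\delta}A\#_{(\alpha+1,\beta)}B-\delta A\#_{(\alpha-1,\beta)}B\right)+(\ln\delta)\, A\#_{(\alpha,\beta)}B.$$ *)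

theory Defs
  imports "HOL-Analysis.Analysis" "HOL-Computational_Algebra.Polynomial"
begin

class complex_banach = banach +
  fixes scaleC :: "complex \<Rightarrow> 'a \<Rightarrow> 'a"  (infixr "*\<^sub>C" 75)
  assumes scaleC_add_right: "z *\<^sub>C (x + y) = z *\<^sub>C x + z *\<^sub>C y"
    and scaleC_add_left: "(z + w) *\<^sub>C x = z *\<^sub>C x + w *\<^sub>C x"
    and scaleC_scaleC: "z *\<^sub>C (w *\<^sub>C x) = (z * w) *\<^sub>C x"
    and scaleC_of_real: "complex_of_real r *\<^sub>C x = r *\<^sub>R x"
    and norm_scaleC: "norm (z *\<^sub>C x) = cmod z * norm x"

class complex_hilbert_space = complex_banach +
  fixes cinner :: "'a \<Rightarrow> 'a \<Rightarrow> complex"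
  assumes cinner_add_left: "cinner (x + y) z = cinner x z + cinner y z"
    and cinner_scaleC_left: "cinner (c *\<^sub>C x) y = c * cinner x y"
    and cinner_commute: "cinner x y = cnj (cinner y x)"
    and cinner_self: "cinner x x = complex_of_real ((norm x)\<^sup>2)"

text \<open>
  Unital algebras are described by \<^class>\<open>monoid_mult\<close> and not by \<^class>\<open>real_normed_algebra_1\<close>,
  so that the zero algebra is not excluded; in every other case \<open>norm 1 = 1\<close> follows from the
  \<open>C\<^sup>*\<close>-identity.
\<close>

class banach_star_algebra = real_normed_algebra + monoid_mult + banach +
  fixes star :: "'a \<Rightarrow> 'a"
  assumes star_star: "star (star x) = x"
    and star_add: "star (x + y) = star x + star y"
    and star_scaleR: "star (r *\<^sub>R x) = r *\<^sub>R star x"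
    and star_mult: "star (x * y) = star y * star x"

class cstar_algebra = banach_star_algebra + complex_banach +
  assumes scaleC_mult_left: "(z *\<^sub>C x) * y = z *\<^sub>C (x * y)"
    and scaleC_mult_right: "x * (z *\<^sub>C y) = z *\<^sub>C (x * y)"
    and star_scaleC: "star (z *\<^sub>C x) = cnj z *\<^sub>C star x"
    and cstar_identity: "norm (star x * x) = (norm x)\<^sup>2"

text \<open>
  Over the reals the \<open>C\<^sup>*\<close>-identity alone does not suffice (take the complex numbers with the
  trivial involution), and the invertibility of \<open>1 + x\<^sup>*x\<close> is part of the definition.
\<close>

class real_cstar_algebra = banach_star_algebra +
  assumes real_cstar_identity: "norm (star x * x) = (norm x)\<^sup>2"
    and one_plus_star_mult_invertible:
      "\<exists>y. (1 + star x * x) * y = 1 \<and> y * (1 + star x * x) = 1"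

text \<open>
  Elements of \<^typ>\<open>'h::complex_hilbert_space \<Rightarrow>\<^sub>L 'h\<close> are only real-linear; the symmetry condition
  forces complex linearity, and the norm of this type is then the usual operator norm.
\<close>

definition self_adjoint_op :: "('h::complex_hilbert_space \<Rightarrow>\<^sub>L 'h) \<Rightarrow> bool" where
  "self_adjoint_op T \<longleftrightarrow> (\<forall>x y. cinner (blinfun_apply T x) y = cinner x (blinfun_apply T y))"

definition positive_op :: "('h::complex_hilbert_space \<Rightarrow>\<^sub>L 'h) \<Rightarrow> bool" where
  "positive_op T \<longleftrightarrow> self_adjoint_op T \<and> (\<forall>x. 0 \<le> Re (cinner (blinfun_apply T x) x))"

definition jordan_prod ::
    "('h::complex_hilbert_space \<Rightarrow>\<^sub>L 'h) \<Rightarrow> ('h \<Rightarrow>\<^sub>L 'h) \<Rightarrow> ('h \<Rightarrow>\<^sub>L 'h)" where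
  "jordan_prod S T = (1/2) *\<^sub>R ((S o\<^sub>L T) + (T o\<^sub>L S))"

definition jc_algebra :: "('h::complex_hilbert_space \<Rightarrow>\<^sub>L 'h) set \<Rightarrow> bool" where
  "jc_algebra \<A> \<longleftrightarrow> (\<forall>T\<in>\<A>. self_adjoint_op T) \<and> subspace \<A> \<and> closed \<A> \<and>
     (\<forall>S\<in>\<A>. \<forall>T\<in>\<A>. jordan_prod S T \<in> \<A>)"

text \<open>The unit of a JC-algebra may be a proper projection; it need not be the identity operator.\<close>

definition jc_unit :: "('h::complex_hilbert_space \<Rightarrow>\<^sub>L 'h) set \<Rightarrow> ('h \<Rightarrow>\<^sub>L 'h) \<Rightarrow> bool" where
  "jc_unit \<A> e \<longleftrightarrow> e \<in> \<A> \<and> (\<forall>T\<in>\<A>. jordan_prod e T = T)"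

text \<open>
  The data of the three kinds of algebras that enter the statement. For a JC-algebra \<open>mul\<close> is the
  product of the ambient operator algebra.
\<close>

record 'a op_algebra =
  carr :: "'a set"
  mul :: "'a \<Rightarrow> 'a \<Rightarrow> 'a"
  unit :: "'a"
  spectrum :: "'a \<Rightarrow> complex set"
  cone :: "'a set"

definition inverse_in :: "'a set \<Rightarrow> ('a \<Rightarrow> 'a \<Rightarrow> 'a) \<Rightarrow> 'a \<Rightarrow> 'a \<Rightarrow> 'a \<Rightarrow> bool" where
  "inverse_in C m e a b \<longleftrightarrow> b \<in> C \<and> m a b = e \<and> m b a = e"

definition cstar_spectrum :: "'a::cstar_algebra \<Rightarrow> complex set" where
  "cstar_spectrum a = {z. \<nexists>b. inverse_in UNIV (*) 1 (a - z *\<^sub>C 1) b}"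

definition cstar_alg :: "'a::cstar_algebra op_algebra" where
  "cstar_alg = \<lparr> carr = UNIV, mul = (*), unit = 1, spectrum = cstar_spectrum,
     cone = {a. star a = a \<and> cstar_spectrum a \<subseteq> \<real>\<^sub>\<ge>\<^sub>0} \<rparr>"

text \<open>
  The spectrum of an element of a real algebra is its spectrum in the complexification:
  \<open>a - (s + it)\<close> and its conjugate \<open>a - (s - it)\<close> are both invertible there iff their product
  \<open>(a - s)\<^sup>2 + t\<^sup>2\<close> is invertible in the real algebra.
\<close>

definition real_cstar_spectrum :: "'a::real_cstar_algebra \<Rightarrow> complex set" where
  "real_cstar_spectrum a =
     {z. \<nexists>b. inverse_in UNIV (*) 1 ((a - Re z *\<^sub>R 1) * (a - Re z *\<^sub>R 1) + (Im z)\<^sup>2 *\<^sub>R 1) b}"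

definition real_cstar_alg :: "'a::real_cstar_algebra op_algebra" where
  "real_cstar_alg = \<lparr> carr = UNIV, mul = (*), unit = 1, spectrum = real_cstar_spectrum,
     cone = {a. star a = a \<and> real_cstar_spectrum a \<subseteq> \<real>\<^sub>\<ge>\<^sub>0} \<rparr>"

text \<open>As usual for Jordan operator algebras, only real spectral values are considered.\<close>

definition jc_spectrum ::
    "('h::complex_hilbert_space \<Rightarrow>\<^sub>L 'h) set \<Rightarrow> ('h \<Rightarrow>\<^sub>L 'h) \<Rightarrow> ('h \<Rightarrow>\<^sub>L 'h) \<Rightarrow> complex set" where
  "jc_spectrum \<A> e a = complex_of_real ` {t. \<nexists>b. inverse_in \<A> (o\<^sub>L) e (a - t *\<^sub>R e) b}"

definition jc_alg ::
    "('h::complex_hilbert_space \<Rightarrow>\<^sub>L 'h) set \<Rightarrow> ('h \<Rightarrow>\<^sub>L 'h) \<Rightarrow> ('h \<Rightarrow>\<^sub>L 'h) op_algebra" where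
  "jc_alg \<A> e = \<lparr> carr = \<A>, mul = (o\<^sub>L), unit = e, spectrum = jc_spectrum \<A> e,
     cone = {T. positive_op T} \<rparr>"

definition positive_invertible :: "'a op_algebra \<Rightarrow> 'a \<Rightarrow> bool" where
  "positive_invertible M a \<longleftrightarrow>
     a \<in> carr M \<and> a \<in> cone M \<and> (\<exists>b. inverse_in (carr M) (mul M) (unit M) a b)"

definition op_le :: "'a::real_normed_vector op_algebra \<Rightarrow> 'a \<Rightarrow> 'a \<Rightarrow> bool" where
  "op_le M X Y \<longleftrightarrow> Y - X \<in> cone M"

definition poly_calc :: "'a::real_normed_vector op_algebra \<Rightarrow> real poly \<Rightarrow> 'a \<Rightarrow> 'a" where
  "poly_calc M p a = (\<Sum>i\<le>degree p. coeff p i *\<^sub>R (mul M a ^^ i) (unit M))"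

text \<open>
  Continuous functional calculus of a self-adjoint element \<open>a\<close>, whose spectrum is a compact set of
  real numbers: \<open>f(a)\<close> is the common norm limit of \<open>p\<^sub>n(a)\<close> over all sequences of real
  polynomials \<open>p\<^sub>n\<close> that converge to \<open>f\<close> uniformly on the spectrum.
\<close>

definition fun_calc :: "'a::real_normed_vector op_algebra \<Rightarrow> (real \<Rightarrow> real) \<Rightarrow> 'a \<Rightarrow> 'a" where
  "fun_calc M f a = (THE b. b \<in> carr M \<and>
     (\<forall>p. uniform_limit {t. complex_of_real t \<in> spectrum M a} (\<lambda>n. poly (p n)) f sequentially
        \<longrightarrow> (\<lambda>n. poly_calc M (p n) a) \<longlonglongrightarrow> b))"

definition op_powr :: "'a::real_normed_vector op_algebra \<Rightarrow> 'a \<Rightarrow> real \<Rightarrow> 'a" where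
  "op_powr M a r = fun_calc M (\<lambda>t. t powr r) a"

definition op_log :: "'a::real_normed_vector op_algebra \<Rightarrow> 'a \<Rightarrow> 'a" where
  "op_log M a = fun_calc M ln a"

definition op_inv :: "'a::real_normed_vector op_algebra \<Rightarrow> 'a \<Rightarrow> 'a" where
  "op_inv M a = fun_calc M inverse a"

definition sandwich :: "'a op_algebra \<Rightarrow> 'a \<Rightarrow> 'a \<Rightarrow> 'a" where
  "sandwich M C Y = mul M (mul M C Y) C"

definition op_X :: "'a::real_normed_vector op_algebra \<Rightarrow> real \<Rightarrow> 'a \<Rightarrow> 'a \<Rightarrow> 'a" where
  "op_X M \<beta> A B = sandwich M (op_powr M A (- \<beta> / 2)) B"

definition rel_entropy ::
    "'a::real_normed_vector op_algebra \<Rightarrow> real \<Rightarrow> real \<Rightarrow> 'a \<Rightarrow> 'a \<Rightarrow> 'a" where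
  "rel_entropy M \<alpha> \<beta> A B = (let X = op_X M \<beta> A B in
     sandwich M (op_powr M A (\<beta> / 2)) (mul M (op_powr M X \<alpha>) (op_log M X)))"

definition geom_mean ::
    "'a::real_normed_vector op_algebra \<Rightarrow> real \<Rightarrow> real \<Rightarrow> 'a \<Rightarrow> 'a \<Rightarrow> 'a" where
  "geom_mean M \<alpha> \<beta> A B = (let X = op_X M \<beta> A B in
     sandwich M (op_powr M A (\<beta> / 2)) (op_powr M X \<alpha>))"

definition bound_I ::
    "'a::real_normed_vector op_algebra \<Rightarrow> real \<Rightarrow> real \<Rightarrow> 'a \<Rightarrow> 'a \<Rightarrow> 'a" where
  "bound_I M \<alpha> \<beta> A B = (let X = op_X M \<beta> A B in
     2 *\<^sub>R sandwich M (op_powr M A (\<beta> / 2))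
       (mul M (unit M - 2 *\<^sub>R op_inv M (unit M + X)) (op_powr M X \<alpha>)))"

definition bound_II ::
    "'a::real_normed_vector op_algebra \<Rightarrow> real \<Rightarrow> real \<Rightarrow> 'a \<Rightarrow> 'a \<Rightarrow> 'a" where
  "bound_II M \<alpha> \<beta> A B = (let X = op_X M \<beta> A B in
     4 *\<^sub>R geom_mean M \<alpha> \<beta> A B
     - 8 *\<^sub>R sandwich M (op_powr M A (\<beta> / 2))
         (mul M (op_powr M X \<alpha>) (op_inv M (op_powr M X (1/2) + unit M))))"

definition bound_V ::
    "'a::real_normed_vector op_algebra \<Rightarrow> real \<Rightarrow> real \<Rightarrow> 'a \<Rightarrow> 'a \<Rightarrow> 'a" where
  "bound_V M \<alpha> \<beta> A B =
     (1/2) *\<^sub>R (geom_mean M (\<alpha> + 1) \<beta> A B - geom_mean M (\<alpha> - 1) \<beta> A B)"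

definition bound_II' ::
    "'a::real_normed_vector op_algebra \<Rightarrow> real \<Rightarrow> real \<Rightarrow> real \<Rightarrow> 'a \<Rightarrow> 'a \<Rightarrow> 'a" where
  "bound_II' M \<delta> \<alpha> \<beta> A B = (let X = op_X M \<beta> A B in
     (ln \<delta> + 4) *\<^sub>R geom_mean M \<alpha> \<beta> A B
     - (8 * sqrt \<delta>) *\<^sub>R sandwich M (op_powr M A (\<beta> / 2))
         (mul M (op_inv M (op_powr M X (1/2) + sqrt \<delta> *\<^sub>R unit M)) (op_powr M X \<alpha>)))"

definition bound_III' ::
    "'a::real_normed_vector op_algebra \<Rightarrow> real \<Rightarrow> real \<Rightarrow> real \<Rightarrow> 'a \<Rightarrow> 'a \<Rightarrow> 'a" where
  "bound_III' M \<delta> \<alpha> \<beta> A B =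
     ((1 / sqrt \<delta>) *\<^sub>R geom_mean M (\<alpha> + 1/2) \<beta> A B - sqrt \<delta> *\<^sub>R geom_mean M (\<alpha> - 1/2) \<beta> A B)
     + ln \<delta> *\<^sub>R geom_mean M \<alpha> \<beta> A B"

definition bound_V' ::
    "'a::real_normed_vector op_algebra \<Rightarrow> real \<Rightarrow> real \<Rightarrow> real \<Rightarrow> 'a \<Rightarrow> 'a \<Rightarrow> 'a" where
  "bound_V' M \<delta> \<alpha> \<beta> A B =
     (1/2) *\<^sub>R ((1 / \<delta>) *\<^sub>R geom_mean M (\<alpha> + 1) \<beta> A B - \<delta> *\<^sub>R geom_mean M (\<alpha> - 1) \<beta> A B)
     + ln \<delta> *\<^sub>R geom_mean M \<alpha> \<beta> A B"

end

theory Submission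
  imports Defs "HOL-Computational_Algebra.Fundamental_Theorem_Algebra"
begin

text \<open>
  Every expression in the statement has the form \<open>A\<^bsup>\<beta>/2\<^esup> f(X) A\<^bsup>\<beta>/2\<^esup>\<close>. The hypothesis
  \<open>\<delta> A\<^bsup>\<beta>\<^esup> \<le> B\<close> gives \<open>\<delta> \<le> X\<close>, so the claim is a chain of scalar inequalities on the spectrum
  of \<open>X\<close>, transported by the functional calculus and by the sandwich with \<open>A\<^bsup>\<beta>/2\<^esup>\<close>.

  What has to be supplied is the functional calculus of a self-adjoint element \<open>a\<close>. In all three
  kinds of algebras the self-adjoint elements in the bicommutant of \<open>a\<close> form a commutative
  associative real Banach algebra in which \<open>\<parallel>x\<^sup>2\<parallel> = \<parallel>x\<parallel>\<^sup>2\<close> and \<open>1 + x\<^sup>2\<close> is invertible. There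
  \<open>\<parallel>x\<parallel>\<close> or \<open>-\<parallel>x\<parallel>\<close> is a spectral value of \<open>x\<close>, which with the factorisation of real polynomials
  yields \<open>\<parallel>p(a)\<parallel> \<le> sup \<bar>p\<bar>\<close> over the spectrum of \<open>a\<close>.
\<close>

section \<open>Commutative algebras of self-adjoint elements\<close>

text \<open>Products may leave a JC-algebra and a real algebra has no complex scalars, so Gelfand
  theory and holomorphic resolvents are not directly at hand; all spectral arguments are made in one
  commuting family over the reals. The whole bicommutant is taken, and not the closed algebra
  generated by a, because it visibly contains the inverses of its members, so that spectra do not
  change on passing to it. Invertibility of 1 + x^2 replaces the missing complex numbers: it inverts
  every real quadratic without real roots, leaving only real spectral values. It is part of the
  definition for real algebras, comes from Arens' argument for complex ones and from a Hilbert space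
  estimate for JC-algebras. Positivity of star x x is no tool common to the three settings. That c h
  c stays positive is therefore shown for invertible c only, by inverting c h c + s for every s > 0;
  powers of A are of this kind.\<close>

locale banach_mult =
  fixes mult :: "'a::banach \<Rightarrow> 'a \<Rightarrow> 'a" (infixl "\<odot>" 70) and e :: 'a
  assumes bilinear: "bounded_bilinear (\<odot>)"
    and assoc: "x \<odot> y \<odot> z = x \<odot> (y \<odot> z)"
    and norm_mult_le: "norm (x \<odot> y) \<le> norm x * norm y"
begin

sublocale bounded_bilinear "(\<odot>)" by (rule bilinear)

lemmas mult_simps = add_left add_right diff_left diff_right scaleR_left scaleR_right
  zero_left zero_right minus_left minus_right

declare zero_left [simp] zero_right [simp]

text \<open>The Neumann series as the fixed point of the contraction u -> e + z u. The closed
  invariant set \<open>T\<close> lets the solution inherit properties such as membership in an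
  algebra or commuting with z; the latter makes the inverse of e - z two-sided.\<close>

lemma neumann:
  assumes "closed T" "T \<noteq> {}" "\<And>u. u \<in> T \<Longrightarrow> e + z \<odot> u \<in> T" "norm z < 1"
  obtains u where "u \<in> T" "u = e + z \<odot> u"
proof -
  have "\<exists>!x\<in>T. e + z \<odot> x = x"
  proof (rule Banach_fix[where c = "norm z"])
    show "dist (e + z \<odot> x) (e + z \<odot> y) \<le> norm z * dist x y" for x y
      by (simp add: dist_norm flip: diff_right) (rule norm_mult_le)
  qed (use assms in \<open>auto simp: complete_eq_closed\<close>)
  then show thesis
    using that by metis
qed

section \<open>Polynomials in one element\<close>

definition pc :: "real poly \<Rightarrow> 'a \<Rightarrow> 'a" where
  "pc p a = (\<Sum>i\<le>degree p. coeff p i *\<^sub>R ((\<odot>) a ^^ i) e)"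

lemma pc_eq_sum:
  assumes "degree p \<le> n"
  shows "pc p a = (\<Sum>i\<le>n. coeff p i *\<^sub>R ((\<odot>) a ^^ i) e)"
  unfolding pc_def
  by (rule sum.mono_neutral_left) (use assms in \<open>auto simp: coeff_eq_0\<close>)

lemma pc_0 [simp]: "pc 0 a = 0"
  by (simp add: pc_def)

lemma pc_pCons [simp]: "pc (pCons c p) a = c *\<^sub>R e + a \<odot> pc p a"
proof -
  have "pc (pCons c p) a = (\<Sum>i\<le>Suc (degree p). coeff (pCons c p) i *\<^sub>R ((\<odot>) a ^^ i) e)"
    by (rule pc_eq_sum) (simp add: degree_pCons_le)
  also have "\<dots> = c *\<^sub>R e + (\<Sum>i\<le>degree p. coeff p i *\<^sub>R (a \<odot> ((\<odot>) a ^^ i) e))"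
    by (subst sum.atMost_Suc_shift) simp
  also have "(\<Sum>i\<le>degree p. coeff p i *\<^sub>R (a \<odot> ((\<odot>) a ^^ i) e)) = a \<odot> pc p a"
    by (simp add: pc_def sum_right scaleR_right)
  finally show ?thesis .
qed

lemma pc_add: "pc (p + q) a = pc p a + pc q a"
  by (induction p q rule: poly_induct2) (simp_all add: mult_simps scaleR_add_left)

lemma pc_smult: "pc (smult c p) a = c *\<^sub>R pc p a"
  by (induction p) (simp_all add: mult_simps scaleR_add_right)

lemma pc_diff: "pc (p - q) a = pc p a - pc q a"
  using pc_add[of "p - q" q a] by simp

end

text \<open>The commutative real \<open>C\<^sup>*\<close>-algebras with trivial involution, as subsets of a Banach algebra
  that may have a different unit.\<close>

locale comm_real_cstar = banach_mult +
  fixes D :: "'a set"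
  assumes subspace_D: "subspace D" and closed_D: "closed D" and unit_D: "e \<in> D"
    and unit_left: "x \<in> D \<Longrightarrow> e \<odot> x = x"
    and mult_D: "x \<in> D \<Longrightarrow> y \<in> D \<Longrightarrow> x \<odot> y \<in> D"
    and comm: "x \<in> D \<Longrightarrow> y \<in> D \<Longrightarrow> x \<odot> y = y \<odot> x"
    and norm_square: "x \<in> D \<Longrightarrow> norm (x \<odot> x) = (norm x)\<^sup>2"
    and one_plus_square: "x \<in> D \<Longrightarrow> \<exists>y\<in>D. (e + x \<odot> x) \<odot> y = e"
begin

lemma unit_right: "x \<in> D \<Longrightarrow> x \<odot> e = x"
  using comm unit_D unit_left by metis

lemma D_closed [simp, intro]:
  "0 \<in> D" "e \<in> D" "x \<in> D \<Longrightarrow> y \<in> D \<Longrightarrow> x + y \<in> D" "x \<in> D \<Longrightarrow> y \<in> D \<Longrightarrow> x - y \<in> D"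
  "x \<in> D \<Longrightarrow> c *\<^sub>R x \<in> D" "x \<in> D \<Longrightarrow> - x \<in> D" "x \<in> D \<Longrightarrow> y \<in> D \<Longrightarrow> x \<odot> y \<in> D"
  using subspace_D unit_D mult_D
  by (auto simp: subspace_0 subspace_add subspace_diff subspace_scale subspace_neg)

lemma left_comm: "x \<in> D \<Longrightarrow> y \<in> D \<Longrightarrow> x \<odot> (y \<odot> z) = y \<odot> (x \<odot> z)"
  using assoc comm by metis

lemma mult_4:
  assumes "x \<in> D" "y \<in> D" "u \<in> D"
  shows "x \<odot> y \<odot> (u \<odot> v) = x \<odot> u \<odot> (y \<odot> v)"
  using assms by (simp add: assoc left_comm[of y u])

lemmas D_ac = assoc comm left_comm
lemmas D_simps = mult_simps unit_left unit_right

lemma pc_D [simp, intro]: "a \<in> D \<Longrightarrow> pc p a \<in> D"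
  by (induction p) auto

lemma pc_mult: "a \<in> D \<Longrightarrow> pc (p * q) a = pc p a \<odot> pc q a"
  by (induction p) (simp_all add: pc_add pc_smult D_simps assoc)

text \<open>The norm of e solves n = n^2, and the root 0 belongs to the zero algebra.\<close>

lemma norm_unit_le: "norm e \<le> 1"
proof -
  have "norm e = (norm e)\<^sup>2"
    using norm_square[of e] unit_left[of e] by simp
  then show ?thesis
    by (metis norm_ge_zero power2_eq_square mult_cancel_left1 order.refl zero_le_one)
qed

section \<open>Inverses: uniqueness, norm estimates, continuity\<close>

definition inv_of :: "'a \<Rightarrow> 'a" where
  "inv_of x = (SOME y. y \<in> D \<and> x \<odot> y = e)"

definition invertible :: "'a \<Rightarrow> bool" where
  "invertible x \<longleftrightarrow> x \<in> D \<and> (\<exists>y\<in>D. x \<odot> y = e)"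

lemma invertibleI: "x \<in> D \<Longrightarrow> y \<in> D \<Longrightarrow> x \<odot> y = e \<Longrightarrow> invertible x"
  by (auto simp: invertible_def)

lemma invertible_D: "invertible x \<Longrightarrow> x \<in> D"
  by (simp add: invertible_def)

lemma inv_of:
  assumes "invertible x"
  shows "inv_of x \<in> D" "x \<odot> inv_of x = e"
proof -
  have "\<exists>y. y \<in> D \<and> x \<odot> y = e"
    using assms by (auto simp: invertible_def)
  from someI_ex[OF this] show "inv_of x \<in> D" "x \<odot> inv_of x = e"
    by (simp_all add: inv_of_def)
qed

lemma inverse_unique:
  assumes "x \<in> D" "y \<in> D" "z \<in> D" "x \<odot> y = e" "x \<odot> z = e"
  shows "y = z"
  using assms by (metis assoc comm unit_right)

lemma inv_of_eqI:
  assumes "x \<in> D" "y \<in> D" "x \<odot> y = e"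
  shows "inv_of x = y"
  using assms inv_of[of x] inverse_unique[of x "inv_of x" y] invertibleI by blast

lemma invertible_mult_iff:
  assumes "x \<in> D" "y \<in> D"
  shows "invertible (x \<odot> y) \<longleftrightarrow> invertible x \<and> invertible y"
proof
  assume "invertible (x \<odot> y)"
  then obtain z where z: "z \<in> D" "x \<odot> y \<odot> z = e"
    by (auto simp: invertible_def)
  then have "x \<odot> (y \<odot> z) = e" "y \<odot> (x \<odot> z) = e"
    using assms by (metis assoc) (use assms z in \<open>metis assoc left_comm\<close>)
  then show "invertible x \<and> invertible y"
    using assms z(1) by (intro conjI invertibleI[of x "y \<odot> z"] invertibleI[of y "x \<odot> z"] mult_D)
next
  assume inv: "invertible x \<and> invertible y"
  let ?z = "inv_of x \<odot> inv_of y"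
  have "x \<odot> y \<odot> ?z = x \<odot> inv_of x \<odot> (y \<odot> inv_of y)"
    using assms inv by (intro mult_4) (auto simp: inv_of)
  then show "invertible (x \<odot> y)"
    using assms inv inv_of invertibleI[of "x \<odot> y" ?z] by (simp add: unit_left)
qed

lemma inv_of_mult:
  assumes "invertible x" "invertible y"
  shows "inv_of (x \<odot> y) = inv_of x \<odot> inv_of y"
proof (rule inv_of_eqI)
  have "x \<odot> y \<odot> (inv_of x \<odot> inv_of y) = x \<odot> inv_of x \<odot> (y \<odot> inv_of y)"
    using assms by (intro mult_4) (auto simp: inv_of invertible_D)
  then show "x \<odot> y \<odot> (inv_of x \<odot> inv_of y) = e"
    using assms inv_of by (simp add: unit_left)
qed (use assms inv_of invertible_D in auto)

lemma invertible_scaleR: "c \<noteq> 0 \<Longrightarrow> invertible x \<Longrightarrow> invertible (c *\<^sub>R x)"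
  unfolding invertible_def by (auto simp: mult_simps intro!: bexI[where x = "inverse c *\<^sub>R _"])

lemma invertible_unit: "invertible e"
  using unit_left by (auto intro: invertibleI)

lemma invertible_one_minus:
  assumes "z \<in> D" "norm z < 1"
  shows "invertible (e - z)"
proof -
  obtain u where u: "u \<in> D" "u = e + z \<odot> u"
    using neumann[of D z] closed_D assms by blast
  then have "(e - z) \<odot> u = e"
    by (simp add: D_simps) (metis add_diff_cancel_right')
  then show ?thesis
    using u assms by (auto intro: invertibleI)
qed

text \<open>From u - e = z u follows norm u \<le> 1 + norm z norm u, which bounds norm u. It is
  applied to a high power z of very small norm.\<close>

lemma norm_inv_one_minus:
  assumes "z \<in> D" "norm z < 1" "u \<in> D" "(e - z) \<odot> u = e"
  shows "norm (u - e) \<le> norm z / (1 - norm z)"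
proof -
  have u: "u - e = z \<odot> u"
    using assms by (simp add: D_simps algebra_simps)
  have "norm u \<le> norm (u - e) + norm e"
    by (metis diff_add_cancel norm_triangle_ineq)
  moreover have "norm (u - e) \<le> norm z * norm u"
    unfolding u by (rule norm_mult_le)
  ultimately have "norm u \<le> norm z * norm u + 1" 
    using norm_unit_le by linarith
  then have "(1 - norm z) * norm u \<le> 1"
    by (simp add: algebra_simps)
  then have "norm u \<le> 1 / (1 - norm z)"
    using assms by (simp add: field_simps)
  then have "norm z * norm u \<le> norm z / (1 - norm z)"
    using mult_left_mono[of "norm u" "1 / (1 - norm z)" "norm z"] by simp
  then show ?thesis
    using \<open>norm (u - e) \<le> norm z * norm u\<close> by linarith
qed

text \<open>Resolvent identity v - u = v (x - y) u for the inverses u of x and v of y. The smallness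
  hypothesis bounds the right-hand side by half of norm v, so norm v \<le> 2 norm u, and this is put
  back into the identity.\<close>

lemma norm_inv_of_diff_le:
  assumes "invertible x" "invertible y" "norm (inv_of x) * norm (x - y) \<le> 1/2"
  shows "norm (inv_of y - inv_of x) \<le> 2 * (norm (inv_of x))\<^sup>2 * norm (x - y)"
proof -
  let ?u = "inv_of x" and ?v = "inv_of y"
  have D: "x \<in> D" "y \<in> D" "?u \<in> D" "?v \<in> D"
    using assms inv_of invertible_D by auto
  have "?v - ?u = ?v \<odot> (x \<odot> ?u) - ?u \<odot> (y \<odot> ?v)"
    using assms D by (simp add: inv_of D_simps)
  also have "\<dots> = ?v \<odot> ((x - y) \<odot> ?u)"
    using D by (simp add: D_simps D_ac)
  finally have vu: "?v - ?u = ?v \<odot> ((x - y) \<odot> ?u)" .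
  have "norm (?v - ?u) \<le> norm ?v * norm ((x - y) \<odot> ?u)"
    unfolding vu by (rule norm_mult_le)
  also have "\<dots> \<le> norm ?v * (norm (x - y) * norm ?u)"
    by (intro mult_left_mono norm_mult_le) simp
  finally have le: "norm (?v - ?u) \<le> norm ?v * (norm (x - y) * norm ?u)" .
  also have "\<dots> \<le> norm ?v * (1/2)"
    using assms by (intro mult_left_mono) (simp_all add: mult.commute)
  finally have "norm ?v \<le> 2 * norm ?u"
    using norm_triangle_ineq2[of ?v ?u] by simp
  then have "norm ?v * (norm (x - y) * norm ?u) \<le> 2 * norm ?u * (norm (x - y) * norm ?u)"
    by (intro mult_right_mono) auto
  with le show ?thesis
    by (simp add: power2_eq_square mult.assoc mult.left_commute mult.commute)
qed

lemma continuous_on_inv_of: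
  assumes F: "continuous_on K F" and inv: "\<And>k. k \<in> K \<Longrightarrow> invertible (F k)"
  shows "continuous_on K (\<lambda>k. inv_of (F k))"
  unfolding continuous_on_def
proof
  fix k assume k: "k \<in> K"
  have lim: "((\<lambda>x. norm (F k - F x)) \<longlongrightarrow> 0) (at k within K)"
    using F k by (auto simp: continuous_on_def intro!: tendsto_eq_intros)
  have "((\<lambda>x. norm (inv_of (F k)) * norm (F k - F x)) \<longlongrightarrow> 0) (at k within K)"
    by (rule tendsto_mult_right_zero) (rule lim)
  then have "\<forall>\<^sub>F x in at k within K. norm (inv_of (F k)) * norm (F k - F x) < 1/2"
    by (rule order_tendstoD) simp
  moreover have "\<forall>\<^sub>F x in at k within K. x \<in> K"
    by (simp add: eventually_at_filter)
  ultimately have "\<forall>\<^sub>F x in at k within K.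
      norm (inv_of (F x) - inv_of (F k)) \<le> 2 * (norm (inv_of (F k)))\<^sup>2 * norm (F k - F x)"
    by eventually_elim (use k inv in \<open>auto intro: norm_inv_of_diff_le\<close>)
  moreover have "((\<lambda>x. 2 * (norm (inv_of (F k)))\<^sup>2 * norm (F k - F x)) \<longlongrightarrow> 0) (at k within K)"
    by (rule tendsto_mult_right_zero) (rule lim)
  ultimately have "((\<lambda>x. inv_of (F x) - inv_of (F k)) \<longlongrightarrow> 0) (at k within K)"
    by (rule Lim_null_comparison)
  then show "((\<lambda>x. inv_of (F x)) \<longlongrightarrow> inv_of (F k)) (at k within K)"
    by (simp add: LIM_zero_iff)
qed

section \<open>Resolvents on the unit circle in real terms\<close>

definition quad :: "'a \<Rightarrow> real \<Rightarrow> 'a" where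
  "quad x c = e - (2 * c) *\<^sub>R x + x \<odot> x"

text \<open>For w on the unit circle with real part c and conjugate w', \<open>quad x c\<close> is
  (e - w x)(e - w' x), and \<open>poisson x c\<close> is the real part of the inverse of e - w x,
  which is half the sum of e and the Poisson kernel (e - x^2) / \<open>quad x c\<close>. Both depend
  on w through c alone, so real scalars suffice.\<close>

definition poisson :: "'a \<Rightarrow> real \<Rightarrow> 'a" where
  "poisson x c = (e - c *\<^sub>R x) \<odot> inv_of (quad x c)"

lemma quad_D: "x \<in> D \<Longrightarrow> quad x c \<in> D"
  by (simp add: quad_def)

lemma poisson_D: "invertible (quad x c) \<Longrightarrow> x \<in> D \<Longrightarrow> poisson x c \<in> D"
  by (simp add: poisson_def inv_of)

text \<open>With x = r d, completing the square gives (x - c e)^2 + (1 - c^2) e. For c^2 < 1 this is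
  a multiple of some e + y^2. For c = 1 or c = -1 it is the square of e - x or e + x, where the
  Neumann series covers r < 1 and the hypotheses cover r = 1.\<close>

lemma invertible_quad:
  assumes d: "d \<in> D" "norm d \<le> 1" and inv: "invertible (e - d)" "invertible (e + d)"
    and r: "0 \<le> r" "r \<le> 1" and c: "-1 \<le> c" "c \<le> 1"
  shows "invertible (quad (r *\<^sub>R d) c)"
proof -
  have small: "invertible (e - s *\<^sub>R d)" if "\<bar>s\<bar> \<le> 1" for s :: real
  proof (cases "\<bar>s\<bar> = 1")
    case True
    then have "s = 1 \<or> s = -1" by linarith
    then show ?thesis using inv by auto
  next
    case False
    then have "\<bar>s\<bar> * norm d \<le> \<bar>s\<bar> * 1" using d by (intro mult_left_mono) auto
    then show ?thesis using False that d by (intro invertible_one_minus) auto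
  qed
  consider "c = 1" | "c = -1" | "c\<^sup>2 < 1"
  proof (cases "\<bar>c\<bar> < 1")
    case False
    then have "c = 1 \<or> c = -1" using c by linarith
    then show ?thesis using that by blast
  qed (use that abs_square_less_1 in blast)
  then show ?thesis
  proof cases
    case 1
    then have "quad (r *\<^sub>R d) c = (e - r *\<^sub>R d) \<odot> (e - r *\<^sub>R d)"
      using d by (simp add: quad_def D_simps algebra_simps scaleR_2 flip: scaleR_scaleR)
    then show ?thesis
      using small[of r] r invertible_mult_iff invertible_D by simp
  next
    case 2
    then have "quad (r *\<^sub>R d) c = (e - (-r) *\<^sub>R d) \<odot> (e - (-r) *\<^sub>R d)"
      using d by (simp add: quad_def D_simps algebra_simps scaleR_2 flip: scaleR_scaleR)
    then show ?thesis
      using small[of "-r"] r invertible_mult_iff invertible_D by simp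
  next
    case 3
    define y where "y = r *\<^sub>R d - c *\<^sub>R e"
    define s where "s = 1 / sqrt (1 - c\<^sup>2)"
    have s: "s * s = 1 / (1 - c\<^sup>2)"
      using 3 by (simp add: s_def)
    have "quad (r *\<^sub>R d) c = (1 - c\<^sup>2) *\<^sub>R e + y \<odot> y"
      using d by (simp add: y_def quad_def D_simps power2_eq_square algebra_simps mult_2
          scaleR_add_left) (simp flip: scaleR_add_left)
    also have "\<dots> = (1 - c\<^sup>2) *\<^sub>R (e + (s *\<^sub>R y) \<odot> (s *\<^sub>R y))"
      using 3 by (simp add: mult_simps s scaleR_add_right)
    finally have eq: "quad (r *\<^sub>R d) c = (1 - c\<^sup>2) *\<^sub>R (e + (s *\<^sub>R y) \<odot> (s *\<^sub>R y))" .
    have "s *\<^sub>R y \<in> D"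
      using d by (simp add: y_def)
    then have "invertible (e + (s *\<^sub>R y) \<odot> (s *\<^sub>R y))"
      using one_plus_square[of "s *\<^sub>R y"] by (auto simp: invertible_def)
    then show ?thesis
      unfolding eq using 3 by (intro invertible_scaleR) auto
  qed
qed

text \<open>(1 - w x)(1 + w x) = 1 - w^2 x^2: negating w negates c = cos \<theta>, and squaring w
  turns c into cos 2\<theta> = 2 c^2 - 1.\<close>

lemma quad_double:
  assumes "x \<in> D"
  shows "quad x c \<odot> quad x (- c) = quad (x \<odot> x) (2 * c\<^sup>2 - 1)"
proof -
  have "quad x c \<odot> quad x (- c) = pc ([:1, - 2 * c, 1:] * [:1, 2 * c, 1:]) x"
    using assms by (simp only: pc_mult) (simp add: quad_def D_simps)
  also have "[:1, - 2 * c, 1:] * [:1, 2 * c, 1:] = [:1, 0, - 2 * (2 * c\<^sup>2 - 1), 0, 1:]"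
    by (simp add: power2_eq_square)
  also have "pc \<dots> x = quad (x \<odot> x) (2 * c\<^sup>2 - 1)"
    using assms by (simp add: quad_def D_simps assoc) (simp add: algebra_simps)
  finally show ?thesis .
qed

text \<open>With \<open>c = cos \<theta>\<close> this is the real part of
  \<open>1 / (1 - e\<^bsup>i\<theta>\<^esup> x) + 1 / (1 + e\<^bsup>i\<theta>\<^esup> x) = 2 / (1 - e\<^bsup>2i\<theta>\<^esup> x\<^sup>2)\<close>.\<close>

lemma poisson_double:
  assumes x: "x \<in> D" and inv: "invertible (quad x c)" "invertible (quad x (- c))"
  shows "poisson (x \<odot> x) (2 * c\<^sup>2 - 1) = (1/2) *\<^sub>R (poisson x c + poisson x (- c))"
proof -
  define u v where "u = inv_of (quad x c)" and "v = inv_of (quad x (- c))"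
  define p q where "p = quad x c" and "q = quad x (- c)"
  have uv: "u \<in> D" "v \<in> D" "p \<in> D" "q \<in> D" "p \<odot> u = e" "q \<odot> v = e"
    using inv inv_of invertible_D by (auto simp: u_def v_def p_def q_def)
  let ?m = "e - c *\<^sub>R x" and ?n = "e + c *\<^sub>R x"
  have mn: "?m \<in> D" "?n \<in> D" using x by auto
  have "?m \<odot> q + ?n \<odot> p = pc ([:1, - c:] * [:1, 2 * c, 1:] + [:1, c:] * [:1, - 2 * c, 1:]) x"
    using x by (simp only: pc_add pc_mult) (simp add: p_def q_def quad_def D_simps)
  also have "[:1, - c:] * [:1, 2 * c, 1:] + [:1, c:] * [:1, - 2 * c, 1:] =
      smult 2 [:1, 0, - (2 * c\<^sup>2 - 1):]"
    by (simp add: power2_eq_square)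
  also have "pc \<dots> x = 2 *\<^sub>R (e - (2 * c\<^sup>2 - 1) *\<^sub>R (x \<odot> x))"
    using x by (simp only: pc_smult) (simp add: D_simps, simp add: algebra_simps)
  finally have "2 *\<^sub>R (e - (2 * c\<^sup>2 - 1) *\<^sub>R (x \<odot> x)) \<odot> (u \<odot> v) =
      ?m \<odot> q \<odot> (u \<odot> v) + ?n \<odot> p \<odot> (u \<odot> v)"
    by (metis add_left)
  also have "\<dots> = ?m \<odot> u \<odot> (q \<odot> v) + ?n \<odot> v \<odot> (p \<odot> u)"
    using mn uv comm[of u v] mult_4[of ?m q u v] mult_4[of ?n p v u] by simp
  also have "\<dots> = ?m \<odot> u + ?n \<odot> v"
    using mn uv by (simp add: unit_right)
  finally have "2 *\<^sub>R (e - (2 * c\<^sup>2 - 1) *\<^sub>R (x \<odot> x)) \<odot> (u \<odot> v) = ?m \<odot> u + ?n \<odot> v" .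
  moreover have "inv_of (quad (x \<odot> x) (2 * c\<^sup>2 - 1)) = u \<odot> v"
    using inv x by (simp add: u_def v_def inv_of_mult flip: quad_double)
  ultimately have "2 *\<^sub>R poisson (x \<odot> x) (2 * c\<^sup>2 - 1) = poisson x c + poisson x (- c)"
    by (simp add: poisson_def u_def v_def scaleR_left)
  then show ?thesis
    by (metis scaleR_half_double scaleR_2 scaleR_scaleR scaleR_one nonzero_eq_divide_eq
        zero_neq_numeral)
qed

abbreviation sq_iter :: "nat \<Rightarrow> 'a \<Rightarrow> 'a" where
  "sq_iter k x \<equiv> ((\<lambda>x. x \<odot> x) ^^ k) x"

lemma sq_iter_D: "x \<in> D \<Longrightarrow> sq_iter k x \<in> D"
  by (induction k) auto

lemma norm_sq_iter: "x \<in> D \<Longrightarrow> norm (sq_iter k x) = norm x ^ 2 ^ k"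
  by (induction k) (auto simp: norm_square sq_iter_D simp flip: power_mult simp: mult.commute)

text \<open>By \<open>poisson_double\<close> a value at a square is the mean of two values at the
  previous stage, so the bound \<epsilon> survives any number of squarings.\<close>

lemma poisson_sq_iter_close:
  assumes x: "x \<in> D" and y: "y \<in> D"
    and inv: "\<And>c. c \<in> {-1..1} \<Longrightarrow> invertible (quad x c)"
      "\<And>c. c \<in> {-1..1} \<Longrightarrow> invertible (quad y c)"
    and close: "\<And>c. c \<in> {-1..1} \<Longrightarrow> norm (poisson x c - poisson y c) \<le> \<epsilon>"
  shows "c \<in> {-1..1} \<Longrightarrow> invertible (quad (sq_iter k x) c) \<and> invertible (quad (sq_iter k y) c) \<and>
    norm (poisson (sq_iter k x) c - poisson (sq_iter k y) c) \<le> \<epsilon>"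
proof (induction k arbitrary: c)
  case 0
  then show ?case using inv close by simp
next
  case (Suc k)
  let ?x = "sq_iter k x" and ?y = "sq_iter k y"
  \<comment> \<open>Half-angle formula: \<open>b\<close> is the cosine of half the angle whose
    cosine is \<open>c\<close>.\<close>
  define b where "b = sqrt ((1 + c) / 2)"
  have bc: "c = 2 * b\<^sup>2 - 1"
    using Suc.prems by (simp add: b_def field_simps)
  have b: "b \<in> {-1..1}" "- b \<in> {-1..1}"
    using Suc.prems by (auto simp: b_def real_le_lsqrt intro: order.trans[of _ 0])
  note IH = Suc.IH[OF b(1)] Suc.IH[OF b(2)]
  have D: "?x \<in> D" "?y \<in> D"
    using x y sq_iter_D by auto
  have "poisson (?x \<odot> ?x) c - poisson (?y \<odot> ?y) c =
      (1/2) *\<^sub>R ((poisson ?x b - poisson ?y b) + (poisson ?x (- b) - poisson ?y (- b)))"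
    unfolding bc using IH D by (simp add: poisson_double algebra_simps)
  also have "norm \<dots> \<le> (1/2) * (\<epsilon> + \<epsilon>)"
    using IH by (simp add: norm_triangle_le)
  finally have "norm (poisson (?x \<odot> ?x) c - poisson (?y \<odot> ?y) c) \<le> \<epsilon>" by simp
  moreover have "invertible (quad (?x \<odot> ?x) c)" "invertible (quad (?y \<odot> ?y) c)"
    unfolding bc using IH D by (simp_all add: quad_D invertible_mult_iff flip: quad_double)
  ultimately show ?case by simp
qed

lemma quad_1: "x \<in> D \<Longrightarrow> quad x 1 = (e - x) \<odot> (e - x)"
  by (simp add: quad_def D_simps algebra_simps scaleR_2)

lemma poisson_1:
  assumes "x \<in> D" "invertible (quad x 1)"
  shows "(e - x) \<odot> poisson x 1 = e"
  using assms inv_of(2)[of "quad x 1"] by (simp add: poisson_def quad_1 assoc)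

text \<open>Rickart's proof of the spectral radius formula: if \<open>e - z d\<close> were invertible on the whole
  closed unit disc, then \<open>(e - r\<^sup>n d\<^sup>n)\<^bsup>-1\<^esup>\<close> would tend to \<open>(e - d\<^sup>n)\<^bsup>-1\<^esup>\<close>
  as \<open>r \<rightarrow> 1\<close> uniformly in the powers \<open>n\<close> of two, which is incompatible with
  \<open>\<parallel>d\<^sup>n\<parallel> = 1\<close>.\<close>

lemma not_invertible_one_minus_plus:
  assumes d: "d \<in> D" "norm d = 1"
  shows "\<not> (invertible (e - d) \<and> invertible (e + d))"
proof
  assume "invertible (e - d) \<and> invertible (e + d)"
  then have inv: "invertible (quad (r *\<^sub>R d) c)" if "r \<in> {0..1}" "c \<in> {-1..1}" for r c
    using that d invertible_quad[of d r c] by auto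
  let ?K = "{0..1::real} \<times> {-1..1::real}"
  have "continuous_on ?K (\<lambda>z. quad (fst z *\<^sub>R d) (snd z))"
    unfolding quad_def by (intro continuous_intros continuous_on)
  then have "continuous_on ?K (\<lambda>z. inv_of (quad (fst z *\<^sub>R d) (snd z)))"
    by (rule continuous_on_inv_of) (auto intro: inv)
  then have "continuous_on ?K (\<lambda>z. poisson (fst z *\<^sub>R d) (snd z))"
    unfolding poisson_def by (intro continuous_intros continuous_on)
  then have "uniformly_continuous_on ?K (\<lambda>z. poisson (fst z *\<^sub>R d) (snd z))"
    by (rule compact_uniformly_continuous) (intro compact_Times compact_Icc)
  then obtain \<eta> where \<eta>: "\<eta> > 0" and unif: "\<And>z w. z \<in> ?K \<Longrightarrow> w \<in> ?K \<Longrightarrow> dist w z < \<eta> \<Longrightarrow>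
      dist (poisson (fst w *\<^sub>R d) (snd w)) (poisson (fst z *\<^sub>R d) (snd z)) < 1/5"
    unfolding uniformly_continuous_on_def by (metis zero_less_divide_1_iff zero_less_numeral)
  define r where "r = 1 - min (\<eta> / 2) (1/2)"
  have r: "0 < r" "r < 1" "\<bar>1 - r\<bar> < \<eta>"
    using \<eta> by (auto simp: r_def)
  have close: "norm (poisson (r *\<^sub>R d) c - poisson d c) \<le> 1/5" if "c \<in> {-1..1}" for c
    using unif[of "(1, c)" "(r, c)"] that r
    by (simp add: dist_norm norm_Pair abs_minus_commute)
  have rd: "r *\<^sub>R d \<in> D" using d by simp
  have sq: "invertible (quad (sq_iter k (r *\<^sub>R d)) 1)" "invertible (quad (sq_iter k d) 1)"
    "norm (poisson (sq_iter k (r *\<^sub>R d)) 1 - poisson (sq_iter k d) 1) \<le> 1/5" for k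
    using poisson_sq_iter_close[OF rd d(1) _ _ close, of 1 k] inv[of r] inv[of 1] r by auto
  \<comment> \<open>With norm x < 1/10 the inverse u of e - x is within 1/9 of e, so the inverse v
    of e - y is within 1/5 + 1/9 of e. As y = (v - e)(e - y) and norm (e - y) \<le> 2, this yields
    norm y \<le> 28/45, whereas norm y = 1.\<close>
  obtain k where k: "r ^ k < 1/10"
    using real_arch_pow_inv[of "1/10" r] r by auto
  let ?x = "sq_iter k (r *\<^sub>R d)" and ?y = "sq_iter k d"
  define u v where "u = poisson ?x 1" and "v = poisson ?y 1"
  have D: "?x \<in> D" "?y \<in> D" using rd d sq_iter_D by auto
  then have uv: "u \<in> D" "v \<in> D" "(e - ?x) \<odot> u = e" "(e - ?y) \<odot> v = e"
    using poisson_1 poisson_D sq by (auto simp: u_def v_def)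
  have "r ^ 2 ^ k \<le> r ^ k"
    using r less_exp[of k] by (intro power_decreasing) (auto intro: less_imp_le)
  then have nx: "norm ?x < 1/10"
    using norm_sq_iter[OF rd, of k] d r(1) k by simp
  have "norm (u - e) \<le> norm ?x / (1 - norm ?x)"
    using norm_inv_one_minus[OF D(1) _ uv(1,3)] nx by simp
  also have "\<dots> \<le> 1/9"
    using nx by (simp add: field_simps)
  finally have "norm (v - e) \<le> 1/5 + 1/9"
    using sq(3)[of k] norm_triangle_ineq[of "v - u" "u - e"]
    by (simp add: u_def v_def norm_minus_commute)
  have "?y = (v - e) \<odot> (e - ?y)"
  proof -
    have "(v - e) \<odot> (e - ?y) = v \<odot> (e - ?y) - (e - ?y)"
      using D uv by (simp add: diff_left unit_left)
    also have "v \<odot> (e - ?y) = e"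
      using D uv comm[of v "e - ?y"] by simp
    finally show ?thesis by simp
  qed
  then have "norm ?y \<le> norm (v - e) * norm (e - ?y)"
    using norm_mult_le by metis
  also have "\<dots> \<le> (1/5 + 1/9) * (1 + 1)"
  proof (rule mult_mono)
    show "norm (e - ?y) \<le> 1 + 1"
      using norm_triangle_ineq4[of e ?y] norm_unit_le norm_sq_iter[OF d(1), of k] d by simp
  qed (use \<open>norm (v - e) \<le> 1/5 + 1/9\<close> in auto)
  finally show False
    using norm_sq_iter[OF d(1), of k] d by simp
qed

section \<open>The spectrum\<close>

definition spec :: "'a \<Rightarrow> real set" where
  "spec a = {t. \<not> invertible (a - t *\<^sub>R e)}"

text \<open>Scaling to norm one reduces this to \<open>not_invertible_one_minus_plus\<close>. It
  takes the place of the spectral radius formula.\<close>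

lemma norm_in_spec:
  assumes d: "d \<in> D" "d \<noteq> 0"
  shows "norm d \<in> spec d \<or> - norm d \<in> spec d"
proof (rule ccontr)
  define n where "n = norm d"
  have n: "n > 0" using d by (simp add: n_def)
  assume "\<not> (norm d \<in> spec d \<or> - norm d \<in> spec d)"
  then have inv: "invertible (d - n *\<^sub>R e)" "invertible (d + n *\<^sub>R e)"
    by (auto simp: spec_def n_def)
  have "invertible ((- inverse n) *\<^sub>R (d - n *\<^sub>R e))" "invertible (inverse n *\<^sub>R (d + n *\<^sub>R e))"
    using inv n by (auto intro!: invertible_scaleR simp del: scaleR_minus_left)
  moreover have "(- inverse n) *\<^sub>R (d - n *\<^sub>R e) = e - inverse n *\<^sub>R d"
    "inverse n *\<^sub>R (d + n *\<^sub>R e) = e + inverse n *\<^sub>R d"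
    using n by (auto simp: algebra_simps)
  moreover have "norm (inverse n *\<^sub>R d) = 1"
    using n by (simp add: n_def)
  ultimately show False
    using not_invertible_one_minus_plus[of "inverse n *\<^sub>R d"] d by simp
qed

lemma spec_subset:
  assumes "a \<in> D"
  shows "spec a \<subseteq> {- norm a..norm a}"
proof
  fix t assume t: "t \<in> spec a"
  show "t \<in> {- norm a..norm a}"
  proof (rule ccontr)
    assume "t \<notin> {- norm a..norm a}"
    then have *: "\<bar>t\<bar> > norm a" "t \<noteq> 0" by auto
    then have "invertible (e - inverse t *\<^sub>R a)"
      using assms by (intro invertible_one_minus) (auto simp: field_simps)
    then have "invertible ((- t) *\<^sub>R (e - inverse t *\<^sub>R a))"
      using * by (intro invertible_scaleR) auto
    also have "(- t) *\<^sub>R (e - inverse t *\<^sub>R a) = a - t *\<^sub>R e"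
      using * by (simp add: algebra_simps)
    finally show False using t by (simp add: spec_def)
  qed
qed

lemma closed_spec:
  assumes a: "a \<in> D"
  shows "closed (spec a)"
proof -
  have "\<exists>\<delta>>0. \<forall>s. dist s t < \<delta> \<longrightarrow> s \<notin> spec a" if t: "t \<notin> spec a" for t
  proof -
    define u where "u = inv_of (a - t *\<^sub>R e)"
    have u: "u \<in> D" "(a - t *\<^sub>R e) \<odot> u = e"
      using t inv_of by (auto simp: spec_def u_def)
    \<comment> \<open>a - s e = (a - t e)(e - (s - t) u), where the second factor falls under the
      Neumann series. Adding 1 to norm u keeps the radius positive when u = 0, as in the zero
      algebra.\<close>
    have "s \<notin> spec a" if s: "dist s t < 1 / (norm u + 1)" for s
    proof -
      have "\<bar>s - t\<bar> * norm u \<le> \<bar>s - t\<bar> * (norm u + 1)"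
        by (intro mult_left_mono) auto
      also have "\<dots> < 1"
        using s by (simp add: dist_norm pos_less_divide_eq add_nonneg_pos)
      finally have "invertible (e - (s - t) *\<^sub>R u)"
        using u by (intro invertible_one_minus) auto
      then have "invertible ((a - t *\<^sub>R e) \<odot> (e - (s - t) *\<^sub>R u))"
        using a t u by (simp add: invertible_mult_iff spec_def)
      also have "(a - t *\<^sub>R e) \<odot> (e - (s - t) *\<^sub>R u) = a - s *\<^sub>R e"
        using a u by (simp only: diff_right scaleR_right) (simp add: unit_right algebra_simps)
      finally show ?thesis by (simp add: spec_def)
    qed
    then show ?thesis
      by (intro exI[of _ "1 / (norm u + 1)"]) (auto simp: add_nonneg_pos)
  qed
  then show ?thesis
    unfolding closed_open open_dist by (metis ComplD ComplI dist_commute)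
qed

lemma compact_spec: "a \<in> D \<Longrightarrow> compact (spec a)"
  using closed_spec spec_subset bounded_subset bounded_closed_interval
  by (metis compact_eq_bounded_closed)

end

section \<open>Functional calculus\<close>

text \<open>A complex root z that is not real is a root of the remainder of q modulo its real
  minimal polynomial; this remainder is at most linear and real, hence zero. The quadratic is (t -
  s)^2 + b^2, the shape that invertibility of e + y^2 can handle.\<close>

lemma real_poly_linear_or_quadratic_factor:
  fixes q :: "real poly"
  assumes "degree q > 0"
  shows "(\<exists>t. poly q t = 0) \<or> (\<exists>s b. b \<noteq> 0 \<and> [:s\<^sup>2 + b\<^sup>2, - 2 * s, 1:] dvd q)"
proof -
  define ev where "ev q z = poly (map_poly complex_of_real q) z" for q z
  have ev_pCons: "ev (pCons c p) z = of_real c + z * ev p z" for c p z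
    by (simp add: ev_def map_poly_pCons)
  have ev_0: "ev 0 z = 0" for z
    by (simp add: ev_def)
  have ev_add: "ev (p + r) z = ev p z + ev r z" for p r z
    by (induction p r rule: poly_induct2) (simp_all add: ev_pCons ev_0 algebra_simps)
  have ev_smult: "ev (smult c p) z = of_real c * ev p z" for c p z
    by (induction p) (simp_all add: ev_pCons ev_0 algebra_simps)
  have ev_mult: "ev (p * r) z = ev p z * ev r z" for p r z
    by (induction p) (simp_all add: ev_pCons ev_0 ev_add ev_smult algebra_simps)
  have ev_real: "ev p (of_real t) = of_real (poly p t)" for p t
    by (induction p) (simp_all add: ev_pCons ev_0)
  have "degree (map_poly complex_of_real q) = degree q"
    by (rule degree_map_poly) simp
  then have "\<not> constant (poly (map_poly complex_of_real q))"
    using assms by (simp add: constant_degree)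
  then obtain z where z: "ev q z = 0"
    using fundamental_theorem_of_algebra unfolding ev_def by blast
  show ?thesis
  proof (cases "Im z = 0")
    case True
    then have "z = of_real (Re z)" by (simp add: complex_eq_iff)
    then have "poly q (Re z) = 0"
      using z ev_real[of q "Re z"] by simp
    then show ?thesis by blast
  next
    case False
    define m where "m = [:(Re z)\<^sup>2 + (Im z)\<^sup>2, - 2 * Re z, 1:]"
    have "ev m z = 0"
      by (simp add: m_def ev_pCons ev_0 complex_eq_iff power2_eq_square algebra_simps)
    moreover have "ev q z = ev m z * ev (q div m) z + ev (q mod m) z"
      by (metis ev_add ev_mult mult_div_mod_eq)
    ultimately have mod: "ev (q mod m) z = 0"
      using z by simp
    have "m \<noteq> 0" "degree m = 2" by (auto simp: m_def)
    then have "degree (q mod m) < 2 \<or> q mod m = 0"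
      using degree_mod_less[of m q] by auto
    then have deg: "degree (q mod m) < 2" by auto
    obtain r0 r1 where r: "q mod m = [:r0, r1:]"
    proof (rule that, rule poly_eqI)
      show "coeff (q mod m) n = coeff [:coeff (q mod m) 0, coeff (q mod m) 1:] n" for n
        using deg by (auto simp: coeff_pCons coeff_eq_0 split: nat.split)
    qed
    have "r0 + r1 * Re z = 0" "r1 * Im z = 0"
      using mod by (auto simp: r ev_pCons ev_0 complex_eq_iff mult.commute)
    then have "q mod m = 0"
      using False by (simp add: r)
    then have "m dvd q" by (simp add: dvd_eq_mod_eq_0)
    then show ?thesis
      using False unfolding m_def by blast
  qed
qed

lemma continuous_poly_approximation:
  fixes f :: "real \<Rightarrow> real"
  assumes "compact S" "continuous_on S f"
  obtains p where "uniform_limit S (\<lambda>n. poly (p n)) f sequentially"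
proof -
  have "\<exists>p. \<forall>x\<in>S. \<bar>poly p x - f x\<bar> < inverse (real (Suc n))" for n
  proof -
    obtain g where g: "real_polynomial_function g" "\<And>x. x \<in> S \<Longrightarrow> \<bar>f x - g x\<bar> < inverse (real (Suc n))"
      using Stone_Weierstrass_real_polynomial_function[OF assms, of "inverse (real (Suc n))"]
      by (metis inverse_positive_iff_positive of_nat_0_less_iff zero_less_Suc)
    obtain a N where "g = (\<lambda>x. \<Sum>i\<le>N. a i * x ^ i)"
      using g(1) real_polynomial_function_iff_sum by auto
    then have "poly (\<Sum>i\<le>N. monom (a i) i) = g"
      by (simp add: fun_eq_iff poly_sum poly_monom)
    then show ?thesis
      using g(2) by (intro exI[of _ "\<Sum>i\<le>N. monom (a i) i"]) (simp add: abs_minus_commute)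
  qed
  then obtain p where p: "\<And>n x. x \<in> S \<Longrightarrow> \<bar>poly (p n) x - f x\<bar> < inverse (real (Suc n))"
    by metis
  have "uniform_limit S (\<lambda>n. poly (p n)) f sequentially"
  proof (rule uniform_limitI)
    fix \<epsilon> :: real assume "\<epsilon> > 0"
    then have "\<forall>\<^sub>F n in sequentially. inverse (real (Suc n)) < \<epsilon>"
      by (rule order_tendstoD[OF LIMSEQ_inverse_real_of_nat])
    then show "\<forall>\<^sub>F n in sequentially. \<forall>x\<in>S. dist (poly (p n) x) (f x) < \<epsilon>"
      by eventually_elim (use p in \<open>auto simp: dist_real_def intro: less_trans\<close>)
  qed
  then show thesis by (rule that)
qed

section \<open>Spectral mapping and the norm bound for polynomials\<close>

context comm_real_cstar
begin

lemma pc_const: "pc [:c:] a = c *\<^sub>R e"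
  by (simp add: mult_simps)

text \<open>Induction on the degree, splitting off one factor at a time: a linear factor is
  invertible because its root lies outside the spectrum, and a quadratic one is b^2 (e + y^2) with y
  = (a - s e) / b.\<close>

lemma invertible_pc:
  assumes a: "a \<in> D"
  shows "q \<noteq> 0 \<Longrightarrow> (\<And>t. t \<in> spec a \<Longrightarrow> poly q t \<noteq> 0) \<Longrightarrow> invertible (pc q a)"
proof (induction "degree q" arbitrary: q rule: less_induct)
  case less
  show ?case
  proof (cases "degree q = 0")
    case True
    then obtain c where "q = [:c:]" by (rule degree_eq_zeroE)
    then show ?thesis
      using less.prems invertible_scaleR[of c e] invertible_unit by (simp add: mult_simps)
  next
    case False
    have factor: "invertible (pc q a)" if q: "q = m * k" and m: "invertible (pc m a)" "degree m > 0" for m k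
    proof -
      have "k \<noteq> 0" "m \<noteq> 0" using q less.prems by auto
      then have "invertible (pc k a)"
        using less.prems(2) m q by (intro less.hyps) (auto simp: degree_mult_eq)
      then show ?thesis
        using a m by (simp add: q pc_mult invertible_mult_iff)
    qed
    consider t where "poly q t = 0" | s b where "b \<noteq> 0" "[:s\<^sup>2 + b\<^sup>2, - 2 * s, 1:] dvd q"
      using real_poly_linear_or_quadratic_factor[of q] False by blast
    then show ?thesis
    proof cases
      case 1
      then obtain k where k: "q = [:- t, 1:] * k"
        by (auto simp: poly_eq_0_iff_dvd dvd_def)
      have "t \<notin> spec a" using 1 less.prems by blast
      then have "invertible (pc [:- t, 1:] a)"
        using a by (simp add: spec_def D_simps add.commute)
      from factor[OF k this] show ?thesis by simp
    next
      case 2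
      then obtain k where k: "q = [:s\<^sup>2 + b\<^sup>2, - 2 * s, 1:] * k"
        by (auto simp: dvd_def)
      define y where "y = inverse b *\<^sub>R (a - s *\<^sub>R e)"
      have y: "y \<in> D" using a by (simp add: y_def)
      have "pc [:s\<^sup>2 + b\<^sup>2, - 2 * s, 1:] a = pc ([:b\<^sup>2:] + [:- s, 1:] * [:- s, 1:]) a"
        by (simp add: power2_eq_square algebra_simps)
      also have "\<dots> = b\<^sup>2 *\<^sub>R e + (b *\<^sub>R y) \<odot> (b *\<^sub>R y)"
        using a 2 by (simp only: pc_add pc_mult) (simp add: y_def D_simps)
      also have "\<dots> = b\<^sup>2 *\<^sub>R (e + y \<odot> y)"
        by (simp add: mult_simps power2_eq_square scaleR_add_right)
      also have "invertible \<dots>"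
        using one_plus_square[OF y] y 2 by (intro invertible_scaleR) (auto simp: invertible_def)
      finally have "invertible (pc [:s\<^sup>2 + b\<^sup>2, - 2 * s, 1:] a)" .
      from factor[OF k this] show ?thesis by simp
    qed
  qed
qed

lemma not_invertible_0: "e \<noteq> 0 \<Longrightarrow> \<not> invertible 0"
  by (auto simp: invertible_def zero_left)

lemma spec_nonempty: "a \<in> D \<Longrightarrow> e \<noteq> 0 \<Longrightarrow> spec a \<noteq> {}"
proof (cases "a = 0")
  case True
  then show "e \<noteq> 0 \<Longrightarrow> spec a \<noteq> {}"
    using not_invertible_0 by (auto simp: spec_def intro: exI[of _ 0])
qed (use norm_in_spec[of a] in blast)

text \<open>The norm of p(a) is the modulus of a spectral value \<mu> of p(a). As p(a) - \<mu> e is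
  not invertible, p - \<mu> vanishes somewhere on the spectrum of a, so \<mu> is a value of p
  there.\<close>

lemma norm_pc_le:
  assumes a: "a \<in> D" and B: "B \<ge> 0" "\<And>t. t \<in> spec a \<Longrightarrow> \<bar>poly p t\<bar> \<le> B"
  shows "norm (pc p a) \<le> B"
proof (cases "pc p a = 0")
  case False
  then have e: "e \<noteq> 0"
    using a unit_left[of "pc p a"] by (auto simp: zero_left)
  obtain \<mu> where \<mu>: "\<mu> \<in> spec (pc p a)" "\<bar>\<mu>\<bar> = norm (pc p a)"
    using norm_in_spec[OF pc_D[OF a] False] by force
  then have "\<not> invertible (pc (p - [:\<mu>:]) a)"
    by (simp add: spec_def pc_diff pc_const)
  \<comment> \<open>This serves the case where p is the constant \<mu>: any spectral point will do,
    once there is one.\<close>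
  moreover obtain t0 where "t0 \<in> spec a"
    using spec_nonempty a e by blast
  ultimately obtain t where "t \<in> spec a" "poly (p - [:\<mu>:]) t = 0"
    using invertible_pc[OF a, of "p - [:\<mu>:]"] by (cases "p - [:\<mu>:] = 0") auto
  then have "poly p t = \<mu>" by simp
  then show ?thesis using B(2)[OF \<open>t \<in> spec a\<close>] \<mu>(2) by simp
qed (use B in simp)

section \<open>Continuous functions of one element\<close>

definition fc :: "(real \<Rightarrow> real) \<Rightarrow> 'a \<Rightarrow> 'a" where
  "fc f a = (THE b. b \<in> D \<and>
     (\<forall>p. uniform_limit (spec a) (\<lambda>n. poly (p n)) f sequentially \<longrightarrow> (\<lambda>n. pc (p n) a) \<longlonglongrightarrow> b))"

lemma pc_diff_tendsto_0:
  assumes a: "a \<in> D" and "uniform_limit (spec a) (\<lambda>n. poly (p n)) f sequentially"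
    "uniform_limit (spec a) (\<lambda>n. poly (q n)) f sequentially"
  shows "(\<lambda>n. pc (p n) a - pc (q n) a) \<longlonglongrightarrow> 0"
proof (rule LIMSEQ_I)
  fix \<epsilon> :: real assume \<epsilon>: "\<epsilon> > 0"
  have "uniform_limit (spec a) (\<lambda>n t. poly (p n) t - poly (q n) t) (\<lambda>t. f t - f t) sequentially"
    by (intro uniform_limit_intros assms)
  then have "\<forall>\<^sub>F n in sequentially. \<forall>t\<in>spec a. dist (poly (p n) t - poly (q n) t) (f t - f t) < \<epsilon> / 2"
    by (rule uniform_limitD) (use \<epsilon> in simp)
  then have "\<forall>\<^sub>F n in sequentially. norm (pc (p n) a - pc (q n) a) \<le> \<epsilon> / 2"
    by eventually_elim
      (unfold pc_diff[symmetric], rule norm_pc_le, use a \<epsilon> in \<open>auto simp: dist_norm intro: less_imp_le\<close>)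
  then have "\<forall>\<^sub>F n in sequentially. norm (pc (p n) a - pc (q n) a - 0) < \<epsilon>"
    by eventually_elim (use \<epsilon> in auto)
  then show "\<exists>N. \<forall>n\<ge>N. norm (pc (p n) a - pc (q n) a - 0) < \<epsilon>"
    by (simp add: eventually_sequentially)
qed

lemma pc_convergent:
  assumes a: "a \<in> D" and lim: "uniform_limit (spec a) (\<lambda>n. poly (p n)) f sequentially"
  obtains b where "b \<in> D" "(\<lambda>n. pc (p n) a) \<longlonglongrightarrow> b"
proof -
  have "Cauchy (\<lambda>n. pc (p n) a)"
  proof (rule CauchyI)
    fix \<epsilon> :: real assume \<epsilon>: "\<epsilon> > 0"
    then have "\<forall>\<^sub>F n in sequentially. \<forall>t\<in>spec a. dist (poly (p n) t) (f t) < \<epsilon> / 4"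
      using uniform_limitD[OF lim, of "\<epsilon> / 4"] by simp
    then obtain N where N: "\<And>n t. n \<ge> N \<Longrightarrow> t \<in> spec a \<Longrightarrow> \<bar>poly (p n) t - f t\<bar> < \<epsilon> / 4"
      by (auto simp: eventually_sequentially dist_real_def)
    have "norm (pc (p m) a - pc (p n) a) < \<epsilon>" if "m \<ge> N" "n \<ge> N" for m n
    proof -
      have "norm (pc (p m - p n) a) \<le> \<epsilon> / 2"
      proof (rule norm_pc_le)
        fix t assume "t \<in> spec a"
        then show "\<bar>poly (p m - p n) t\<bar> \<le> \<epsilon> / 2"
          using N[of m t] N[of n t] that by (simp add: abs_if split: if_splits)
      qed (use a \<epsilon> in auto)
      then show ?thesis using \<epsilon> by (simp add: pc_diff)
    qed
    then show "\<exists>N. \<forall>m\<ge>N. \<forall>n\<ge>N. norm (pc (p m) a - pc (p n) a) < \<epsilon>" by blast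
  qed
  then obtain b where b: "(\<lambda>n. pc (p n) a) \<longlonglongrightarrow> b"
    using Cauchy_convergent_iff convergent_def by blast
  moreover have "b \<in> D"
    using closed_sequentially[OF closed_D _ b] a by simp
  ultimately show thesis using that by blast
qed

text \<open>Two sequences approximating the same function have images whose difference tends to 0,
  so one sequence determines the value. The algebraic rules then follow by combining sequences
  termwise.\<close>

lemma fc_eqI:
  assumes a: "a \<in> D" and lim: "uniform_limit (spec a) (\<lambda>n. poly (p n)) f sequentially"
    and b: "(\<lambda>n. pc (p n) a) \<longlonglongrightarrow> b"
  shows "fc f a = b"
  unfolding fc_def
proof (rule the_equality)
  have bD: "b \<in> D"
    using closed_sequentially[OF closed_D _ b] a by simp
  have "(\<lambda>n. pc (q n) a) \<longlonglongrightarrow> b"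
    if "uniform_limit (spec a) (\<lambda>n. poly (q n)) f sequentially" for q
    using tendsto_add[OF pc_diff_tendsto_0[OF a that lim] b] by simp
  with bD show "b \<in> D \<and> (\<forall>p. uniform_limit (spec a) (\<lambda>n. poly (p n)) f sequentially \<longrightarrow>
      (\<lambda>n. pc (p n) a) \<longlonglongrightarrow> b)" by blast
  fix c assume "c \<in> D \<and> (\<forall>p. uniform_limit (spec a) (\<lambda>n. poly (p n)) f sequentially \<longrightarrow>
      (\<lambda>n. pc (p n) a) \<longlonglongrightarrow> c)"
  then show "c = b" using lim b LIMSEQ_unique by blast
qed

lemma fc_tendsto:
  assumes "a \<in> D" "uniform_limit (spec a) (\<lambda>n. poly (p n)) f sequentially"
  shows "(\<lambda>n. pc (p n) a) \<longlonglongrightarrow> fc f a"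
  using pc_convergent[OF assms] fc_eqI[OF assms] by metis

lemma spec_approx:
  assumes "a \<in> D" "continuous_on (spec a) f"
  obtains p where "uniform_limit (spec a) (\<lambda>n. poly (p n)) f sequentially" "(\<lambda>n. pc (p n) a) \<longlonglongrightarrow> fc f a"
  using continuous_poly_approximation[OF compact_spec[OF assms(1)] assms(2)] fc_tendsto[OF assms(1)]
  by metis

lemma fc_D [simp, intro]:
  assumes "a \<in> D" "continuous_on (spec a) f"
  shows "fc f a \<in> D"
  using spec_approx[OF assms] closed_sequentially[OF closed_D] pc_D[OF assms(1)] by metis

lemma fc_poly:
  assumes "a \<in> D"
  shows "fc (poly p) a = pc p a"
  using assms fc_eqI[of a "\<lambda>_. p" "poly p"] by (simp add: uniform_limit_const)

lemma fc_cong: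
  assumes "\<And>t. t \<in> spec a \<Longrightarrow> f t = g t"
  shows "fc f a = fc g a"
proof -
  have "uniform_limit (spec a) (\<lambda>n. poly (p n)) f sequentially \<longleftrightarrow>
      uniform_limit (spec a) (\<lambda>n. poly (p n)) g sequentially" for p :: "nat \<Rightarrow> real poly"
    by (rule uniform_limit_cong') (use assms in auto)
  then show ?thesis by (simp add: fc_def)
qed

lemma fc_const: "a \<in> D \<Longrightarrow> fc (\<lambda>_. c) a = c *\<^sub>R e"
  using fc_poly[of a "[:c:]"] fc_cong[of a "poly [:c:]" "\<lambda>_. c"] by simp

lemma fc_id: "a \<in> D \<Longrightarrow> fc (\<lambda>t. t) a = a"
  using fc_poly[of a "[:0, 1:]"] fc_cong[of a "poly [:0, 1:]" "\<lambda>t. t"] by (simp add: D_simps)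

context
  fixes a and f g :: "real \<Rightarrow> real"
  assumes a: "a \<in> D" and f: "continuous_on (spec a) f" and g: "continuous_on (spec a) g"
begin

lemma fc_add: "fc (\<lambda>t. f t + g t) a = fc f a + fc g a"
proof -
  obtain p q where pq: "uniform_limit (spec a) (\<lambda>n. poly (p n)) f sequentially" "(\<lambda>n. pc (p n) a) \<longlonglongrightarrow> fc f a"
    "uniform_limit (spec a) (\<lambda>n. poly (q n)) g sequentially" "(\<lambda>n. pc (q n) a) \<longlonglongrightarrow> fc g a"
    using spec_approx[OF a f] spec_approx[OF a g] by metis
  have "(\<lambda>n. poly (p n + q n)) = (\<lambda>n t. poly (p n) t + poly (q n) t)"
    by (simp add: fun_eq_iff)
  then show ?thesis
    using uniform_limit_add[OF pq(1,3)] tendsto_add[OF pq(2,4)]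
    by (intro fc_eqI[of _ "\<lambda>n. p n + q n"] a) (simp_all add: pc_add)
qed

lemma fc_mult: "fc (\<lambda>t. f t * g t) a = fc f a \<odot> fc g a"
proof -
  obtain p q where pq: "uniform_limit (spec a) (\<lambda>n. poly (p n)) f sequentially" "(\<lambda>n. pc (p n) a) \<longlonglongrightarrow> fc f a"
    "uniform_limit (spec a) (\<lambda>n. poly (q n)) g sequentially" "(\<lambda>n. pc (q n) a) \<longlonglongrightarrow> fc g a"
    using spec_approx[OF a f] spec_approx[OF a g] by metis
  have "uniform_limit (spec a) (\<lambda>n t. poly (p n) t * poly (q n) t) (\<lambda>t. f t * g t) sequentially"
    using pq f g compact_spec[OF a]
    by (intro uniform_limit_intros compact_imp_bounded compact_continuous_image)
  moreover have "(\<lambda>n. pc (p n) a \<odot> pc (q n) a) \<longlonglongrightarrow> fc f a \<odot> fc g a"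
    by (rule tendsto[OF pq(2,4)])
  moreover have "(\<lambda>n. poly (p n * q n)) = (\<lambda>n t. poly (p n) t * poly (q n) t)"
    by (simp add: fun_eq_iff)
  ultimately show ?thesis
    using a by (intro fc_eqI[of _ "\<lambda>n. p n * q n"]) (simp_all add: pc_mult)
qed

end

lemma fc_scaleR:
  assumes "a \<in> D" "continuous_on (spec a) f"
  shows "fc (\<lambda>t. c * f t) a = c *\<^sub>R fc f a"
  using assms fc_mult[of a "\<lambda>_. c" f] by (simp add: fc_const D_simps)

lemma fc_diff:
  assumes "a \<in> D" "continuous_on (spec a) f" "continuous_on (spec a) g"
  shows "fc (\<lambda>t. f t - g t) a = fc f a - fc g a"
  using assms fc_add[of a f "\<lambda>t. (-1) * g t"] fc_scaleR[of a g "-1"]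
  by (simp add: continuous_on_minus)

lemma fc_mult_inverse:
  assumes "a \<in> D" "continuous_on (spec a) f" "\<And>t. t \<in> spec a \<Longrightarrow> f t \<noteq> 0"
  shows "fc f a \<odot> fc (\<lambda>t. inverse (f t)) a = e"
proof -
  have "fc f a \<odot> fc (\<lambda>t. inverse (f t)) a = fc (\<lambda>t. f t * inverse (f t)) a"
    using assms by (intro fc_mult[symmetric] continuous_intros) auto
  also have "\<dots> = fc (\<lambda>_. 1) a"
    by (rule fc_cong) (use assms in auto)
  finally show ?thesis
    using assms by (simp add: fc_const)
qed

text \<open>For s outside the image, 1 / (f - s) is continuous on the spectrum and its value at a
  inverts f(a) - s e.\<close>

lemma spec_fc_subset:
  assumes a: "a \<in> D" and f: "continuous_on (spec a) f"
  shows "spec (fc f a) \<subseteq> f ` spec a"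
proof
  fix s assume s: "s \<in> spec (fc f a)"
  show "s \<in> f ` spec a"
  proof (rule ccontr)
    assume "s \<notin> f ` spec a"
    then have nz: "f t - s \<noteq> 0" if "t \<in> spec a" for t using that by force
    have cont: "continuous_on (spec a) (\<lambda>t. f t - s)"
      by (intro continuous_intros f)
    have "fc (\<lambda>t. f t - s) a = fc f a - s *\<^sub>R e"
      using a f by (simp add: fc_diff fc_const)
    then have "(fc f a - s *\<^sub>R e) \<odot> fc (\<lambda>t. inverse (f t - s)) a = e"
      using fc_mult_inverse[OF a cont nz] by simp
    moreover have "fc (\<lambda>t. inverse (f t - s)) a \<in> D"
      by (rule fc_D[OF a continuous_on_inverse[OF cont]]) (use nz in blast)
    ultimately have "invertible (fc f a - s *\<^sub>R e)"
      using a f by (intro invertibleI) auto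
    then show False using s by (simp add: spec_def)
  qed
qed

text \<open>The root t of p - p(t) splits off, so p(a) - p(t) e has the noninvertible factor a - t
  e.\<close>

lemma poly_in_spec_pc:
  assumes a: "a \<in> D" and t: "t \<in> spec a"
  shows "poly p t \<in> spec (pc p a)"
proof -
  have "poly (p - [:poly p t:]) t = 0" by simp
  then obtain k where "p - [:poly p t:] = [:- t, 1:] * k"
    by (metis poly_eq_0_iff_dvd dvd_def)
  then have "pc p a - poly p t *\<^sub>R e = pc [:- t, 1:] a \<odot> pc k a"
    using a by (metis pc_mult pc_diff pc_const)
  also have "pc [:- t, 1:] a = a - t *\<^sub>R e"
    using a by (simp add: D_simps)
  finally show ?thesis
    using a t by (simp add: spec_def invertible_mult_iff)
qed

text \<open>For polynomials, p(t) is a spectral value of p(a) and so bounded by its norm; then pass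
  to the limit. In particular f(a) = 0 forces f = 0 on the spectrum.\<close>

lemma abs_le_norm_fc:
  assumes a: "a \<in> D" and f: "continuous_on (spec a) f" and t: "t \<in> spec a"
  shows "\<bar>f t\<bar> \<le> norm (fc f a)"
proof -
  obtain p where p: "uniform_limit (spec a) (\<lambda>n. poly (p n)) f sequentially"
    "(\<lambda>n. pc (p n) a) \<longlonglongrightarrow> fc f a"
    using spec_approx[OF a f] by metis
  have "(\<lambda>n. \<bar>poly (p n) t\<bar>) \<longlonglongrightarrow> \<bar>f t\<bar>"
    by (intro tendsto_rabs tendsto_uniform_limitI[OF p(1) t])
  moreover have "(\<lambda>n. norm (pc (p n) a)) \<longlonglongrightarrow> norm (fc f a)"
    by (intro tendsto_norm p)
  moreover have "\<bar>poly (p n) t\<bar> \<le> norm (pc (p n) a)" for n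
    using poly_in_spec_pc[OF a t, of "p n"] spec_subset[of "pc (p n) a"] a by fastforce
  ultimately show ?thesis
    by (intro LIMSEQ_le) auto
qed

end

text \<open>The self-adjoint part of an operator algebra of any of the three kinds.\<close>

locale sa_algebra = banach_mult +
  fixes S :: "'a set"
  assumes subspace_S: "subspace S" and closed_S: "closed S" and unit_S: "e \<in> S"
    and unit_left: "x \<in> S \<Longrightarrow> e \<odot> x = x" and unit_right: "x \<in> S \<Longrightarrow> x \<odot> e = x"
    and comm_mult_S: "x \<in> S \<Longrightarrow> y \<in> S \<Longrightarrow> x \<odot> y = y \<odot> x \<Longrightarrow> x \<odot> y \<in> S"
    and sandwich_S: "x \<in> S \<Longrightarrow> y \<in> S \<Longrightarrow> x \<odot> y \<odot> x \<in> S"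
    and norm_square: "x \<in> S \<Longrightarrow> norm (x \<odot> x) = (norm x)\<^sup>2"
    and one_plus_square: "x \<in> S \<Longrightarrow> \<exists>y\<in>S. (e + x \<odot> x) \<odot> y = e \<and> y \<odot> (e + x \<odot> x) = e"
begin

lemma S_closed [simp, intro]:
  "0 \<in> S" "e \<in> S" "x \<in> S \<Longrightarrow> y \<in> S \<Longrightarrow> x + y \<in> S" "x \<in> S \<Longrightarrow> y \<in> S \<Longrightarrow> x - y \<in> S"
  "x \<in> S \<Longrightarrow> c *\<^sub>R x \<in> S" "x \<in> S \<Longrightarrow> - x \<in> S" "x \<in> S \<Longrightarrow> x \<odot> x \<in> S"
  using subspace_S unit_S comm_mult_S
  by (auto simp: subspace_0 subspace_add subspace_diff subspace_scale subspace_neg)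

section \<open>Bicommutants and the calculus of a self-adjoint element\<close>

definition inverse_pair :: "'a \<Rightarrow> 'a \<Rightarrow> bool" where
  "inverse_pair x y \<longleftrightarrow> y \<in> S \<and> x \<odot> y = e \<and> y \<odot> x = e"

definition regular :: "'a \<Rightarrow> bool" where
  "regular x \<longleftrightarrow> (\<exists>y. inverse_pair x y)"

definition spec :: "'a \<Rightarrow> real set" where
  "spec a = {t. \<not> regular (a - t *\<^sub>R e)}"

definition bicommutant :: "'a \<Rightarrow> 'a set" where
  "bicommutant a = {x \<in> S. \<forall>y\<in>S. a \<odot> y = y \<odot> a \<longrightarrow> x \<odot> y = y \<odot> x}"

lemma bicommutant_S: "x \<in> bicommutant a \<Longrightarrow> x \<in> S"
  by (simp add: bicommutant_def)

lemma bicommutant_comm: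
  "x \<in> bicommutant a \<Longrightarrow> y \<in> S \<Longrightarrow> a \<odot> y = y \<odot> a \<Longrightarrow> x \<odot> y = y \<odot> x"
  by (simp add: bicommutant_def)

lemma bicommutant_self: "a \<in> S \<Longrightarrow> a \<in> bicommutant a"
  by (simp add: bicommutant_def)

lemma commute_mult:
  assumes "x \<odot> z = z \<odot> x" "y \<odot> z = z \<odot> y"
  shows "x \<odot> y \<odot> z = z \<odot> (x \<odot> y)"
  using assms assoc by metis

lemma inverse_commutes:
  assumes "inverse_pair x y" "z \<in> S" "x \<odot> z = z \<odot> x"
  shows "y \<odot> z = z \<odot> y"
proof -
  have "y \<odot> z = y \<odot> (z \<odot> (x \<odot> y))"
    using assms by (simp add: inverse_pair_def unit_right)
  also have "\<dots> = y \<odot> (x \<odot> z) \<odot> y"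
    unfolding assms(3) by (simp add: assoc)
  also have "\<dots> = (y \<odot> x) \<odot> z \<odot> y"
    by (simp add: assoc)
  also have "\<dots> = z \<odot> y"
    using assms by (simp add: inverse_pair_def unit_left)
  finally show ?thesis .
qed

lemma inverse_in_bicommutant:
  assumes "x \<in> bicommutant a" "inverse_pair x y"
  shows "y \<in> bicommutant a"
  unfolding bicommutant_def
  using assms inverse_commutes[OF assms(2)] bicommutant_comm[OF assms(1)]
  by (auto simp: inverse_pair_def)

text \<open>Since a commutes with itself, each member of the bicommutant commutes with a and
  therefore with every other member. Commuting is what brings products back into
  \<open>S\<close>.\<close>

lemma comm_real_cstar_bicommutant:
  assumes a: "a \<in> S"
  shows "comm_real_cstar (\<odot>) e (bicommutant a)"
proof
  show "subspace (bicommutant a)"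
    by (auto simp: subspace_def bicommutant_def mult_simps)
  have "closed (S \<inter> (\<Inter>y\<in>{y\<in>S. a \<odot> y = y \<odot> a}. {x. x \<odot> y = y \<odot> x}))"
    by (intro closed_Int closed_S closed_INT ballI closed_Collect_eq continuous_on continuous_intros)
  also have "S \<inter> (\<Inter>y\<in>{y\<in>S. a \<odot> y = y \<odot> a}. {x. x \<odot> y = y \<odot> x}) = bicommutant a"
    by (auto simp: bicommutant_def)
  finally show "closed (bicommutant a)" .
  show "e \<in> bicommutant a"
    by (simp add: bicommutant_def unit_left unit_right)
  fix x assume x: "x \<in> bicommutant a"
  note xS = bicommutant_S[OF x]
  have xa: "a \<odot> x = x \<odot> a"
    using bicommutant_comm[OF x a] by simp
  show "e \<odot> x = x" "norm (x \<odot> x) = (norm x)\<^sup>2"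
    using xS unit_left norm_square by auto
  show "\<exists>y\<in>bicommutant a. (e + x \<odot> x) \<odot> y = e"
  proof -
    obtain y where y: "inverse_pair (e + x \<odot> x) y"
      using one_plus_square[OF xS] by (auto simp: inverse_pair_def)
    have "e + x \<odot> x \<in> bicommutant a"
      using x xS by (auto simp: bicommutant_def mult_simps unit_left unit_right commute_mult)
    then show ?thesis
      using inverse_in_bicommutant y by (auto simp: inverse_pair_def)
  qed
  fix y assume y: "y \<in> bicommutant a"
  note yS = bicommutant_S[OF y]
  show xy: "x \<odot> y = y \<odot> x"
    using bicommutant_comm[OF y xS xa] by simp
  show "x \<odot> y \<in> bicommutant a"
    using x y comm_mult_S[OF xS yS xy] by (auto simp: bicommutant_def commute_mult)
qed

text \<open>An inverse in \<open>S\<close> commutes with whatever the element itself commutes with,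
  so it stays in the bicommutant.\<close>

lemma
  assumes a: "a \<in> S"
  shows invertible_bicommutant_iff:
      "x \<in> bicommutant a \<Longrightarrow> comm_real_cstar.invertible (\<odot>) e (bicommutant a) x \<longleftrightarrow> regular x"
    and spec_bicommutant:
      "x \<in> bicommutant a \<Longrightarrow> comm_real_cstar.spec (\<odot>) e (bicommutant a) x = spec x"
proof -
  interpret D: comm_real_cstar "(\<odot>)" e "bicommutant a"
    using a by (rule comm_real_cstar_bicommutant)
  show *: "D.invertible x \<longleftrightarrow> regular x" if x: "x \<in> bicommutant a" for x
  proof
    assume "D.invertible x"
    then have "inverse_pair x (D.inv_of x)"
      using D.inv_of[of x] D.comm x by (auto simp: inverse_pair_def intro: bicommutant_S)
    then show "regular x" by (auto simp: regular_def)
  next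
    assume "regular x"
    then show "D.invertible x"
      using x inverse_in_bicommutant by (auto simp: regular_def D.invertible_def inverse_pair_def)
  qed
  show "D.spec x = spec x" if "x \<in> bicommutant a"
    using * that by (auto simp: D.spec_def spec_def)
qed

definition fcalc :: "(real \<Rightarrow> real) \<Rightarrow> 'a \<Rightarrow> 'a" where
  "fcalc f a = comm_real_cstar.fc (\<odot>) e (bicommutant a) f a"

lemma spec_subset: "a \<in> S \<Longrightarrow> spec a \<subseteq> {- norm a..norm a}"
  using comm_real_cstar.spec_subset[OF comm_real_cstar_bicommutant] spec_bicommutant
    bicommutant_self by metis

lemma compact_spec: "a \<in> S \<Longrightarrow> compact (spec a)"
  using comm_real_cstar.compact_spec[OF comm_real_cstar_bicommutant] spec_bicommutant
    bicommutant_self by metis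

text \<open>Bridge to \<open>fun_calc\<close>, whose description ranges over the whole carrier
  \<open>C\<close>. An approximating sequence exists because the spectrum is compact, and its limit
  is unique in \<open>C\<close> as well.\<close>

lemma fcalc_eq_The:
  assumes a: "a \<in> S" and f: "continuous_on (spec a) f" and C: "S \<subseteq> C"
  shows "(THE b. b \<in> C \<and> (\<forall>p. uniform_limit (spec a) (\<lambda>n. poly (p n)) f sequentially \<longrightarrow>
    (\<lambda>n. pc (p n) a) \<longlonglongrightarrow> b)) = fcalc f a"
proof -
  interpret D: comm_real_cstar "(\<odot>)" e "bicommutant a"
    using a by (rule comm_real_cstar_bicommutant)
  have sp: "D.spec a = spec a"
    using a bicommutant_self spec_bicommutant by blast
  have aD: "a \<in> bicommutant a" using a by (rule bicommutant_self)
  obtain q where q: "uniform_limit (spec a) (\<lambda>n. poly (q n)) f sequentially"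
    using D.spec_approx[OF aD, unfolded sp, OF f] by blast
  show ?thesis
  proof (rule the_equality)
    have "fcalc f a \<in> C"
      using D.fc_D[OF aD, unfolded sp, OF f] bicommutant_S C by (auto simp: fcalc_def)
    then show "fcalc f a \<in> C \<and> (\<forall>p. uniform_limit (spec a) (\<lambda>n. poly (p n)) f sequentially \<longrightarrow>
        (\<lambda>n. pc (p n) a) \<longlonglongrightarrow> fcalc f a)"
      using D.fc_tendsto[OF aD, unfolded sp] by (auto simp: fcalc_def)
    fix c assume "c \<in> C \<and> (\<forall>p. uniform_limit (spec a) (\<lambda>n. poly (p n)) f sequentially \<longrightarrow>
      (\<lambda>n. pc (p n) a) \<longlonglongrightarrow> c)"
    then show "c = fcalc f a"
      using q D.fc_tendsto[OF aD, unfolded sp, OF q] LIMSEQ_unique by (auto simp: fcalc_def)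
  qed
qed

context
  fixes a assumes a: "a \<in> S"
begin

interpretation D: comm_real_cstar "(\<odot>)" e "bicommutant a"
  using a by (rule comm_real_cstar_bicommutant)

private lemma aD: "a \<in> bicommutant a"
  using a by (rule bicommutant_self)

private lemma sp: "D.spec a = spec a"
  using aD by (rule spec_bicommutant[OF a])

lemma fcalc_cong: "(\<And>t. t \<in> spec a \<Longrightarrow> f t = g t) \<Longrightarrow> fcalc f a = fcalc g a"
  unfolding fcalc_def by (rule D.fc_cong) (simp add: sp)

lemma fcalc_const: "fcalc (\<lambda>_. c) a = c *\<^sub>R e"
  unfolding fcalc_def using aD by (rule D.fc_const)

lemma fcalc_id: "fcalc (\<lambda>t. t) a = a"
  unfolding fcalc_def using aD by (rule D.fc_id)

context
  fixes f :: "real \<Rightarrow> real" assumes f: "continuous_on (spec a) f"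
begin

lemma fcalc_bicommutant: "fcalc f a \<in> bicommutant a"
  unfolding fcalc_def using aD f by (intro D.fc_D) (simp_all add: sp)

lemma fcalc_S: "fcalc f a \<in> S"
  using fcalc_bicommutant by (rule bicommutant_S)

lemma fcalc_scaleR: "fcalc (\<lambda>t. c * f t) a = c *\<^sub>R fcalc f a"
  unfolding fcalc_def using aD f by (intro D.fc_scaleR) (simp_all add: sp)

lemma fcalc_inverse_pair:
  assumes "\<And>t. t \<in> spec a \<Longrightarrow> f t \<noteq> 0"
  shows "inverse_pair (fcalc f a) (fcalc (\<lambda>t. inverse (f t)) a)"
proof -
  have D: "fcalc f a \<in> bicommutant a" "fcalc (\<lambda>t. inverse (f t)) a \<in> bicommutant a"
    unfolding fcalc_def using aD f assms
    by (auto simp: sp intro!: D.fc_D continuous_on_inverse)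
  moreover have "fcalc f a \<odot> fcalc (\<lambda>t. inverse (f t)) a = e"
    unfolding fcalc_def using aD f assms by (intro D.fc_mult_inverse) (simp_all add: sp)
  ultimately show ?thesis
    using D.comm[OF D] by (simp add: inverse_pair_def bicommutant_S)
qed

lemma spec_fcalc_subset: "spec (fcalc f a) \<subseteq> f ` spec a"
  using D.spec_fc_subset[OF aD, unfolded sp, OF f] spec_bicommutant[OF a fcalc_bicommutant]
  by (simp add: fcalc_def)

lemma abs_le_norm_fcalc: "t \<in> spec a \<Longrightarrow> \<bar>f t\<bar> \<le> norm (fcalc f a)"
  using D.abs_le_norm_fc[OF aD, unfolded sp, OF f] by (simp add: fcalc_def)

context
  fixes g :: "real \<Rightarrow> real" assumes g: "continuous_on (spec a) g"
begin

lemma fcalc_add: "fcalc (\<lambda>t. f t + g t) a = fcalc f a + fcalc g a"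
  unfolding fcalc_def using aD f g by (intro D.fc_add) (simp_all add: sp)

lemma fcalc_diff: "fcalc (\<lambda>t. f t - g t) a = fcalc f a - fcalc g a"
  unfolding fcalc_def using aD f g by (intro D.fc_diff) (simp_all add: sp)

lemma fcalc_mult: "fcalc (\<lambda>t. f t * g t) a = fcalc f a \<odot> fcalc g a"
  unfolding fcalc_def using aD f g by (intro D.fc_mult) (simp_all add: sp)

end
end

lemma norm_unit_diff_le:
  assumes "spec a \<subseteq> {0..r}" "r \<ge> 0"
  shows "norm (r *\<^sub>R e - a) \<le> r"
proof -
  have "norm (pc [:r, -1:] a) \<le> r"
    using aD assms by (intro D.norm_pc_le) (auto simp: sp)
  also have "pc [:r, -1:] a = r *\<^sub>R e - a"
    using a by (simp add: mult_simps unit_right)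
  finally show ?thesis .
qed

end

lemma spec_unit_diff:
  assumes "a \<in> S" "t \<in> spec a"
  shows "r - t \<in> spec (r *\<^sub>R e - a)"
proof (rule ccontr)
  assume "r - t \<notin> spec (r *\<^sub>R e - a)"
  then obtain y where y: "inverse_pair (t *\<^sub>R e - a) y"
    by (auto simp: spec_def regular_def algebra_simps)
  then have "inverse_pair (a - t *\<^sub>R e) (- y)"
    by (auto simp: inverse_pair_def mult_simps algebra_simps)
  then show False using assms by (auto simp: spec_def regular_def)
qed

section \<open>The positive cone\<close>

definition pos :: "'a set" where
  "pos = {a \<in> S. spec a \<subseteq> {0..}}"

lemma pos_S: "a \<in> pos \<Longrightarrow> a \<in> S"
  by (simp add: pos_def)

lemma norm_unit_diff_le_pos:
  assumes "a \<in> pos"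
  shows "norm (norm a *\<^sub>R e - a) \<le> norm a"
  using assms spec_subset[of a] by (intro norm_unit_diff_le) (force simp: pos_def)+

text \<open>Together with \<open>norm_unit_diff_le_pos\<close> this describes positivity by a norm
  inequality, which by the triangle inequality is stable under sums; the spectral definition does
  not show that.\<close>

lemma posI_norm:
  assumes "a \<in> S" "norm (r *\<^sub>R e - a) \<le> r"
  shows "a \<in> pos"
proof -
  have "t \<ge> 0" if "t \<in> spec a" for t
    using spec_unit_diff[OF assms(1) that, of r] spec_subset[of "r *\<^sub>R e - a"] assms by fastforce
  then show ?thesis using assms by (auto simp: pos_def)
qed

lemma pos_add:
  assumes "a \<in> pos" "b \<in> pos"
  shows "a + b \<in> pos"
proof (rule posI_norm)
  have "norm ((norm a + norm b) *\<^sub>R e - (a + b)) = norm ((norm a *\<^sub>R e - a) + (norm b *\<^sub>R e - b))"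
    by (simp add: scaleR_add_left algebra_simps)
  also have "\<dots> \<le> norm a + norm b"
    using assms by (intro norm_triangle_le add_mono norm_unit_diff_le_pos)
  finally show "norm ((norm a + norm b) *\<^sub>R e - (a + b)) \<le> norm a + norm b" .
qed (use assms pos_S in auto)

lemma regularI: "inverse_pair x y \<Longrightarrow> regular x"
  by (auto simp: regular_def)

lemma posI_regular:
  assumes "a \<in> S" "\<And>s. s > 0 \<Longrightarrow> regular (a + s *\<^sub>R e)"
  shows "a \<in> pos"
proof -
  have "t \<ge> 0" if "t \<in> spec a" for t
    using that assms(2)[of "- t"] by (force simp: spec_def)
  then show ?thesis using assms by (auto simp: pos_def)
qed

lemma regular_pos_add: "a \<in> pos \<Longrightarrow> s > 0 \<Longrightarrow> regular (a + s *\<^sub>R e)"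
  by (force simp: pos_def spec_def dest: subsetD[of _ _ "- s"])

lemma pos_scaleR:
  assumes "a \<in> pos" "c \<ge> 0"
  shows "c *\<^sub>R a \<in> pos"
proof (rule posI_norm)
  have "norm ((c * norm a) *\<^sub>R e - c *\<^sub>R a) = c * norm (norm a *\<^sub>R e - a)"
    using assms by (simp flip: scaleR_scaleR scaleR_diff_right)
  also have "\<dots> \<le> c * norm a"
    using assms by (intro mult_left_mono norm_unit_diff_le_pos)
  finally show "norm ((c * norm a) *\<^sub>R e - c *\<^sub>R a) \<le> c * norm a" .
qed (use assms pos_S in auto)

lemma fcalc_pos:
  assumes "a \<in> S" "continuous_on (spec a) f" "\<And>t. t \<in> spec a \<Longrightarrow> 0 \<le> f t"
  shows "fcalc f a \<in> pos"
  using spec_fcalc_subset[OF assms(1,2)] fcalc_S[OF assms(1,2)] assms(3) by (force simp: pos_def)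

lemma square_pos:
  assumes "a \<in> S"
  shows "a \<odot> a \<in> pos"
proof -
  have "fcalc (\<lambda>t. t * t) a = a \<odot> a"
    using assms by (simp add: fcalc_mult fcalc_id continuous_on_id)
  then show ?thesis
    using assms fcalc_pos[of a "\<lambda>t. t * t"] by (simp add: continuous_intros)
qed

text \<open>The spectrum is closed and misses 0, hence misses a neighbourhood of 0.\<close>

lemma pos_regular_bound:
  assumes "a \<in> pos" "regular a"
  obtains \<epsilon> where "\<epsilon> > 0" "a - \<epsilon> *\<^sub>R e \<in> pos" "spec a \<subseteq> {\<epsilon>..}"
proof -
  have "closed (spec a)" "0 \<notin> spec a"
    using assms compact_spec pos_S compact_imp_closed by (auto simp: spec_def)
  then have "open (- spec a)" "0 \<in> - spec a" by auto
  then obtain \<epsilon> where \<epsilon>: "\<epsilon> > 0" "ball 0 \<epsilon> \<subseteq> - spec a"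
    using open_contains_ball by blast
  have sub: "spec a \<subseteq> {\<epsilon>..}"
  proof
    fix t assume t: "t \<in> spec a"
    then have "t \<ge> 0" using assms by (auto simp: pos_def)
    moreover have "t \<notin> ball 0 \<epsilon>" using t \<epsilon> by blast
    ultimately show "t \<in> {\<epsilon>..}" by simp
  qed
  have "a - \<epsilon> *\<^sub>R e \<in> pos"
  proof (rule posI_regular)
    fix s :: real assume "s > 0"
    then have "\<epsilon> - s \<notin> spec a" using sub by force
    then show "regular (a - \<epsilon> *\<^sub>R e + s *\<^sub>R e)"
      by (simp add: spec_def algebra_simps)
  qed (use assms pos_S in auto)
  with \<epsilon> sub that show thesis by blast
qed

lemma sandwich_inverse_pair:
  assumes c: "c \<in> S" "inverse_pair c c'" and w: "w \<in> S" "inverse_pair w w'"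
  shows "inverse_pair (c \<odot> w \<odot> c) (c' \<odot> w' \<odot> c')"
proof -
  have S: "c' \<in> S" "w' \<in> S" using c w by (auto simp: inverse_pair_def)
  have "c \<odot> w \<odot> c \<odot> (c' \<odot> w' \<odot> c') = c \<odot> (w \<odot> ((c \<odot> c') \<odot> w')) \<odot> c'"
    by (simp add: assoc)
  moreover have "c' \<odot> w' \<odot> c' \<odot> (c \<odot> w \<odot> c) = c' \<odot> (w' \<odot> ((c' \<odot> c) \<odot> w)) \<odot> c"
    by (simp add: assoc)
  ultimately show ?thesis
    using S c w by (simp add: inverse_pair_def sandwich_S unit_left unit_right)
qed

text \<open>\<open>c h c + s = c (h + s c\<^bsup>-2\<^esup>) c\<close>, where \<open>h + s c\<^bsup>-2\<^esup>\<close> is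
  bounded below.\<close>

lemma sandwich_pos:
  assumes c: "c \<in> S" "inverse_pair c c'" and h: "h \<in> pos"
  shows "c \<odot> h \<odot> c \<in> pos"
proof (rule posI_regular)
  show "c \<odot> h \<odot> c \<in> S" using c h by (simp add: sandwich_S pos_S)
  fix s :: real assume s: "s > 0"
  have c': "c' \<in> S" "c \<odot> c' = e" "c' \<odot> c = e"
    using c by (auto simp: inverse_pair_def)
  have "inverse_pair (c' \<odot> e \<odot> c') (c \<odot> e \<odot> c)"
    using c c' by (intro sandwich_inverse_pair) (auto simp: inverse_pair_def unit_left)
  then have "regular (c' \<odot> c')"
    using c' by (simp add: unit_right regularI)
  then obtain \<epsilon> where \<epsilon>: "\<epsilon> > 0" "c' \<odot> c' - \<epsilon> *\<^sub>R e \<in> pos"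
    using pos_regular_bound square_pos c' by metis
  define w where "w = h + s *\<^sub>R (c' \<odot> c')"
  have "regular ((h + s *\<^sub>R (c' \<odot> c' - \<epsilon> *\<^sub>R e)) + (s * \<epsilon>) *\<^sub>R e)"
    using h s \<epsilon> by (intro regular_pos_add pos_add pos_scaleR) auto
  then have "regular w"
    by (simp add: w_def algebra_simps)
  moreover have "w \<in> S"
    using h c' by (auto simp: w_def pos_S)
  ultimately have "regular (c \<odot> w \<odot> c)"
    using sandwich_inverse_pair[OF c] by (metis regular_def)
  also have "c \<odot> w \<odot> c = c \<odot> h \<odot> c + s *\<^sub>R ((c \<odot> c') \<odot> (c' \<odot> c))"
    by (simp add: w_def mult_simps assoc)
  also have "(c \<odot> c') \<odot> (c' \<odot> c) = e"
    using c' by (simp add: unit_left)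
  finally show "regular (c \<odot> h \<odot> c + s *\<^sub>R e)" .
qed

end

section \<open>Scalar inequalities\<close>

text \<open>With s = sqrt x the difference is 2 (s - 1)^3 / ((s + 1)(1 + s^2)), which changes sign
  exactly at x = 1.\<close>

lemma ineq_I_II:
  fixes x :: real
  assumes "x > 0"
  shows "x \<ge> 1 \<Longrightarrow> 2 * (1 - 2 * inverse (1 + x)) \<le> 4 - 8 * inverse (x powr (1/2) + 1)"
    and "x \<le> 1 \<Longrightarrow> 4 - 8 * inverse (x powr (1/2) + 1) \<le> 2 * (1 - 2 * inverse (1 + x))"
proof -
  define s where "s = sqrt x"
  have s: "s > 0" "x = s\<^sup>2" "x powr (1/2) = s"
    using assms by (auto simp: s_def powr_half_sqrt)
  have "4 - 8 * inverse (s + 1) - 2 * (1 - 2 * inverse (1 + s\<^sup>2))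
      = 2 * (s - 1) ^ 3 / ((s + 1) * (1 + s\<^sup>2))"
  proof -
    have "s + 1 \<noteq> 0" "1 + s\<^sup>2 \<noteq> 0" using s(1) by (simp, metis add_pos_nonneg less_numeral_extra(3) zero_le_power2 zero_less_one)
    then show ?thesis
      by (simp add: divide_simps) (simp add: algebra_simps power2_eq_square power3_eq_cube)
  qed
  moreover have "(s + 1) * (1 + s\<^sup>2) > 0"
    using s by (intro mult_pos_pos add_pos_nonneg) auto
  moreover have "x \<ge> 1 \<Longrightarrow> (s - 1) ^ 3 \<ge> 0" "x \<le> 1 \<Longrightarrow> (s - 1) ^ 3 \<le> 0"
    by (auto simp: s_def power_le_zero_eq)
  ultimately show "x \<ge> 1 \<Longrightarrow> 2 * (1 - 2 * inverse (1 + x)) \<le> 4 - 8 * inverse (x powr (1/2) + 1)"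
    "x \<le> 1 \<Longrightarrow> 4 - 8 * inverse (x powr (1/2) + 1) \<le> 2 * (1 - 2 * inverse (1 + x))"
    unfolding s(3) unfolding s(2)
    by (smt (verit) divide_nonneg_pos divide_nonpos_pos)+
qed

lemma mono_from_deriv:
  fixes f f' :: "real \<Rightarrow> real"
  assumes "\<And>t. t > 0 \<Longrightarrow> (f has_real_derivative f' t) (at t)" "\<And>t. t > 0 \<Longrightarrow> f' t \<ge> 0"
    and "0 < a" "a \<le> b"
  shows "f a \<le> f b"
proof (rule DERIV_nonneg_imp_nondecreasing[OF assms(4)])
  fix t assume "a \<le> t"
  then have "t > 0" using assms(3) by simp
  then show "\<exists>y. (f has_real_derivative y) (at t) \<and> 0 \<le> y"
    using assms(1,2) by blast
qed

text \<open>One monotone function serves two links of the chain. Put s = sqrt x and add 4: at d =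
  sqrt \<delta> it is the weight of II', at d = 1 that of II, and at d = s it is ln x. Its
  derivative is 2 (s - d)^2 / (d (s + d)^2).\<close>

lemma ln_shift_mono:
  fixes s :: real
  assumes "s > 0" "0 < a" "a \<le> b"
  shows "2 * ln a - 8 * a * inverse (s + a) \<le> 2 * ln b - 8 * b * inverse (s + b)"
proof (rule mono_from_deriv[of "\<lambda>d. 2 * ln d - 8 * d * inverse (s + d)"
      "\<lambda>d. 2 * (s - d)\<^sup>2 / (d * (s + d)\<^sup>2)", OF _ _ assms(2,3)])
  fix d :: real assume d: "d > 0"
  then have nz: "d \<noteq> 0" "s + d \<noteq> 0" using assms by auto
  have "((\<lambda>d. 2 * ln d - 8 * d * inverse (s + d)) has_real_derivative
      2 / d - (8 * inverse (s + d) + 8 * d * - (inverse (s + d) * inverse (s + d)))) (at d)"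
    using d nz by (auto intro!: derivative_eq_intros)
  moreover have "2 / d - (8 * inverse (s + d) + 8 * d * - (inverse (s + d) * inverse (s + d)))
      = 2 * (s - d)\<^sup>2 / (d * (s + d)\<^sup>2)"
    using nz by (simp add: divide_simps) (simp add: algebra_simps power2_eq_square)
  ultimately show "((\<lambda>d. 2 * ln d - 8 * d * inverse (s + d)) has_real_derivative
      2 * (s - d)\<^sup>2 / (d * (s + d)\<^sup>2)) (at d)" by simp
  show "2 * (s - d)\<^sup>2 / (d * (s + d)\<^sup>2) \<ge> 0" using d by simp
qed

lemma ineq_II_II':
  fixes x \<delta> :: real
  assumes "x > 0" "\<delta> > 0"
  defines "u \<equiv> x powr (1/2)"
  shows "\<delta> \<ge> 1 \<Longrightarrow> 4 - 8 * inverse (u + 1) \<le> ln \<delta> + 4 - 8 * sqrt \<delta> * inverse (u + sqrt \<delta>)"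
    and "\<delta> \<le> 1 \<Longrightarrow> ln \<delta> + 4 - 8 * sqrt \<delta> * inverse (u + sqrt \<delta>) \<le> 4 - 8 * inverse (u + 1)"
proof -
  have u: "u > 0" using assms by simp
  have "2 * ln (sqrt \<delta>) = ln \<delta>" using assms by (simp add: ln_sqrt)
  then show "\<delta> \<ge> 1 \<Longrightarrow> 4 - 8 * inverse (u + 1) \<le> ln \<delta> + 4 - 8 * sqrt \<delta> * inverse (u + sqrt \<delta>)"
    "\<delta> \<le> 1 \<Longrightarrow> ln \<delta> + 4 - 8 * sqrt \<delta> * inverse (u + sqrt \<delta>) \<le> 4 - 8 * inverse (u + 1)"
    using ln_shift_mono[OF u, of 1 "sqrt \<delta>"] ln_shift_mono[OF u, of "sqrt \<delta>" 1] assms by auto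
qed

lemma ineq_II'_ln:
  fixes x \<delta> :: real
  assumes "x > 0" "\<delta> > 0"
  defines "u \<equiv> x powr (1/2)"
  shows "x \<ge> \<delta> \<Longrightarrow> ln \<delta> + 4 - 8 * sqrt \<delta> * inverse (u + sqrt \<delta>) \<le> ln x"
    and "x \<le> \<delta> \<Longrightarrow> ln x \<le> ln \<delta> + 4 - 8 * sqrt \<delta> * inverse (u + sqrt \<delta>)"
proof -
  have u: "u = sqrt x" "u > 0" using assms by (auto simp: powr_half_sqrt)
  have eq: "ln \<delta> = 2 * ln (sqrt \<delta>)" "ln x = 2 * ln u" "8 * u * inverse (u + u) = 4"
    using assms(1,2) u by (auto simp: ln_sqrt field_simps)
  show "ln \<delta> + 4 - 8 * sqrt \<delta> * inverse (u + sqrt \<delta>) \<le> ln x" if "x \<ge> \<delta>"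
  proof -
    have "sqrt \<delta> \<le> u" using that unfolding u(1) by simp
    then show ?thesis
      using ln_shift_mono[OF u(2), of "sqrt \<delta>" u] assms(2) eq by simp
  qed
  show "ln x \<le> ln \<delta> + 4 - 8 * sqrt \<delta> * inverse (u + sqrt \<delta>)" if "x \<le> \<delta>"
  proof -
    have "u \<le> sqrt \<delta>" using that unfolding u(1) by simp
    then show ?thesis
      using ln_shift_mono[OF u(2,2), of "sqrt \<delta>"] eq by simp
  qed
qed

text \<open>The function is 2 (sinh (ln t) - ln t). It vanishes at t = 1 and is used at t = sqrt (x
  / \<delta>).\<close>

lemma ln_hyperbolic_mono:
  fixes a b :: real
  assumes "0 < a" "a \<le> b"
  shows "a - 1 / a - 2 * ln a \<le> b - 1 / b - 2 * ln b"
proof (rule mono_from_deriv[of "\<lambda>t. t - 1 / t - 2 * ln t" "\<lambda>t. (t - 1)\<^sup>2 / t\<^sup>2", OF _ _ assms])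
  fix t :: real assume t: "t > 0"
  have "((\<lambda>t. t - 1 / t - 2 * ln t) has_real_derivative 1 + 1 / (t * t) - 2 / t) (at t)"
    using t by (auto intro!: derivative_eq_intros)
  moreover have "1 + 1 / (t * t) - 2 / t = (t - 1)\<^sup>2 / t\<^sup>2"
    using t by (simp add: divide_simps) (simp add: algebra_simps power2_eq_square)
  ultimately show "((\<lambda>t. t - 1 / t - 2 * ln t) has_real_derivative (t - 1)\<^sup>2 / t\<^sup>2) (at t)" by simp
qed simp

lemma ineq_ln_III':
  fixes x \<delta> :: real
  assumes "x > 0" "\<delta> > 0"
  shows "x \<ge> \<delta> \<Longrightarrow> ln x \<le> sqrt x / sqrt \<delta> - sqrt \<delta> / sqrt x + ln \<delta>"
    and "x \<le> \<delta> \<Longrightarrow> sqrt x / sqrt \<delta> - sqrt \<delta> / sqrt x + ln \<delta> \<le> ln x"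
proof -
  define y where "y = sqrt x / sqrt \<delta>"
  have "y > 0" "2 * ln y = ln x - ln \<delta>" "sqrt \<delta> / sqrt x = 1 / y"
    "x \<ge> \<delta> \<Longrightarrow> y \<ge> 1" "x \<le> \<delta> \<Longrightarrow> y \<le> 1"
    using assms by (auto simp: y_def ln_div ln_sqrt)
  then show "x \<ge> \<delta> \<Longrightarrow> ln x \<le> sqrt x / sqrt \<delta> - sqrt \<delta> / sqrt x + ln \<delta>"
    "x \<le> \<delta> \<Longrightarrow> sqrt x / sqrt \<delta> - sqrt \<delta> / sqrt x + ln \<delta> \<le> ln x"
    using ln_hyperbolic_mono[of 1 y] ln_hyperbolic_mono[of y 1] by (auto simp: y_def)
qed

text \<open>With y = sqrt (x / \<delta>) the difference is (y - 1)^3 (y + 1) / (2 y^2), whose sign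
  is that of x - \<delta>.\<close>

lemma ineq_III'_V':
  fixes x \<delta> :: real
  assumes "x > 0" "\<delta> > 0"
  shows "x \<ge> \<delta> \<Longrightarrow> sqrt x / sqrt \<delta> - sqrt \<delta> / sqrt x \<le> (1/2) * (x / \<delta> - \<delta> / x)"
    and "x \<le> \<delta> \<Longrightarrow> (1/2) * (x / \<delta> - \<delta> / x) \<le> sqrt x / sqrt \<delta> - sqrt \<delta> / sqrt x"
proof -
  define y where "y = sqrt x / sqrt \<delta>"
  have y: "y > 0" "sqrt \<delta> / sqrt x = 1 / y" "x / \<delta> = y\<^sup>2" "\<delta> / x = 1 / y\<^sup>2"
    "x \<ge> \<delta> \<Longrightarrow> y \<ge> 1" "x \<le> \<delta> \<Longrightarrow> y \<le> 1"
    using assms by (auto simp: y_def power_divide)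
  have "(1/2) * (y\<^sup>2 - 1 / y\<^sup>2) - (y - 1 / y) = (y - 1) ^ 3 * (y + 1) / (2 * y\<^sup>2)"
    using y(1) by (simp add: divide_simps) (simp add: algebra_simps power2_eq_square power3_eq_cube power4_eq_xxxx)
  moreover have "2 * y\<^sup>2 > 0" "y + 1 > 0" using y by auto
  moreover have "x \<ge> \<delta> \<Longrightarrow> (y - 1) ^ 3 \<ge> 0" "x \<le> \<delta> \<Longrightarrow> (y - 1) ^ 3 \<le> 0"
    using y by (auto simp: power_le_zero_eq)
  ultimately have "x \<ge> \<delta> \<Longrightarrow> y - 1 / y \<le> (1/2) * (y\<^sup>2 - 1 / y\<^sup>2)"
    "x \<le> \<delta> \<Longrightarrow> (1/2) * (y\<^sup>2 - 1 / y\<^sup>2) \<le> y - 1 / y"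
    by (smt (verit) divide_nonneg_pos divide_nonpos_pos mult_nonneg_nonneg mult_nonpos_nonneg)+
  then show "x \<ge> \<delta> \<Longrightarrow> sqrt x / sqrt \<delta> - sqrt \<delta> / sqrt x \<le> (1/2) * (x / \<delta> - \<delta> / x)"
    "x \<le> \<delta> \<Longrightarrow> (1/2) * (x / \<delta> - \<delta> / x) \<le> sqrt x / sqrt \<delta> - sqrt \<delta> / sqrt x"
    unfolding y(2-4) by (simp_all add: y_def)
qed

text \<open>The two sides are -g(\<delta>) and -g(1) for g(d) = (d / x - x / d) / 2 - ln d, which
  increases because its derivative is (x - d)^2 / (2 x d^2).\<close>

lemma ineq_V'_V:
  fixes x \<delta> :: real
  assumes x: "x > 0" and "\<delta> > 0"
  shows "\<delta> \<ge> 1 \<Longrightarrow> (1/2) * (x / \<delta> - \<delta> / x) + ln \<delta> \<le> (1/2) * (x - 1 / x)"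
    and "\<delta> \<le> 1 \<Longrightarrow> (1/2) * (x - 1 / x) \<le> (1/2) * (x / \<delta> - \<delta> / x) + ln \<delta>"
proof -
  have mono: "(1/2) * (a / x - x / a) - ln a \<le> (1/2) * (b / x - x / b) - ln b"
    if "0 < a" "a \<le> b" for a b
  proof (rule mono_from_deriv[of "\<lambda>d. (1/2) * (d / x - x / d) - ln d"
        "\<lambda>d. (x - d)\<^sup>2 / (2 * x * d\<^sup>2)", OF _ _ that])
    fix d :: real assume d: "d > 0"
    have "((\<lambda>d. (1/2) * (d / x - x / d) - ln d) has_real_derivative
        (1/2) * (1 / x + x / (d * d)) - 1 / d) (at d)"
      using d x by (auto intro!: derivative_eq_intros)
    moreover have "(1/2) * (1 / x + x / (d * d)) - 1 / d = (x - d)\<^sup>2 / (2 * x * d\<^sup>2)"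
      using d x by (simp add: divide_simps) (simp add: algebra_simps power2_eq_square)
    ultimately show "((\<lambda>d. (1/2) * (d / x - x / d) - ln d) has_real_derivative
        (x - d)\<^sup>2 / (2 * x * d\<^sup>2)) (at d)" by simp
  qed (use x in simp)
  have arith: "c * (r - y) - 0 \<le> c * (q - p) - l \<Longrightarrow> c * (p - q) + l \<le> c * (y - r)"
    "c * (q - p) - l \<le> c * (r - y) - 0 \<Longrightarrow> c * (y - r) \<le> c * (p - q) + l"
    for c l p q r y :: real
    by (simp_all add: algebra_simps)
  show "(1/2) * (x / \<delta> - \<delta> / x) + ln \<delta> \<le> (1/2) * (x - 1 / x)" if "\<delta> \<ge> 1"
    using mono[OF zero_less_one that] unfolding ln_one div_by_1 by (rule arith)
  show "(1/2) * (x - 1 / x) \<le> (1/2) * (x / \<delta> - \<delta> / x) + ln \<delta>" if "\<delta> \<le> 1"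
    using mono[OF assms(2) that] unfolding ln_one div_by_1 by (rule arith)
qed

section \<open>The chain of operator inequalities\<close>

text \<open>In an associative algebra the carrier is larger than the self-adjoint part
  \<open>S\<close>, so its spectra, cone and inverses have to be matched with those formed inside
  \<open>S\<close>. For a JC-algebra, where the cone is given by quadratic forms,
  \<open>cone_iff\<close> is the substantial condition.\<close>

locale op_alg =
  fixes M :: "'a::banach op_algebra" and S :: "'a set"
  assumes sa: "sa_algebra (mul M) (unit M) S"
    and S_carr: "S \<subseteq> carr M"
    and spectrum_S: "a \<in> S \<Longrightarrow> {t. complex_of_real t \<in> spectrum M a} = sa_algebra.spec (mul M) (unit M) S a"
    and cone_iff: "a \<in> S \<Longrightarrow> a \<in> cone M \<longleftrightarrow> sa_algebra.spec (mul M) (unit M) S a \<subseteq> {0..}"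
    and cone_S: "a \<in> carr M \<Longrightarrow> a \<in> cone M \<Longrightarrow> a \<in> S"
    and inverse_S: "a \<in> S \<Longrightarrow> inverse_in (carr M) (mul M) (unit M) a b \<Longrightarrow> b \<in> S"
begin

sublocale sa_algebra "mul M" "unit M" S
  by (rule sa)

lemma cone_pos: "a \<in> S \<Longrightarrow> a \<in> cone M \<longleftrightarrow> a \<in> pos"
  by (simp add: cone_iff pos_def)

lemma fun_calc_eq:
  assumes "a \<in> S" "continuous_on (spec a) f"
  shows "fun_calc M f a = fcalc f a"
  using fcalc_eq_The[OF assms S_carr] spectrum_S[OF assms(1)]
  by (simp add: fun_calc_def poly_calc_def pc_def)

lemma positive_invertible_pos:
  assumes "positive_invertible M a"
  shows "a \<in> S" "a \<in> pos" "regular a" "spec a \<subseteq> {0<..}"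
proof -
  show S: "a \<in> S"
    using assms cone_S by (auto simp: positive_invertible_def)
  then show pos: "a \<in> pos"
    using assms cone_pos by (auto simp: positive_invertible_def)
  show reg: "regular a"
    using assms S inverse_S
    by (auto simp: positive_invertible_def regular_def inverse_pair_def inverse_in_def)
  obtain \<epsilon> where "\<epsilon> > 0" "spec a \<subseteq> {\<epsilon>..}"
    using pos reg by (rule pos_regular_bound)
  then show "spec a \<subseteq> {0<..}" by auto
qed

lemma inverse_pair_unique:
  assumes "x \<in> S" "inverse_pair x y" "inverse_pair x z"
  shows "y = z"
proof -
  have "y = mul M y (mul M x z)" using assms by (simp add: inverse_pair_def unit_right)
  also have "\<dots> = mul M (mul M y x) z" by (simp add: assoc)
  also have "\<dots> = z" using assms by (simp add: inverse_pair_def unit_left)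
  finally show ?thesis .
qed

text \<open>Both sides are inverses of f(a), and inverses are unique; this avoids a composition rule
  for the functional calculus.\<close>

lemma op_inv_fcalc:
  assumes a: "a \<in> S" and f: "continuous_on (spec a) f" "\<And>t. t \<in> spec a \<Longrightarrow> f t > 0"
  shows "op_inv M (fcalc f a) = fcalc (\<lambda>t. inverse (f t)) a"
proof (rule inverse_pair_unique)
  let ?b = "fcalc f a"
  show b: "?b \<in> S" using a f by (intro fcalc_S)
  have nz: "t \<noteq> 0" if "t \<in> spec ?b" for t
    using spec_fcalc_subset[OF a f(1)] f(2) that by force
  have "inverse_pair (fcalc (\<lambda>t. t) ?b) (fcalc inverse ?b)"
    using nz by (intro fcalc_inverse_pair b continuous_on_id) auto
  moreover have "op_inv M ?b = fcalc inverse ?b"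
    unfolding op_inv_def using nz by (intro fun_calc_eq b continuous_intros) auto
  ultimately show "inverse_pair ?b (op_inv M ?b)"
    using b by (simp add: fcalc_id)
  show "inverse_pair ?b (fcalc (\<lambda>t. inverse (f t)) a)"
    using a f(1) by (rule fcalc_inverse_pair) (use f(2) in force)
qed

lemma continuous_on_powr_const:
  assumes "T \<subseteq> {0<..}"
  shows "continuous_on T (\<lambda>t :: real. t powr r)"
  using assms by (intro continuous_intros) auto

lemma op_powr_eq:
  assumes "a \<in> S" "spec a \<subseteq> {0<..}"
  shows "op_powr M a r = fcalc (\<lambda>t. t powr r) a"
  unfolding op_powr_def using assms by (intro fun_calc_eq continuous_on_powr_const)

lemma inverse_pair_op_powr:
  assumes "a \<in> S" "spec a \<subseteq> {0<..}"
  shows "inverse_pair (op_powr M a r) (op_powr M a (- r))"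
proof -
  have "inverse_pair (fcalc (\<lambda>t. t powr r) a) (fcalc (\<lambda>t. inverse (t powr r)) a)"
    using assms by (intro fcalc_inverse_pair continuous_on_powr_const) auto
  then show ?thesis
    using assms by (simp add: op_powr_eq powr_minus)
qed

end

section \<open>Transport of scalar functions on the spectrum of \<open>X\<close>\<close>

locale positive_pair = op_alg +
  fixes A B :: 'a and \<beta> :: real
  assumes posA: "positive_invertible M A" and posB: "positive_invertible M B"
begin

definition X where "X = op_X M \<beta> A B"
definition C where "C = op_powr M A (\<beta> / 2)"
definition \<Phi> where "\<Phi> f = sandwich M C (fcalc f X)"

lemmas A = positive_invertible_pos[OF posA]
lemmas B = positive_invertible_pos[OF posB]

lemma C: "C \<in> S" "inverse_pair C (op_powr M A (- \<beta> / 2))"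
  and C': "op_powr M A (- \<beta> / 2) \<in> S" "inverse_pair (op_powr M A (- \<beta> / 2)) C"
proof -
  show "inverse_pair C (op_powr M A (- \<beta> / 2))"
    using inverse_pair_op_powr[OF A(1,4), of "\<beta> / 2"] by (simp add: C_def)
  show "inverse_pair (op_powr M A (- \<beta> / 2)) C"
    using inverse_pair_op_powr[OF A(1,4), of "- \<beta> / 2"] by (simp add: C_def)
  show "C \<in> S" "op_powr M A (- \<beta> / 2) \<in> S"
    unfolding C_def op_powr_eq[OF A(1,4)] by (intro fcalc_S A(1,4) continuous_on_powr_const)+
qed

lemma X: "X \<in> S" "spec X \<subseteq> {0<..}"
proof -
  have pos: "X \<in> pos"
    unfolding X_def op_X_def sandwich_def by (rule sandwich_pos[OF C' B(2)])
  have reg: "regular X"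
  proof -
    obtain b where "inverse_pair B b"
      using B(3) by (auto simp: regular_def)
    from regularI[OF sandwich_inverse_pair[OF C' B(1) this]] show ?thesis
      by (simp add: X_def op_X_def sandwich_def)
  qed
  show "X \<in> S" using pos by (rule pos_S)
  obtain \<epsilon> where "\<epsilon> > 0" "spec X \<subseteq> {\<epsilon>..}"
    using pos reg by (rule pos_regular_bound)
  then show "spec X \<subseteq> {0<..}" by auto
qed

lemma spec_X_pos: "t \<in> spec X \<Longrightarrow> t > 0"
  using X(2) by auto

lemma sandwich_power: "sandwich M (op_powr M A (- \<beta> / 2)) (op_powr M A \<beta>) = unit M"
proof -
  note cont = continuous_on_powr_const[OF A(4)]
  have "sandwich M (op_powr M A (- \<beta> / 2)) (op_powr M A \<beta>) =
      fcalc (\<lambda>t. t powr (- \<beta> / 2) * t powr \<beta> * t powr (- \<beta> / 2)) A"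
    unfolding sandwich_def op_powr_eq[OF A(1,4)]
    using A(1) by (simp add: fcalc_mult cont continuous_on_mult)
  also have "\<dots> = fcalc (\<lambda>_. 1) A"
    by (rule fcalc_cong) (use A in \<open>auto simp flip: powr_add\<close>)
  finally show ?thesis using A(1) by (simp add: fcalc_const)
qed

lemma sandwich_linear:
  "sandwich M c (x + y) = sandwich M c x + sandwich M c y"
  "sandwich M c (x - y) = sandwich M c x - sandwich M c y"
  "sandwich M c (r *\<^sub>R x) = r *\<^sub>R sandwich M c x"
  by (simp_all add: sandwich_def mult_simps)

text \<open>Conjugation by A^(-\<beta>/2) preserves the cone, sends B to X and, by
  \<open>sandwich_power\<close>, \<delta> A^\<beta> to \<delta> 1.\<close>

lemma
  shows spec_X_ge: "op_le M (\<delta> *\<^sub>R op_powr M A \<beta>) B \<Longrightarrow> t \<in> spec X \<Longrightarrow> t \<ge> \<delta>"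
    and spec_X_le: "op_le M B (\<delta> *\<^sub>R op_powr M A \<beta>) \<Longrightarrow> t \<in> spec X \<Longrightarrow> t \<le> \<delta>"
proof -
  let ?s = "sandwich M (op_powr M A (- \<beta> / 2))"
  have AS: "op_powr M A \<beta> \<in> S"
    unfolding op_powr_eq[OF A(1,4)] by (intro fcalc_S A(1,4) continuous_on_powr_const)
  have X_eq: "?s B = X" by (simp add: X_def op_X_def)
  {
    assume "op_le M (\<delta> *\<^sub>R op_powr M A \<beta>) B" and t: "t \<in> spec X"
    then have "B - \<delta> *\<^sub>R op_powr M A \<beta> \<in> pos"
      using AS B(1) cone_pos by (simp add: op_le_def)
    then have "?s (B - \<delta> *\<^sub>R op_powr M A \<beta>) \<in> pos"
      unfolding sandwich_def by (rule sandwich_pos[OF C'])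
    then have "X - \<delta> *\<^sub>R unit M \<in> pos"
      by (simp only: sandwich_linear sandwich_power X_eq)
    moreover have "t - \<delta> \<in> spec (X - \<delta> *\<^sub>R unit M)"
      using t by (simp add: spec_def algebra_simps)
    ultimately show "t \<ge> \<delta>" by (force simp: pos_def)
  }
  {
    assume "op_le M B (\<delta> *\<^sub>R op_powr M A \<beta>)" and t: "t \<in> spec X"
    then have "\<delta> *\<^sub>R op_powr M A \<beta> - B \<in> pos"
      using AS B(1) cone_pos by (simp add: op_le_def)
    then have "?s (\<delta> *\<^sub>R op_powr M A \<beta> - B) \<in> pos"
      unfolding sandwich_def by (rule sandwich_pos[OF C'])
    then have "\<delta> *\<^sub>R unit M - X \<in> pos"
      by (simp only: sandwich_linear sandwich_power X_eq)
    moreover have "\<delta> - t \<in> spec (\<delta> *\<^sub>R unit M - X)"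
      using spec_unit_diff[OF X(1) t] .
    ultimately show "t \<le> \<delta>" by (force simp: pos_def)
  }
qed

abbreviation cont_X :: "(real \<Rightarrow> real) \<Rightarrow> bool" where
  "cont_X \<equiv> continuous_on (spec X)"

lemma \<Phi>_mono:
  assumes "cont_X f" "cont_X g" "\<And>t. t \<in> spec X \<Longrightarrow> f t \<le> g t"
  shows "op_le M (\<Phi> f) (\<Phi> g)"
proof -
  have "fcalc (\<lambda>t. g t - f t) X \<in> pos"
    using assms X by (intro fcalc_pos continuous_intros) auto
  then have "sandwich M C (fcalc (\<lambda>t. g t - f t) X) \<in> pos"
    unfolding sandwich_def by (rule sandwich_pos[OF C])
  also have "sandwich M C (fcalc (\<lambda>t. g t - f t) X) = \<Phi> g - \<Phi> f"
    using assms X by (simp add: \<Phi>_def fcalc_diff sandwich_linear)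
  finally show ?thesis
    by (simp add: op_le_def pos_S cone_pos)
qed

lemma \<Phi>_linear:
  "cont_X f \<Longrightarrow> cont_X g \<Longrightarrow> \<Phi> f + \<Phi> g = \<Phi> (\<lambda>t. f t + g t)"
  "cont_X f \<Longrightarrow> cont_X g \<Longrightarrow> \<Phi> f - \<Phi> g = \<Phi> (\<lambda>t. f t - g t)"
  "cont_X f \<Longrightarrow> c *\<^sub>R \<Phi> f = \<Phi> (\<lambda>t. c * f t)"
  using X by (simp_all add: \<Phi>_def fcalc_add fcalc_diff fcalc_scaleR sandwich_linear)

lemma \<Phi>_mult:
  "cont_X f \<Longrightarrow> cont_X g \<Longrightarrow> sandwich M C (mul M (fcalc f X) (fcalc g X)) = \<Phi> (\<lambda>t. f t * g t)"
  using X by (simp add: \<Phi>_def fcalc_mult)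

lemma cont_X_powr: "cont_X (\<lambda>t. t powr r)"
  using X by (intro continuous_on_powr_const)

lemma cont_X_ln: "cont_X ln"
  using X by (intro continuous_on_ln continuous_on_id) auto

lemma cont_X_inverse:
  "c \<ge> 0 \<Longrightarrow> cont_X (\<lambda>t. inverse (t powr r + c))" "cont_X (\<lambda>t. inverse (1 + t))"
proof -
  have "t powr r + c > 0" "1 + t > 0" if "t \<in> spec X" "c \<ge> 0" for t
    using spec_X_pos[OF that(1)] that(2) by (simp_all add: add_pos_nonneg)
  then show "c \<ge> 0 \<Longrightarrow> cont_X (\<lambda>t. inverse (t powr r + c))"
    by (intro continuous_intros cont_X_powr) force
  have "1 + t > 0" if "t \<in> spec X" for t
    using spec_X_pos[OF that] by simp
  then show "cont_X (\<lambda>t. inverse (1 + t))"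
    by (intro continuous_intros) force
qed

lemmas cont_X_intros = cont_X_powr cont_X_ln cont_X_inverse continuous_on_const continuous_on_id
  continuous_on_add continuous_on_diff continuous_on_mult

lemma op_powr_X: "op_powr M X r = fcalc (\<lambda>t. t powr r) X"
  using X by (rule op_powr_eq)

lemma geom_mean_eq: "geom_mean M r \<beta> A B = \<Phi> (\<lambda>t. t powr r)"
  by (simp add: geom_mean_def Let_def \<Phi>_def op_powr_X flip: X_def C_def)

lemma op_inv_unit_X: "op_inv M (unit M + X) = fcalc (\<lambda>t. inverse (1 + t)) X"
proof -
  have "unit M + X = fcalc (\<lambda>t. 1 + t) X"
    using X by (simp add: fcalc_add cont_X_intros fcalc_id fcalc_const)
  then show ?thesis
    using X spec_X_pos by (simp add: op_inv_fcalc cont_X_intros add_pos_pos)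
qed

lemma op_inv_sqrt_X:
  assumes "c \<ge> 0"
  shows "op_inv M (op_powr M X (1/2) + c *\<^sub>R unit M) = fcalc (\<lambda>t. inverse (t powr (1/2) + c)) X"
proof -
  have "op_powr M X (1/2) + c *\<^sub>R unit M = fcalc (\<lambda>t. t powr (1/2) + c) X"
    using X by (simp add: fcalc_add cont_X_intros fcalc_const op_powr_X)
  moreover have "t powr (1/2) + c > 0" if "t \<in> spec X" for t
    using spec_X_pos[OF that] assms by (intro add_pos_nonneg) auto
  ultimately show ?thesis
    using X by (simp add: op_inv_fcalc cont_X_intros)
qed

lemma bound_I_eq: "bound_I M \<alpha> \<beta> A B = \<Phi> (\<lambda>t. 2 * ((1 - 2 * inverse (1 + t)) * t powr \<alpha>))"
proof -
  have "unit M - 2 *\<^sub>R op_inv M (unit M + X) = fcalc (\<lambda>t. 1 - 2 * inverse (1 + t)) X"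
    using X by (simp add: op_inv_unit_X fcalc_diff fcalc_scaleR fcalc_const cont_X_intros)
  then show ?thesis
    by (simp add: bound_I_def Let_def op_powr_X \<Phi>_mult \<Phi>_linear cont_X_intros flip: X_def C_def)
qed

lemma bound_II_eq: "bound_II M \<alpha> \<beta> A B =
    \<Phi> (\<lambda>t. 4 * t powr \<alpha> - 8 * (t powr \<alpha> * inverse (t powr (1/2) + 1)))"
  using op_inv_sqrt_X[of 1]
  by (simp add: bound_II_def Let_def op_powr_X geom_mean_eq \<Phi>_mult \<Phi>_linear cont_X_intros flip: X_def C_def)

lemma bound_II'_eq:
  assumes "\<delta> > 0"
  shows "bound_II' M \<delta> \<alpha> \<beta> A B =
    \<Phi> (\<lambda>t. (ln \<delta> + 4) * t powr \<alpha> - 8 * sqrt \<delta> * (inverse (t powr (1/2) + sqrt \<delta>) * t powr \<alpha>))"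
  using op_inv_sqrt_X[of "sqrt \<delta>"] assms
  by (simp add: bound_II'_def Let_def op_powr_X geom_mean_eq \<Phi>_mult \<Phi>_linear cont_X_intros flip: X_def C_def)

lemma rel_entropy_eq: "rel_entropy M \<alpha> \<beta> A B = \<Phi> (\<lambda>t. t powr \<alpha> * ln t)"
  using X by (simp add: rel_entropy_def Let_def op_powr_X op_log_def fun_calc_eq \<Phi>_mult cont_X_intros
      flip: X_def C_def)

lemma bound_III'_eq: "bound_III' M \<delta> \<alpha> \<beta> A B =
    \<Phi> (\<lambda>t. (1 / sqrt \<delta> * t powr (\<alpha> + 1/2) - sqrt \<delta> * t powr (\<alpha> - 1/2)) + ln \<delta> * t powr \<alpha>)"
  by (simp only: bound_III'_def geom_mean_eq \<Phi>_linear cont_X_intros)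

lemma bound_V'_eq: "bound_V' M \<delta> \<alpha> \<beta> A B =
    \<Phi> (\<lambda>t. (1/2) * (1 / \<delta> * t powr (\<alpha> + 1) - \<delta> * t powr (\<alpha> - 1)) + ln \<delta> * t powr \<alpha>)"
  by (simp only: bound_V'_def geom_mean_eq \<Phi>_linear cont_X_intros)

lemma bound_V_eq: "bound_V M \<alpha> \<beta> A B = \<Phi> (\<lambda>t. (1/2) * (t powr (\<alpha> + 1) - t powr (\<alpha> - 1)))"
  by (simp add: bound_V_def geom_mean_eq \<Phi>_linear cont_X_intros)

lemmas bound_eqs = bound_I_eq bound_II_eq bound_II'_eq rel_entropy_eq bound_III'_eq bound_V'_eq
  bound_V_eq

text \<open>All functions in the chain share the nonnegative factor t^\<alpha>. Taking it out
  reduces the comparison to scalar inequalities free of \<alpha>.\<close>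

lemma \<Phi>_mono_weighted:
  assumes "cont_X f" "cont_X g"
    and "\<And>t. t > 0 \<Longrightarrow> f t = t powr \<alpha> * f' t" "\<And>t. t > 0 \<Longrightarrow> g t = t powr \<alpha> * g' t"
    and "\<And>t. t \<in> spec X \<Longrightarrow> f' t \<le> g' t"
  shows "op_le M (\<Phi> f) (\<Phi> g)"
  using assms spec_X_pos by (intro \<Phi>_mono) (simp_all add: mult_left_mono)

context
  fixes \<alpha> \<delta> :: real
  assumes \<delta>: "\<delta> > 0"
begin

lemma cont_X_bounds:
  "cont_X (\<lambda>t. 2 * ((1 - 2 * inverse (1 + t)) * t powr \<alpha>))"
  "cont_X (\<lambda>t. 4 * t powr \<alpha> - 8 * (t powr \<alpha> * inverse (t powr (1/2) + 1)))"
  "cont_X (\<lambda>t. (ln \<delta> + 4) * t powr \<alpha> - 8 * sqrt \<delta> * (inverse (t powr (1/2) + sqrt \<delta>) * t powr \<alpha>))"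
  "cont_X (\<lambda>t. t powr \<alpha> * ln t)"
  "cont_X (\<lambda>t. (1 / sqrt \<delta> * t powr (\<alpha> + 1/2) - sqrt \<delta> * t powr (\<alpha> - 1/2)) + ln \<delta> * t powr \<alpha>)"
  "cont_X (\<lambda>t. (1/2) * (1 / \<delta> * t powr (\<alpha> + 1) - \<delta> * t powr (\<alpha> - 1)) + ln \<delta> * t powr \<alpha>)"
  "cont_X (\<lambda>t. (1/2) * (t powr (\<alpha> + 1) - t powr (\<alpha> - 1)))"
  using \<delta> by (intro cont_X_intros; simp)+

text \<open>Numbered like \<open>cont_X_bounds\<close>: I, II, II', S, III', V', V. The identity for
  S is trivial and keeps the numbering aligned.\<close>

lemma weights:
  "t > 0 \<Longrightarrow> 2 * ((1 - 2 * inverse (1 + t)) * t powr \<alpha>) = t powr \<alpha> * (2 * (1 - 2 * inverse (1 + t)))"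
  "t > 0 \<Longrightarrow> 4 * t powr \<alpha> - 8 * (t powr \<alpha> * inverse (t powr (1/2) + 1)) =
    t powr \<alpha> * (4 - 8 * inverse (t powr (1/2) + 1))"
  "t > 0 \<Longrightarrow> (ln \<delta> + 4) * t powr \<alpha> - 8 * sqrt \<delta> * (inverse (t powr (1/2) + sqrt \<delta>) * t powr \<alpha>) =
    t powr \<alpha> * (ln \<delta> + 4 - 8 * sqrt \<delta> * inverse (t powr (1/2) + sqrt \<delta>))"
  "t > 0 \<Longrightarrow> t powr \<alpha> * ln t = t powr \<alpha> * ln t"
  "t > 0 \<Longrightarrow> (1 / sqrt \<delta> * t powr (\<alpha> + 1/2) - sqrt \<delta> * t powr (\<alpha> - 1/2)) + ln \<delta> * t powr \<alpha> =
    t powr \<alpha> * (sqrt t / sqrt \<delta> - sqrt \<delta> / sqrt t + ln \<delta>)"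
  "t > 0 \<Longrightarrow> (1/2) * (1 / \<delta> * t powr (\<alpha> + 1) - \<delta> * t powr (\<alpha> - 1)) + ln \<delta> * t powr \<alpha> =
    t powr \<alpha> * ((1/2) * (t / \<delta> - \<delta> / t) + ln \<delta>)"
  "t > 0 \<Longrightarrow> (1/2) * (t powr (\<alpha> + 1) - t powr (\<alpha> - 1)) = t powr \<alpha> * ((1/2) * (t - 1 / t))"
  for t :: real
  by (simp_all add: powr_add powr_diff powr_half_sqrt algebra_simps)

lemma chain_ge:
  assumes "\<delta> \<ge> 1" and le: "op_le M (\<delta> *\<^sub>R op_powr M A \<beta>) B"
  shows "successively (op_le M)
    [bound_I M \<alpha> \<beta> A B, bound_II M \<alpha> \<beta> A B, bound_II' M \<delta> \<alpha> \<beta> A B, rel_entropy M \<alpha> \<beta> A B,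
     bound_III' M \<delta> \<alpha> \<beta> A B, bound_V' M \<delta> \<alpha> \<beta> A B, bound_V M \<alpha> \<beta> A B]"
proof -
  \<comment> \<open>The bound t \<ge> 1 serves I \<le> II, and \<delta> \<ge> 1 serves II \<le> II'
    and V' \<le> V; the three inner links rest on t \<ge> \<delta>.\<close>
  have t: "t > 0" "t \<ge> \<delta>" "t \<ge> 1" if "t \<in> spec X" for t
    using spec_X_ge[OF le that] spec_X_pos[OF that] assms(1) by auto
  note mono = \<Phi>_mono_weighted[where \<alpha> = \<alpha>]
  have ineq:
    "2 * (1 - 2 * inverse (1 + t)) \<le> 4 - 8 * inverse (t powr (1/2) + 1)"
    "4 - 8 * inverse (t powr (1/2) + 1) \<le> ln \<delta> + 4 - 8 * sqrt \<delta> * inverse (t powr (1/2) + sqrt \<delta>)"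
    "ln \<delta> + 4 - 8 * sqrt \<delta> * inverse (t powr (1/2) + sqrt \<delta>) \<le> ln t"
    "ln t \<le> sqrt t / sqrt \<delta> - sqrt \<delta> / sqrt t + ln \<delta>"
    "sqrt t / sqrt \<delta> - sqrt \<delta> / sqrt t + ln \<delta> \<le> (1/2) * (t / \<delta> - \<delta> / t) + ln \<delta>"
    "(1/2) * (t / \<delta> - \<delta> / t) + ln \<delta> \<le> (1/2) * (t - 1 / t)"
    if "t \<in> spec X" for t
  proof -
    show "2 * (1 - 2 * inverse (1 + t)) \<le> 4 - 8 * inverse (t powr (1/2) + 1)"
      by (rule ineq_I_II(1)) (use t[OF that] \<delta> assms(1) in simp_all)
    show "4 - 8 * inverse (t powr (1/2) + 1) \<le> ln \<delta> + 4 - 8 * sqrt \<delta> * inverse (t powr (1/2) + sqrt \<delta>)"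
      by (rule ineq_II_II'(1)) (use t[OF that] \<delta> assms(1) in simp_all)
    show "ln \<delta> + 4 - 8 * sqrt \<delta> * inverse (t powr (1/2) + sqrt \<delta>) \<le> ln t"
      by (rule ineq_II'_ln(1)) (use t[OF that] \<delta> assms(1) in simp_all)
    show "ln t \<le> sqrt t / sqrt \<delta> - sqrt \<delta> / sqrt t + ln \<delta>"
      by (rule ineq_ln_III'(1)) (use t[OF that] \<delta> assms(1) in simp_all)
    show "sqrt t / sqrt \<delta> - sqrt \<delta> / sqrt t + ln \<delta> \<le> (1/2) * (t / \<delta> - \<delta> / t) + ln \<delta>"
      by (intro add_right_mono ineq_III'_V'(1)) (use t[OF that] \<delta> assms(1) in simp_all)
    show "(1/2) * (t / \<delta> - \<delta> / t) + ln \<delta> \<le> (1/2) * (t - 1 / t)"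
      by (rule ineq_V'_V(1)) (use t[OF that] \<delta> assms(1) in simp_all)
  qed
  show ?thesis
    unfolding bound_eqs(1,2,4-) bound_II'_eq[OF \<delta>] successively.simps
    by (intro conjI TrueI
      mono[OF cont_X_bounds(1) cont_X_bounds(2) weights(1) weights(2)]
      mono[OF cont_X_bounds(2) cont_X_bounds(3) weights(2) weights(3)]
      mono[OF cont_X_bounds(3) cont_X_bounds(4) weights(3) weights(4)]
      mono[OF cont_X_bounds(4) cont_X_bounds(5) weights(4) weights(5)]
      mono[OF cont_X_bounds(5) cont_X_bounds(6) weights(5) weights(6)]
      mono[OF cont_X_bounds(6) cont_X_bounds(7) weights(6) weights(7)] ineq)
qed

lemma chain_le:
  assumes "\<delta> \<le> 1" and le: "op_le M B (\<delta> *\<^sub>R op_powr M A \<beta>)"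
  shows "successively (op_le M)
    [bound_V M \<alpha> \<beta> A B, bound_V' M \<delta> \<alpha> \<beta> A B, bound_III' M \<delta> \<alpha> \<beta> A B, rel_entropy M \<alpha> \<beta> A B,
     bound_II' M \<delta> \<alpha> \<beta> A B, bound_II M \<alpha> \<beta> A B, bound_I M \<alpha> \<beta> A B]"
proof -
  have t: "t > 0" "t \<le> \<delta>" "t \<le> 1" if "t \<in> spec X" for t
    using spec_X_le[OF le that] spec_X_pos[OF that] assms(1) by auto
  note mono = \<Phi>_mono_weighted[where \<alpha> = \<alpha>]
  have ineq:
    "4 - 8 * inverse (t powr (1/2) + 1) \<le> 2 * (1 - 2 * inverse (1 + t))"
    "ln \<delta> + 4 - 8 * sqrt \<delta> * inverse (t powr (1/2) + sqrt \<delta>) \<le> 4 - 8 * inverse (t powr (1/2) + 1)"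
    "ln t \<le> ln \<delta> + 4 - 8 * sqrt \<delta> * inverse (t powr (1/2) + sqrt \<delta>)"
    "sqrt t / sqrt \<delta> - sqrt \<delta> / sqrt t + ln \<delta> \<le> ln t"
    "(1/2) * (t / \<delta> - \<delta> / t) + ln \<delta> \<le> sqrt t / sqrt \<delta> - sqrt \<delta> / sqrt t + ln \<delta>"
    "(1/2) * (t - 1 / t) \<le> (1/2) * (t / \<delta> - \<delta> / t) + ln \<delta>"
    if "t \<in> spec X" for t
  proof -
    show "4 - 8 * inverse (t powr (1/2) + 1) \<le> 2 * (1 - 2 * inverse (1 + t))"
      by (rule ineq_I_II(2)) (use t[OF that] \<delta> assms(1) in simp_all)
    show "ln \<delta> + 4 - 8 * sqrt \<delta> * inverse (t powr (1/2) + sqrt \<delta>) \<le> 4 - 8 * inverse (t powr (1/2) + 1)"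
      by (rule ineq_II_II'(2)) (use t[OF that] \<delta> assms(1) in simp_all)
    show "ln t \<le> ln \<delta> + 4 - 8 * sqrt \<delta> * inverse (t powr (1/2) + sqrt \<delta>)"
      by (rule ineq_II'_ln(2)) (use t[OF that] \<delta> assms(1) in simp_all)
    show "sqrt t / sqrt \<delta> - sqrt \<delta> / sqrt t + ln \<delta> \<le> ln t"
      by (rule ineq_ln_III'(2)) (use t[OF that] \<delta> assms(1) in simp_all)
    show "(1/2) * (t / \<delta> - \<delta> / t) + ln \<delta> \<le> sqrt t / sqrt \<delta> - sqrt \<delta> / sqrt t + ln \<delta>"
      by (intro add_right_mono ineq_III'_V'(2)) (use t[OF that] \<delta> assms(1) in simp_all)
    show "(1/2) * (t - 1 / t) \<le> (1/2) * (t / \<delta> - \<delta> / t) + ln \<delta>"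
      by (rule ineq_V'_V(2)) (use t[OF that] \<delta> assms(1) in simp_all)
  qed
  show ?thesis
    unfolding bound_eqs(1,2,4-) bound_II'_eq[OF \<delta>] successively.simps
    by (intro conjI TrueI
      mono[OF cont_X_bounds(2) cont_X_bounds(1) weights(2) weights(1)]
      mono[OF cont_X_bounds(3) cont_X_bounds(2) weights(3) weights(2)]
      mono[OF cont_X_bounds(4) cont_X_bounds(3) weights(4) weights(3)]
      mono[OF cont_X_bounds(5) cont_X_bounds(4) weights(5) weights(4)]
      mono[OF cont_X_bounds(6) cont_X_bounds(5) weights(6) weights(5)]
      mono[OF cont_X_bounds(7) cont_X_bounds(6) weights(7) weights(6)] ineq)
qed

end

end

section \<open>\<open>C\<^sup>*\<close>-algebras and real \<open>C\<^sup>*\<close>-algebras\<close>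

lemma (in banach_star_algebra) star_one: "star 1 = 1"
  by (metis mult_1_left mult_1_right star_mult star_star)

text \<open>Rescaling turns this into t^2 (e + x^2) with x = (a - s e) / t. It excludes nonreal
  spectral values: the element is (a - z)(a - z') for z = s + i t with conjugate z'.\<close>

lemma (in sa_algebra) shifted_square_plus:
  assumes "a \<in> S" "t \<noteq> 0"
  shows "\<exists>y. inverse_pair ((a - s *\<^sub>R e) \<odot> (a - s *\<^sub>R e) + t\<^sup>2 *\<^sub>R e) y"
proof -
  define b where "b = a - s *\<^sub>R e"
  let ?x = "inverse t *\<^sub>R b"
  obtain y where y: "y \<in> S" "(e + ?x \<odot> ?x) \<odot> y = e" "y \<odot> (e + ?x \<odot> ?x) = e"
    using one_plus_square[of ?x] assms by (auto simp: b_def)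
  have "b \<odot> b + t\<^sup>2 *\<^sub>R e = t\<^sup>2 *\<^sub>R (e + ?x \<odot> ?x)"
    using assms(2) by (simp add: scaleR_left scaleR_right scaleR_add_right power2_eq_square field_simps)
  then have "inverse_pair (b \<odot> b + t\<^sup>2 *\<^sub>R e) (inverse (t\<^sup>2) *\<^sub>R y)"
    using y assms(2) by (simp add: inverse_pair_def scaleR_left scaleR_right)
  then show ?thesis unfolding b_def by blast
qed

lemma banach_mult_times: "banach_mult ((*) :: 'a::{real_normed_algebra,banach} \<Rightarrow> 'a \<Rightarrow> 'a)"
  by (rule banach_mult.intro[OF bounded_bilinear_mult]) (simp_all add: mult.assoc norm_mult_ineq)

lemma star_inverse:
  fixes x y :: "'a::banach_star_algebra"
  assumes "star x = x" "x * y = 1" "y * x = 1"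
  shows "star y = y"
proof -
  have "star y * x = 1"
    using assms star_mult[of x y] star_one by metis
  then have "star y * x * y = y" by simp
  then show ?thesis
    using assms by (simp add: mult.assoc)
qed

lemma star_zero: "star (0 :: 'a::banach_star_algebra) = 0"
  using star_scaleR[of 0 "0 :: 'a"] by simp

lemma star_diff: "star (x - y) = star x - star (y :: 'a::banach_star_algebra)"
  using star_add[of "x - y" y] by simp

lemma sa_algebra_star:
  assumes cstar: "\<And>x :: 'a::banach_star_algebra. norm (star x * x) = (norm x)\<^sup>2"
    and plus: "\<And>x :: 'a. star x = x \<Longrightarrow> \<exists>y. (1 + x * x) * y = 1 \<and> y * (1 + x * x) = 1"
  shows "sa_algebra ((*) :: 'a \<Rightarrow> 'a \<Rightarrow> 'a) 1 {a. star a = a}"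
proof -
  interpret banach_mult "(*) :: 'a \<Rightarrow> 'a \<Rightarrow> 'a" 1
    by (rule banach_mult_times)
  \<comment> \<open>Applied to star x as well, this bounds the involution, which is thus continuous;
    hence the self-adjoint part is closed.\<close>
  have le: "norm x \<le> norm (star x)" for x :: 'a
  proof (cases "x = 0")
    case False
    have "norm x * norm x \<le> norm (star x) * norm x"
      using norm_mult_ineq[of "star x" x] by (simp add: cstar power2_eq_square)
    then show ?thesis using False by simp
  qed simp
  have "bounded_linear (star :: 'a \<Rightarrow> 'a)"
    by (rule bounded_linear_intro[of _ 1])
      (use le[of "star _"] in \<open>simp_all add: star_add star_scaleR star_star\<close>)
  then have cont: "continuous_on UNIV (star :: 'a \<Rightarrow> 'a)"
    by (rule linear_continuous_on)
  show ?thesis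
  proof
    show "subspace {a :: 'a. star a = a}"
      by (simp add: subspace_def star_add star_scaleR star_zero)
    show "closed {a :: 'a. star a = a}"
      by (intro closed_Collect_eq cont continuous_on_id)
    fix x y :: 'a
    assume "x \<in> {a. star a = a}"
    then have x: "star x = x" by simp
    show "norm (x * x) = (norm x)\<^sup>2" using cstar[of x] x by simp
    obtain z where z: "(1 + x * x) * z = 1" "z * (1 + x * x) = 1" using plus[OF x] by blast
    have "star (1 + x * x) = 1 + x * x"
      by (simp add: star_add star_mult star_one x)
    from star_inverse[OF this z] z
    show "\<exists>y\<in>{a. star a = a}. (1 + x * x) * y = 1 \<and> y * (1 + x * x) = 1" by blast
    assume "y \<in> {a. star a = a}"
    then have y: "star y = y" by simp
    show "x * y * x \<in> {a. star a = a}"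
      by (simp add: star_mult x y mult.assoc)
    assume "x * y = y * x"
    then show "x * y \<in> {a. star a = a}"
      by (simp add: star_mult x y)
  qed (simp_all add: star_one)
qed

lemma spectrum_nonneg_iff:
  assumes "\<And>t. complex_of_real t \<in> Z \<longleftrightarrow> t \<in> T" "\<And>z. z \<in> Z \<Longrightarrow> Im z = 0"
  shows "Z \<subseteq> \<real>\<^sub>\<ge>\<^sub>0 \<longleftrightarrow> T \<subseteq> {0..}"
proof
  assume "Z \<subseteq> \<real>\<^sub>\<ge>\<^sub>0"
  then show "T \<subseteq> {0..}" using assms(1) by (force simp: complex_nonneg_Reals_iff)
next
  assume T: "T \<subseteq> {0..}"
  show "Z \<subseteq> \<real>\<^sub>\<ge>\<^sub>0"
  proof
    fix z assume z: "z \<in> Z"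
    then have "z = of_real (Re z)" using assms(2) by (simp add: complex_eq_iff)
    then have "Re z \<in> T" using z assms(1) by metis
    then show "z \<in> \<real>\<^sub>\<ge>\<^sub>0" using assms(2)[OF z] T by (auto simp: complex_nonneg_Reals_iff)
  qed
qed

section \<open>Real algebras\<close>

lemma op_alg_real_cstar: "op_alg (real_cstar_alg :: 'a::real_cstar_algebra op_algebra) {a. star a = a}"
proof -
  have "\<exists>y. (1 + x * x) * y = 1 \<and> y * (1 + x * x) = 1" if "star x = x" for x :: 'a
    using one_plus_star_mult_invertible[of x] that by simp
  then interpret sa_algebra "(*) :: 'a \<Rightarrow> 'a \<Rightarrow> 'a" 1 "{a. star a = a}"
    by (intro sa_algebra_star real_cstar_identity)
  have real: "complex_of_real t \<in> real_cstar_spectrum a \<longleftrightarrow> t \<in> spec a" if "star a = a" for t and a :: 'a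
  proof -
    let ?x = "a - t *\<^sub>R 1"
    \<comment> \<open>At a real point the spectrum asks for an inverse b of (a - t)^2 instead of a -
      t. With x = a - t, the elements b x and x b are a left and a right inverse of x, hence
      equal.\<close>
    have "(\<exists>b. inverse_in UNIV (*) 1 (?x * ?x) b) \<longleftrightarrow> regular ?x"
    proof
      assume "\<exists>b. inverse_in UNIV (*) 1 (?x * ?x) b"
      then obtain b where b: "?x * (?x * b) = 1" "(b * ?x) * ?x = 1"
        by (auto simp: inverse_in_def mult.assoc)
      have "b * ?x = (b * ?x) * (?x * (?x * b))" using b by simp
      also have "\<dots> = ?x * b" using b by (metis mult.assoc mult_1_left)
      finally have b': "(?x * b) * ?x = 1" using b by simp
      have "star ?x = ?x" using that by (simp add: star_diff star_scaleR star_one)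
      from star_inverse[OF this b(1) b'] b(1) b'
      show "regular ?x" by (auto simp: regular_def inverse_pair_def)
    next
      assume "regular ?x"
      then obtain b where b: "?x * b = 1" "b * ?x = 1"
        by (auto simp: regular_def inverse_pair_def)
      have "?x * ?x * (b * b) = ?x * (?x * b) * b" "b * b * (?x * ?x) = b * (b * ?x) * ?x"
        by (simp_all only: mult.assoc)
      then show "\<exists>b. inverse_in UNIV (*) 1 (?x * ?x) b"
        using b by (auto simp: inverse_in_def intro!: exI[of _ "b * b"])
    qed
    then show ?thesis by (simp add: real_cstar_spectrum_def spec_def) blast
  qed
  have im: "Im z = 0" if "star a = a" "z \<in> real_cstar_spectrum a" for z and a :: 'a
    using shifted_square_plus[of a "Im z" "Re z"] that
    by (auto simp: real_cstar_spectrum_def inverse_in_def inverse_pair_def)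
  show ?thesis
  proof (rule op_alg.intro)
    show "sa_algebra (mul (real_cstar_alg :: 'a op_algebra)) (unit real_cstar_alg) {a. star a = a}"
      using sa_algebra_axioms by (simp add: real_cstar_alg_def)
    fix a :: 'a assume "a \<in> {a. star a = a}"
    then have a: "star a = a" by simp
    show "{t. complex_of_real t \<in> spectrum real_cstar_alg a} =
        sa_algebra.spec (mul real_cstar_alg) (unit real_cstar_alg) {a. star a = a} a"
      using real[OF a] by (simp add: real_cstar_alg_def)
    have "real_cstar_spectrum a \<subseteq> \<real>\<^sub>\<ge>\<^sub>0 \<longleftrightarrow> spec a \<subseteq> {0..}"
      using real[OF a] im[OF a] by (rule spectrum_nonneg_iff)
    then show "a \<in> cone real_cstar_alg \<longleftrightarrow>
        sa_algebra.spec (mul real_cstar_alg) (unit real_cstar_alg) {a. star a = a} a \<subseteq> {0..}"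
      using a by (simp add: real_cstar_alg_def)
    show "inverse_in (carr real_cstar_alg) (mul real_cstar_alg) (unit real_cstar_alg) a b \<Longrightarrow>
        b \<in> {a. star a = a}" for b
      using star_inverse[OF a] by (simp add: real_cstar_alg_def inverse_in_def)
  qed (simp_all add: real_cstar_alg_def)
qed

section \<open>Complex algebras\<close>

lemma scaleC_minus_left: "(- z) *\<^sub>C (x :: 'a::complex_banach) = - (z *\<^sub>C x)"
  using scaleC_of_real[of "-1" "z *\<^sub>C x"] by (simp add: scaleC_scaleC)

text \<open>Arens' argument: \<open>\<parallel>x + i t\<parallel>\<^sup>2 \<le> \<parallel>x\<parallel>\<^sup>2 + t\<^sup>2 < (1 + t)\<^sup>2\<close> for large \<open>t\<close>, so that
  \<open>1 + i x = (1 + t) + i (x + i t)\<close> is invertible.\<close>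

lemma cstar_one_plus_i_invertible:
  fixes x :: "'a::cstar_algebra"
  assumes x: "star x = x"
  shows "\<exists>v. (1 + \<i> *\<^sub>C x) * v = 1 \<and> v * (1 + \<i> *\<^sub>C x) = 1"
proof -
  define J where "J = \<i> *\<^sub>C (1 :: 'a)"
  have J: "J * y = \<i> *\<^sub>C y" "y * J = \<i> *\<^sub>C y" for y
    by (simp_all add: J_def scaleC_mult_left scaleC_mult_right)
  then have JC: "x * J = J * x" by simp
  have JJ: "J * J = - 1"
    using scaleC_of_real[of "-1" "1 :: 'a"] by (simp add: J) (simp add: J_def scaleC_scaleC)
  have norm_J: "norm (J * y) = norm y" for y
    by (simp add: J norm_scaleC)
  have star_J: "star J = - J"
    by (simp add: J_def star_scaleC star_one scaleC_minus_left)
  have norm_1: "norm (1 :: 'a) \<le> 1"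
    using cstar_identity[of "1 :: 'a"] by (auto simp: star_one power2_eq_square)
  \<comment> \<open>This size is enough: norm x^2 + t^2 = t + t^2 < (1 + t)^2.\<close>
  define t where "t = (norm x)\<^sup>2"
  have t: "t \<ge> 0" by (simp add: t_def)
  define w where "w = x + t *\<^sub>R J"
  have "star w * w = (x - t *\<^sub>R J) * (x + t *\<^sub>R J)"
    by (simp add: w_def star_add star_scaleR star_J x)
  also have "\<dots> = x * x + (t * t) *\<^sub>R 1"
    by (simp add: algebra_simps JJ JC)
  finally have "(norm w)\<^sup>2 = norm (x * x + (t * t) *\<^sub>R 1)"
    by (metis cstar_identity)
  also have "\<dots> \<le> norm x * norm x + (t * t) * norm (1 :: 'a)"
    by (rule norm_triangle_le) (simp add: norm_mult_ineq)
  also have "\<dots> \<le> norm x * norm x + (t * t) * 1"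
    using norm_1 by (intro add_left_mono mult_left_mono) auto
  also have "\<dots> < (1 + t)\<^sup>2"
    using t by (simp add: t_def power2_eq_square algebra_simps add_pos_nonneg)
  finally have norm_w: "norm w < 1 + t"
    using t by (simp add: power2_less_imp_less)
  \<comment> \<open>Chosen so that (1 + t)(1 - z) = 1 + t + J w = 1 + J x, the terms in t cancelling
    by J^2 = -1.\<close>
  define z where "z = - (1 / (1 + t)) *\<^sub>R (J * w)"
  have "norm z < 1"
    using norm_w t by (simp add: z_def norm_J)
  interpret banach_mult "(*) :: 'a \<Rightarrow> 'a \<Rightarrow> 'a" 1
    by (rule banach_mult_times)
  have "closed {u. z * u = u * z}"
    by (intro closed_Collect_eq continuous_intros)
  then obtain u where u: "z * u = u * z" "u = 1 + z * u"
  proof (rule neumann)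
    show "{u. z * u = u * z} \<noteq> {}" by (auto intro: exI[of _ 1])
    show "1 + z * u \<in> {u. z * u = u * z}" if "u \<in> {u. z * u = u * z}" for u
      using that by (simp add: distrib_left distrib_right) (metis mult.assoc)
  qed (use \<open>norm z < 1\<close> in auto)
  have "(1 - z) * u = 1" "u * (1 - z) = 1"
    using u by (simp_all add: algebra_simps)
  moreover have "1 + J * x = (1 + t) *\<^sub>R (1 - z)"
  proof -
    have "(1 + t) *\<^sub>R (1 - z) = (1 + t) *\<^sub>R 1 + J * w"
      using t by (simp add: z_def scaleR_add_right)
    then show ?thesis by (simp add: w_def scaleR_add_left distrib_left JJ)
  qed
  ultimately have "(1 + J * x) * ((1 / (1 + t)) *\<^sub>R u) = 1 \<and> ((1 / (1 + t)) *\<^sub>R u) * (1 + J * x) = 1"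
    using t by simp
  then show ?thesis unfolding J(1) by (rule exI)
qed

text \<open>1 + x^2 = (1 + i x)(1 - i x), and both factors are invertible.\<close>

lemma cstar_one_plus_square_invertible:
  fixes x :: "'a::cstar_algebra"
  assumes x: "star x = x"
  shows "\<exists>y. (1 + x * x) * y = 1 \<and> y * (1 + x * x) = 1"
proof -
  obtain v w where v: "(1 + \<i> *\<^sub>C x) * v = 1" "v * (1 + \<i> *\<^sub>C x) = 1"
    and w: "(1 + \<i> *\<^sub>C (- x)) * w = 1" "w * (1 + \<i> *\<^sub>C (- x)) = 1"
    using cstar_one_plus_i_invertible[of x] cstar_one_plus_i_invertible[of "- x"] x
      star_scaleR[of "-1" x] by auto
  have "(\<i> *\<^sub>C x) * (\<i> *\<^sub>C (- x)) = complex_of_real (- 1) *\<^sub>C (x * - x)"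
    by (simp only: scaleC_mult_left scaleC_mult_right scaleC_scaleC) simp
  also have "\<dots> = x * x"
    by (simp only: scaleC_of_real) simp
  finally have "(\<i> *\<^sub>C x) * (\<i> *\<^sub>C (- x)) = x * x" .
  moreover have "\<i> *\<^sub>C (- x) = - (\<i> *\<^sub>C x)"
    using scaleC_add_right[of \<i> x "- x"] scaleC_add_right[of \<i> x 0] by (simp add: minus_unique)
  ultimately have eq: "1 + x * x = (1 + \<i> *\<^sub>C x) * (1 + \<i> *\<^sub>C (- x))"
    by (simp add: algebra_simps) (metis add.commute neg_eq_iff_add_eq_0)
  have "(1 + x * x) * (w * v) = 1" "w * v * (1 + x * x) = 1"
    unfolding eq by (metis v w mult.assoc mult_1_left mult_1_right)+
  then show ?thesis by blast
qed

lemma op_alg_cstar: "op_alg (cstar_alg :: 'a::cstar_algebra op_algebra) {a. star a = a}"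
proof -
  interpret sa_algebra "(*) :: 'a \<Rightarrow> 'a \<Rightarrow> 'a" 1 "{a. star a = a}"
    by (intro sa_algebra_star cstar_identity cstar_one_plus_square_invertible)
  have real: "complex_of_real t \<in> cstar_spectrum a \<longleftrightarrow> t \<in> spec a" if "star a = a" for t and a :: 'a
  proof -
    have "star (a - t *\<^sub>R 1) = a - t *\<^sub>R 1" using that by (simp add: star_diff star_scaleR star_one)
    from star_inverse[OF this] show ?thesis
      by (auto simp: cstar_spectrum_def spec_def regular_def inverse_pair_def inverse_in_def
          scaleC_of_real)
  qed
  have im: "Im z = 0" if a: "star a = a" and z: "z \<in> cstar_spectrum a" for z and a :: 'a
  proof (rule ccontr)
    assume "Im z \<noteq> 0"
    then obtain y where y: "inverse_pair ((a - Re z *\<^sub>R 1) * (a - Re z *\<^sub>R 1) + (Im z)\<^sup>2 *\<^sub>R 1) y"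
      using shifted_square_plus[of a "Im z" "Re z"] a by auto
    define b J where "b = a - Re z *\<^sub>R 1" and "J = \<i> *\<^sub>C (1 :: 'a)"
    have J: "b * J = J * b"
      by (simp add: J_def scaleC_mult_left scaleC_mult_right)
    have JJ: "J * J = - 1"
      using scaleC_of_real[of "-1" "1 :: 'a"] by (simp add: J_def scaleC_scaleC scaleC_mult_left)
    \<comment> \<open>\<open>p\<close> is a - z and \<open>q\<close> is a minus the conjugate of z.
      They commute and y inverts their product, so y q = q y inverts \<open>p\<close>.\<close>
    define p q where "p = b - Im z *\<^sub>R J" and "q = b + Im z *\<^sub>R J"
    have pq: "p * q = b * b + (Im z)\<^sup>2 *\<^sub>R 1" "q * p = b * b + (Im z)\<^sup>2 *\<^sub>R 1"
      by (simp_all add: p_def q_def algebra_simps J JJ power2_eq_square)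
    have y': "p * q * y = 1" "y * (q * p) = 1"
      using y by (simp_all add: pq inverse_pair_def b_def)
    have "y * q = y * q * (p * q * y)" using y' by simp
    also have "\<dots> = (y * (q * p)) * (q * y)" by (simp only: mult.assoc)
    also have "\<dots> = q * y" using y' by simp
    finally have "inverse_in UNIV (*) 1 p (q * y)"
      using y' by (simp add: inverse_in_def flip: mult.assoc)
    moreover have "p = a - z *\<^sub>C 1"
    proof -
      have "z *\<^sub>C (1 :: 'a) = complex_of_real (Re z) *\<^sub>C 1 + complex_of_real (Im z) *\<^sub>C \<i> *\<^sub>C 1"
        unfolding scaleC_scaleC scaleC_add_left[symmetric] by (metis complex_eq mult.commute)
      then show ?thesis by (simp add: p_def b_def J_def scaleC_of_real)
    qed
    ultimately show False using z by (auto simp: cstar_spectrum_def)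
  qed
  show ?thesis
  proof (rule op_alg.intro)
    show "sa_algebra (mul (cstar_alg :: 'a op_algebra)) (unit cstar_alg) {a. star a = a}"
      using sa_algebra_axioms by (simp add: cstar_alg_def)
    fix a :: 'a assume "a \<in> {a. star a = a}"
    then have a: "star a = a" by simp
    show "{t. complex_of_real t \<in> spectrum cstar_alg a} =
        sa_algebra.spec (mul cstar_alg) (unit cstar_alg) {a. star a = a} a"
      using real[OF a] by (simp add: cstar_alg_def)
    have "cstar_spectrum a \<subseteq> \<real>\<^sub>\<ge>\<^sub>0 \<longleftrightarrow> spec a \<subseteq> {0..}"
      using real[OF a] im[OF a] by (rule spectrum_nonneg_iff)
    then show "a \<in> cone cstar_alg \<longleftrightarrow>
        sa_algebra.spec (mul cstar_alg) (unit cstar_alg) {a. star a = a} a \<subseteq> {0..}"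
      using a by (simp add: cstar_alg_def)
    show "inverse_in (carr cstar_alg) (mul cstar_alg) (unit cstar_alg) a b \<Longrightarrow>
        b \<in> {a. star a = a}" for b
      using star_inverse[OF a] by (simp add: cstar_alg_def inverse_in_def)
  qed (simp_all add: cstar_alg_def)
qed

section \<open>JC-algebras\<close>

definition re_inner :: "'h::complex_hilbert_space \<Rightarrow> 'h \<Rightarrow> real" where
  "re_inner x y = Re (cinner x y)"

lemma re_inner_commute: "re_inner x y = re_inner y x"
  unfolding re_inner_def by (subst cinner_commute) simp

lemma re_inner_self: "re_inner x x = (norm x)\<^sup>2"
  by (simp add: re_inner_def cinner_self)

lemma re_inner_add: "re_inner (x + y) z = re_inner x z + re_inner y z"
  by (simp add: re_inner_def cinner_add_left)

lemma re_inner_scaleR: "re_inner (r *\<^sub>R x) y = r * re_inner x y"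
  by (simp add: re_inner_def cinner_scaleC_left flip: scaleC_of_real)

lemma norm_diff_square: "(norm (x - s *\<^sub>R y))\<^sup>2 = (norm x)\<^sup>2 - 2 * s * re_inner x y + s\<^sup>2 * (norm y)\<^sup>2"
proof -
  have "(norm (x + (- s) *\<^sub>R y))\<^sup>2 = re_inner x (x + (- s) *\<^sub>R y) + (- s) * re_inner y (x + (- s) *\<^sub>R y)"
    by (simp only: re_inner_add re_inner_scaleR flip: re_inner_self)
  also have "re_inner x (x + (- s) *\<^sub>R y) = (norm x)\<^sup>2 + (- s) * re_inner x y"
    by (subst re_inner_commute) (simp only: re_inner_add re_inner_scaleR re_inner_self re_inner_commute[of y x])
  also have "re_inner y (x + (- s) *\<^sub>R y) = re_inner x y + (- s) * (norm y)\<^sup>2"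
    by (subst re_inner_commute) (simp only: re_inner_add re_inner_scaleR re_inner_self)
  finally show ?thesis
    by (simp add: algebra_simps power2_eq_square)
qed

lemma re_inner_le: "re_inner x y \<le> norm x * norm y"
proof (cases "y = 0")
  case True
  have "re_inner x 0 = 0"
    using re_inner_scaleR[of 0 0 x] by (subst re_inner_commute) simp
  then show ?thesis using True by simp
next
  case False
  define n r where "n = (norm y)\<^sup>2" and "r = re_inner x y"
  have n: "n > 0" using False by (simp add: n_def)
  \<comment> \<open>The coefficient r / n minimises the norm of x - s y over real s.\<close>
  have "0 \<le> (norm x)\<^sup>2 - 2 * (r / n) * r + (r / n)\<^sup>2 * n"
    unfolding n_def r_def norm_diff_square[symmetric] by simp
  also have "\<dots> = (norm x)\<^sup>2 - r\<^sup>2 / n"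
    using n by (simp add: power2_eq_square)
  finally have "r\<^sup>2 \<le> (norm x)\<^sup>2 * n"
    using n by (simp add: pos_divide_le_eq)
  then have "r\<^sup>2 \<le> (norm x * norm y)\<^sup>2"
    by (simp add: n_def power_mult_distrib)
  then have "r \<le> norm x * norm y"
    by (rule power2_le_imp_le) simp
  then show ?thesis by (simp add: r_def)
qed

lemma self_adjoint_re_inner:
  "self_adjoint_op T \<Longrightarrow> re_inner (blinfun_apply T x) y = re_inner x (blinfun_apply T y)"
  by (simp add: self_adjoint_op_def re_inner_def)

lemma norm_self_adjoint_apply:
  assumes "self_adjoint_op T"
  shows "(norm (blinfun_apply T x))\<^sup>2 = re_inner (blinfun_apply T (blinfun_apply T x)) x"
  using self_adjoint_re_inner[OF assms, of "T x" x] by (simp only: re_inner_self)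

text \<open>The square of norm (T x) is the inner product of T (T x) with x, which Cauchy-Schwarz
  bounds by norm (T^2) times the square of norm x.\<close>

lemma norm_self_adjoint_square:
  assumes T: "self_adjoint_op T"
  shows "norm (T o\<^sub>L T) = (norm T)\<^sup>2"
proof (rule antisym)
  show "norm (T o\<^sub>L T) \<le> (norm T)\<^sup>2"
    using norm_blinfun_compose[of T T] by (simp add: power2_eq_square)
  have "norm T \<le> sqrt (norm (T o\<^sub>L T))"
  proof (rule norm_blinfun_bound)
    fix x
    have "(norm (T x))\<^sup>2 \<le> norm ((T o\<^sub>L T) x) * norm x"
      using re_inner_le[of "(T o\<^sub>L T) x" x] by (simp add: norm_self_adjoint_apply[OF T])
    also have "\<dots> \<le> norm (T o\<^sub>L T) * norm x * norm x"
      by (intro mult_right_mono norm_blinfun) simp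
    finally have "(norm (T x))\<^sup>2 \<le> norm (T o\<^sub>L T) * (norm x)\<^sup>2"
      by (simp only: power2_eq_square mult.assoc)
    then have "norm (T x) \<le> sqrt (norm (T o\<^sub>L T) * (norm x)\<^sup>2)"
      by (rule real_le_rsqrt)
    then show "norm (T x) \<le> sqrt (norm (T o\<^sub>L T)) * norm x"
      by (simp add: real_sqrt_mult)
  qed simp
  then show "(norm T)\<^sup>2 \<le> norm (T o\<^sub>L T)"
    using power_mono[of "norm T" "sqrt (norm (T o\<^sub>L T))" 2] by simp
qed

lemma banach_mult_blinfun: "banach_mult (o\<^sub>L)"
  by (rule banach_mult.intro[OF bounded_bilinear_blinfun_compose])
    (auto intro!: blinfun_eqI norm_blinfun_compose)

section \<open>Jordan algebras of self-adjoint operators\<close>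

locale jc =
  fixes \<A> :: "('h::complex_hilbert_space \<Rightarrow>\<^sub>L 'h) set" and e
  assumes algebra: "jc_algebra \<A>" and unit: "jc_unit \<A> e"
begin

sublocale banach_mult "(o\<^sub>L) :: ('h \<Rightarrow>\<^sub>L 'h) \<Rightarrow> _ \<Rightarrow> _" e
  by (rule banach_mult_blinfun)

lemma self_adjoint: "T \<in> \<A> \<Longrightarrow> self_adjoint_op T"
  and subspace: "subspace \<A>" and closed: "closed \<A>"
  and jordan: "S \<in> \<A> \<Longrightarrow> T \<in> \<A> \<Longrightarrow> jordan_prod S T \<in> \<A>"
  using algebra by (auto simp: jc_algebra_def)

lemma unit_in: "e \<in> \<A>"
  using unit by (simp add: jc_unit_def)

lemma unit_jordan: "T \<in> \<A> \<Longrightarrow> (e o\<^sub>L T) + (T o\<^sub>L e) = 2 *\<^sub>R T"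
proof -
  assume "T \<in> \<A>"
  then have "2 *\<^sub>R jordan_prod e T = 2 *\<^sub>R T"
    using unit by (simp add: jc_unit_def)
  then show ?thesis by (simp add: jordan_prod_def)
qed

lemma unit_idem: "e o\<^sub>L e = e"
  using unit_jordan[OF unit_in] by (simp flip: scaleR_2)

text \<open>The Jordan unit yields only e T + T e = 2 T. As e^2 = e, multiplying by e on the left
  gives e T e = e T and on the right e T e = T e.\<close>

lemma unit_mult:
  assumes T: "T \<in> \<A>"
  shows "e o\<^sub>L T = T" "T o\<^sub>L e = T"
proof -
  have ee: "e o\<^sub>L (e o\<^sub>L T) = e o\<^sub>L T" "(T o\<^sub>L e) o\<^sub>L e = T o\<^sub>L e"
    by (simp_all add: unit_idem assoc) (simp add: unit_idem flip: assoc)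
  have "e o\<^sub>L ((e o\<^sub>L T) + (T o\<^sub>L e)) = 2 *\<^sub>R (e o\<^sub>L T)"
    unfolding unit_jordan[OF T] by (rule scaleR_right)
  then have 1: "e o\<^sub>L (T o\<^sub>L e) = e o\<^sub>L T"
    by (simp add: add_right ee scaleR_2)
  have "((e o\<^sub>L T) + (T o\<^sub>L e)) o\<^sub>L e = 2 *\<^sub>R (T o\<^sub>L e)"
    unfolding unit_jordan[OF T] by (rule scaleR_left)
  then have "e o\<^sub>L (T o\<^sub>L e) = T o\<^sub>L e"
    by (simp add: add_left ee scaleR_2 assoc unit_idem)
  then have "e o\<^sub>L T = T o\<^sub>L e" using 1 by simp
  then show "e o\<^sub>L T = T" "T o\<^sub>L e = T"
    using unit_jordan[OF T] by (simp_all flip: scaleR_2)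
qed

lemma comm_mult:
  assumes "S \<in> \<A>" "T \<in> \<A>" "S o\<^sub>L T = T o\<^sub>L S"
  shows "S o\<^sub>L T \<in> \<A>"
  using jordan[OF assms(1,2)] assms(3) by (simp add: jordan_prod_def flip: scaleR_2)

text \<open>S T S is a Jordan polynomial in S and T, although S T itself need not lie in the
  algebra.\<close>

lemma sandwich:
  assumes "S \<in> \<A>" "T \<in> \<A>"
  shows "S o\<^sub>L T o\<^sub>L S \<in> \<A>"
proof -
  have "S o\<^sub>L T o\<^sub>L S = 2 *\<^sub>R jordan_prod (jordan_prod S T) S - jordan_prod (jordan_prod S S) T"
    by (simp add: jordan_prod_def mult_simps assoc scaleR_add_right)
      (simp add: scaleR_2 flip: scaleR_add_left)
  then show ?thesis
    using assms jordan subspace by (simp add: subspace_diff subspace_scale)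
qed

text \<open>\<open>\<parallel>(M - T\<^sup>2) y\<parallel>\<^sup>2 = M\<^sup>2 \<parallel>y\<parallel>\<^sup>2 - 2 M \<parallel>T y\<parallel>\<^sup>2 + \<parallel>T\<^sup>2 y\<parallel>\<^sup>2\<close> with \<open>M = \<parallel>T\<parallel>\<^sup>2\<close>.\<close>

lemma norm_unit_diff_square_le:
  assumes T: "T \<in> \<A>"
  shows "norm ((norm T)\<^sup>2 *\<^sub>R e - (T o\<^sub>L T)) \<le> (norm T)\<^sup>2"
proof (rule norm_blinfun_bound)
  fix x
  \<comment> \<open>When e is a proper projection, x is first moved into its range: T x = T y and
    norm y \<le> norm x.\<close>
  define M y where "M = (norm T)\<^sup>2" and "y = blinfun_apply e x"
  have M: "M \<ge> 0" by (simp add: M_def)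
  have "norm e * norm e = norm e"
    using norm_self_adjoint_square[OF self_adjoint[OF unit_in]]
    by (simp add: unit_idem power2_eq_square)
  then have "norm e \<le> 1" by auto
  then have "norm e * norm x \<le> 1 * norm x"
    by (rule mult_right_mono) simp
  then have y: "norm y \<le> norm x"
    using norm_blinfun[of e x] unfolding y_def by linarith
  have "blinfun_apply (T o\<^sub>L e) x = T y"
    by (simp add: y_def)
  then have "T x = T y"
    by (simp only: unit_mult(2)[OF T])
  then have eq: "blinfun_apply (M *\<^sub>R e - (T o\<^sub>L T)) x = - (T (T y) - M *\<^sub>R y)"
    by (simp add: blinfun.diff_left blinfun.scaleR_left y_def)
  have "(norm (T (T y)))\<^sup>2 \<le> (norm T * norm (T y))\<^sup>2"
    by (intro power_mono norm_blinfun) simp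
  then have "(norm (T (T y)))\<^sup>2 \<le> M * (norm (T y))\<^sup>2"
    by (simp add: M_def power_mult_distrib)
  moreover have "M * (norm (T y))\<^sup>2 \<ge> 0" using M by simp
  ultimately have "(norm (T (T y) - M *\<^sub>R y))\<^sup>2 \<le> M\<^sup>2 * (norm y)\<^sup>2"
    unfolding norm_diff_square norm_self_adjoint_apply[OF self_adjoint[OF T], of y, symmetric]
    by linarith
  then have "(norm (T (T y) - M *\<^sub>R y))\<^sup>2 \<le> (M * norm y)\<^sup>2"
    by (simp only: power_mult_distrib)
  then have "norm (T (T y) - M *\<^sub>R y) \<le> M * norm y"
    by (rule power2_le_imp_le) (use M in simp)
  also have "\<dots> \<le> M * norm x" using y M by (rule mult_left_mono)
  finally show "norm (blinfun_apply ((norm T)\<^sup>2 *\<^sub>R e - (T o\<^sub>L T)) x) \<le> (norm T)\<^sup>2 * norm x"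
    using eq unfolding M_def by (simp only: norm_minus_cancel)
qed simp

text \<open>With M = (norm T)^2 one has e + T^2 = (1 + M)(e - z), where norm z \<le> M / (1 + M) <
  1.\<close>

lemma one_plus_square:
  assumes T: "T \<in> \<A>"
  shows "\<exists>y\<in>\<A>. (e + (T o\<^sub>L T)) o\<^sub>L y = e \<and> y o\<^sub>L (e + (T o\<^sub>L T)) = e"
proof -
  define M where "M = (norm T)\<^sup>2"
  have M: "M \<ge> 0" by (simp add: M_def)
  define z where "z = (1 / (1 + M)) *\<^sub>R (M *\<^sub>R e - (T o\<^sub>L T))"
  have zA: "z \<in> \<A>"
    using subspace unit_in comm_mult[OF T T] by (simp add: z_def subspace_diff subspace_scale)
  have "norm z \<le> (1 / (1 + M)) * M"
    using norm_unit_diff_square_le[OF T] M by (simp add: z_def M_def divide_right_mono)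
  also have "\<dots> < 1" using M by (simp add: field_simps)
  finally have "norm z < 1" .
  \<comment> \<open>Restricting to operators that commute with z keeps the products z u inside the
    Jordan algebra.\<close>
  let ?U = "{u \<in> \<A>. z o\<^sub>L u = u o\<^sub>L z}"
  have "closed ({u. z o\<^sub>L u = u o\<^sub>L z} \<inter> \<A>)"
    by (intro closed_Int closed closed_Collect_eq continuous_on continuous_intros)
  then have "closed ?U" by (simp add: Int_def conj_commute)
  then obtain u where u: "u \<in> \<A>" "z o\<^sub>L u = u o\<^sub>L z" "u = e + (z o\<^sub>L u)"
  proof (rule neumann)
    show "?U \<noteq> {}" using unit_in unit_mult[OF zA] by auto
    fix u assume "u \<in> ?U"
    then have u: "u \<in> \<A>" "z o\<^sub>L u = u o\<^sub>L z" by auto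
    have "e + (z o\<^sub>L u) \<in> \<A>"
      using comm_mult[OF zA u] subspace unit_in by (simp add: subspace_add)
    moreover have "z o\<^sub>L (z o\<^sub>L u) = z o\<^sub>L u o\<^sub>L z"
      using u(2) assoc[of z u z] by simp
    then have "z o\<^sub>L (e + (z o\<^sub>L u)) = (e + (z o\<^sub>L u)) o\<^sub>L z"
      by (simp only: add_left add_right unit_mult[OF zA])
    ultimately show "e + (z o\<^sub>L u) \<in> ?U" by simp
  qed (use \<open>norm z < 1\<close> in auto)
  have "u - (z o\<^sub>L u) = e"
    using u(3) by (metis add_diff_cancel_right')
  then have inv: "(e - z) o\<^sub>L u = e" "u o\<^sub>L (e - z) = e"
    using u(2) unit_mult[OF u(1)] by (simp_all add: diff_left diff_right)
  have eq: "e + (T o\<^sub>L T) = (1 + M) *\<^sub>R (e - z)"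
  proof -
    have "(1 + M) *\<^sub>R z = M *\<^sub>R e - (T o\<^sub>L T)"
      using M by (simp add: z_def)
    then have "(1 + M) *\<^sub>R (e - z) = (1 + M) *\<^sub>R e - (M *\<^sub>R e - (T o\<^sub>L T))"
      by (simp only: scaleR_diff_right)
    also have "(1 + M) *\<^sub>R e = e + M *\<^sub>R e"
      by (simp add: scaleR_add_left)
    finally show ?thesis by simp
  qed
  have "(e + (T o\<^sub>L T)) o\<^sub>L ((1 / (1 + M)) *\<^sub>R u) = e"
    "((1 / (1 + M)) *\<^sub>R u) o\<^sub>L (e + (T o\<^sub>L T)) = e"
    unfolding eq scaleR_left scaleR_right inv using M by simp_all
  moreover have "(1 / (1 + M)) *\<^sub>R u \<in> \<A>"
    by (intro subspace_scale subspace u(1))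
  ultimately show ?thesis by blast
qed

lemma norm_square: "T \<in> \<A> \<Longrightarrow> norm (T o\<^sub>L T) = (norm T)\<^sup>2"
  by (intro norm_self_adjoint_square self_adjoint)

sublocale sa_algebra "(o\<^sub>L) :: ('h \<Rightarrow>\<^sub>L 'h) \<Rightarrow> _ \<Rightarrow> _" e \<A>
  by (intro sa_algebra.intro sa_algebra_axioms.intro banach_mult_axioms subspace closed unit_in
    unit_mult comm_mult sandwich norm_square one_plus_square)

text \<open>A nonnegative spectrum provides a square root, and <r r x, x> is the square of norm (r
  x). Conversely let N = h(a) be the negative part and R its square root: R a R = -N^2, so 0 \<le>
  <a R x, R x> = -(norm (N x))^2. Hence N = 0 and h vanishes on the spectrum.\<close>

lemma positive_op_iff:
  assumes a: "a \<in> \<A>"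
  shows "positive_op a \<longleftrightarrow> spec a \<subseteq> {0..}"
proof
  assume sub: "spec a \<subseteq> {0..}"
  let ?r = "fcalc sqrt a"
  have cont: "continuous_on (spec a) sqrt" by (intro continuous_intros)
  have "?r o\<^sub>L ?r = fcalc (\<lambda>t. sqrt t * sqrt t) a"
    by (rule fcalc_mult[OF a cont cont, symmetric])
  also have "\<dots> = fcalc (\<lambda>t. t) a"
    by (rule fcalc_cong[OF a]) (use sub in auto)
  finally have rr: "?r o\<^sub>L ?r = a" using a by (simp add: fcalc_id)
  have "self_adjoint_op ?r"
    using self_adjoint fcalc_S[OF a cont] .
  from norm_self_adjoint_apply[OF this] have "re_inner (blinfun_apply a x) x \<ge> 0" for x
    by (metis rr blinfun_apply_blinfun_compose zero_le_power2)
  then show "positive_op a"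
    using self_adjoint[OF a] by (simp add: positive_op_def re_inner_def)
next
  assume pos: "positive_op a"
  define h where "h t = max 0 (- t)" for t :: real
  have cont: "continuous_on (spec a) h" "continuous_on (spec a) (\<lambda>t. sqrt (h t))"
    unfolding h_def by (intro continuous_intros)+
  define N R where "N = fcalc h a" and "R = fcalc (\<lambda>t. sqrt (h t)) a"
  have sa: "self_adjoint_op N" "self_adjoint_op R"
    unfolding N_def R_def using self_adjoint fcalc_S[OF a] cont by blast+
  have "R o\<^sub>L (a o\<^sub>L R) = fcalc (\<lambda>t. sqrt (h t) * (t * sqrt (h t))) a"
    unfolding R_def using a cont by (simp add: fcalc_mult fcalc_id continuous_on_id continuous_on_mult)
  also have "\<dots> = fcalc (\<lambda>t. (-1) * (h t * h t)) a"
  proof (rule fcalc_cong[OF a])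
    fix t :: real
    have "sqrt (h t) * (t * sqrt (h t)) = t * (sqrt (h t) * sqrt (h t))"
      by (rule mult.left_commute)
    also have "\<dots> = t * h t"
      by (simp add: h_def)
    also have "\<dots> = (-1) * (h t * h t)"
      by (simp add: h_def max_def)
    finally show "sqrt (h t) * (t * sqrt (h t)) = (-1) * (h t * h t)" .
  qed
  also have "\<dots> = - (N o\<^sub>L N)"
    unfolding N_def using a cont by (simp only: fcalc_scaleR fcalc_mult continuous_on_mult) simp
  finally have eq: "R o\<^sub>L (a o\<^sub>L R) = - (N o\<^sub>L N)" .
  have "blinfun_apply N x = 0" for x
  proof -
    have "0 \<le> re_inner (a (R x)) (R x)"
      using pos by (simp add: positive_op_def re_inner_def)
    also have "\<dots> = re_inner ((R o\<^sub>L (a o\<^sub>L R)) x) x"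
      using self_adjoint_re_inner[OF sa(2), of "a (R x)" x] by simp
    also have "\<dots> = - (norm (N x))\<^sup>2"
      unfolding eq using re_inner_scaleR[of "-1" "N (N x)" x] norm_self_adjoint_apply[OF sa(1), of x]
      by (simp add: blinfun.minus_left)
    finally show ?thesis by simp
  qed
  then have "N = 0" by (intro blinfun_eqI) simp
  have "t \<ge> 0" if "t \<in> spec a" for t
    using abs_le_norm_fcalc[OF a cont(1) that] \<open>N = 0\<close> by (simp add: N_def h_def)
  then show "spec a \<subseteq> {0..}" by auto
qed

lemma op_alg_jc: "op_alg (jc_alg \<A> e) \<A>"
proof (rule op_alg.intro)
  show "sa_algebra (mul (jc_alg \<A> e)) (unit (jc_alg \<A> e)) \<A>"
    using sa_algebra_axioms by (simp add: jc_alg_def)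
  fix a assume a: "a \<in> \<A>"
  show "{t. complex_of_real t \<in> spectrum (jc_alg \<A> e) a} =
      sa_algebra.spec (mul (jc_alg \<A> e)) (unit (jc_alg \<A> e)) \<A> a"
    by (auto simp: jc_alg_def jc_spectrum_def spec_def regular_def inverse_pair_def inverse_in_def)
  show "a \<in> cone (jc_alg \<A> e) \<longleftrightarrow>
      sa_algebra.spec (mul (jc_alg \<A> e)) (unit (jc_alg \<A> e)) \<A> a \<subseteq> {0..}"
    using positive_op_iff[OF a] by (simp add: jc_alg_def)
qed (auto simp: jc_alg_def inverse_in_def)

end

section \<open>The chain in the three kinds of algebras\<close>

lemma op_alg_jc_alg:
  assumes "jc_algebra \<A>" "jc_unit \<A> e"
  shows "op_alg (jc_alg \<A> e) \<A>"
  using assms by (intro jc.op_alg_jc jc.intro)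

lemma positive_pairI:
  "op_alg M S \<Longrightarrow> positive_invertible M A \<Longrightarrow> positive_invertible M B \<Longrightarrow> positive_pair M S A B"
  by (intro positive_pair.intro positive_pair_axioms.intro)

lemma op_alg_chain_ge:
  assumes "op_alg M S" "positive_invertible M A" "positive_invertible M B"
    and "\<delta> \<ge> 1" "op_le M (\<delta> *\<^sub>R op_powr M A \<beta>) B"
  shows "successively (op_le M)
    [bound_I M \<alpha> \<beta> A B, bound_II M \<alpha> \<beta> A B, bound_II' M \<delta> \<alpha> \<beta> A B, rel_entropy M \<alpha> \<beta> A B,
     bound_III' M \<delta> \<alpha> \<beta> A B, bound_V' M \<delta> \<alpha> \<beta> A B, bound_V M \<alpha> \<beta> A B]"
  by (rule positive_pair.chain_ge[OF positive_pairI[OF assms(1-3)] _ assms(4,5)])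
    (use assms(4) in simp)

lemma op_alg_chain_le:
  assumes "op_alg M S" "positive_invertible M A" "positive_invertible M B"
    and "0 < \<delta>" "\<delta> \<le> 1" "op_le M B (\<delta> *\<^sub>R op_powr M A \<beta>)"
  shows "successively (op_le M)
    [bound_V M \<alpha> \<beta> A B, bound_V' M \<delta> \<alpha> \<beta> A B, bound_III' M \<delta> \<alpha> \<beta> A B, rel_entropy M \<alpha> \<beta> A B,
     bound_II' M \<delta> \<alpha> \<beta> A B, bound_II M \<alpha> \<beta> A B, bound_I M \<alpha> \<beta> A B]"
  by (rule positive_pair.chain_le[OF positive_pairI[OF assms(1-3)] assms(4-6)])

theorem corollary3p3:
  fixes \<alpha> \<beta> \<delta> :: real
  assumes "\<alpha> \<ge> 0" and "\<beta> > 0"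
  shows
    "(\<forall>A B :: 'a::cstar_algebra.
         positive_invertible cstar_alg A \<and> positive_invertible cstar_alg B \<longrightarrow>
         (\<delta> \<ge> 1 \<and> op_le cstar_alg (\<delta> *\<^sub>R op_powr cstar_alg A \<beta>) B \<longrightarrow>
            successively (op_le cstar_alg)
             [bound_I cstar_alg \<alpha> \<beta> A B,
              bound_II cstar_alg \<alpha> \<beta> A B,
              bound_II' cstar_alg \<delta> \<alpha> \<beta> A B,
              rel_entropy cstar_alg \<alpha> \<beta> A B,
              bound_III' cstar_alg \<delta> \<alpha> \<beta> A B,
              bound_V' cstar_alg \<delta> \<alpha> \<beta> A B,
              bound_V cstar_alg \<alpha> \<beta> A B]) \<and>
         (0 < \<delta> \<and> \<delta> \<le> 1 \<and> op_le cstar_alg B (\<delta> *\<^sub>R op_powr cstar_alg A \<beta>) \<longrightarrow>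
            successively (op_le cstar_alg)
             [bound_V cstar_alg \<alpha> \<beta> A B,
              bound_V' cstar_alg \<delta> \<alpha> \<beta> A B,
              bound_III' cstar_alg \<delta> \<alpha> \<beta> A B,
              rel_entropy cstar_alg \<alpha> \<beta> A B,
              bound_II' cstar_alg \<delta> \<alpha> \<beta> A B,
              bound_II cstar_alg \<alpha> \<beta> A B,
              bound_I cstar_alg \<alpha> \<beta> A B])) \<and>
     (\<forall>A B :: 'b::real_cstar_algebra.
         positive_invertible real_cstar_alg A \<and> positive_invertible real_cstar_alg B \<longrightarrow>
         (\<delta> \<ge> 1 \<and> op_le real_cstar_alg (\<delta> *\<^sub>R op_powr real_cstar_alg A \<beta>) B \<longrightarrow>
            successively (op_le real_cstar_alg)
             [bound_I real_cstar_alg \<alpha> \<beta> A B,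
              bound_II real_cstar_alg \<alpha> \<beta> A B,
              bound_II' real_cstar_alg \<delta> \<alpha> \<beta> A B,
              rel_entropy real_cstar_alg \<alpha> \<beta> A B,
              bound_III' real_cstar_alg \<delta> \<alpha> \<beta> A B,
              bound_V' real_cstar_alg \<delta> \<alpha> \<beta> A B,
              bound_V real_cstar_alg \<alpha> \<beta> A B]) \<and>
         (0 < \<delta> \<and> \<delta> \<le> 1 \<and> op_le real_cstar_alg B (\<delta> *\<^sub>R op_powr real_cstar_alg A \<beta>) \<longrightarrow>
            successively (op_le real_cstar_alg)
             [bound_V real_cstar_alg \<alpha> \<beta> A B,
              bound_V' real_cstar_alg \<delta> \<alpha> \<beta> A B,
              bound_III' real_cstar_alg \<delta> \<alpha> \<beta> A B,
              rel_entropy real_cstar_alg \<alpha> \<beta> A B,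
              bound_II' real_cstar_alg \<delta> \<alpha> \<beta> A B,
              bound_II real_cstar_alg \<alpha> \<beta> A B,
              bound_I real_cstar_alg \<alpha> \<beta> A B])) \<and>
     (\<forall>(\<A> :: ('h::complex_hilbert_space \<Rightarrow>\<^sub>L 'h) set) e.
       jc_algebra \<A> \<and> jc_unit \<A> e \<longrightarrow>
       (\<forall>A B.
         positive_invertible (jc_alg \<A> e) A \<and> positive_invertible (jc_alg \<A> e) B \<longrightarrow>
         (\<delta> \<ge> 1 \<and> op_le (jc_alg \<A> e) (\<delta> *\<^sub>R op_powr (jc_alg \<A> e) A \<beta>) B \<longrightarrow>
            successively (op_le (jc_alg \<A> e))
             [bound_I (jc_alg \<A> e) \<alpha> \<beta> A B,
              bound_II (jc_alg \<A> e) \<alpha> \<beta> A B,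
              bound_II' (jc_alg \<A> e) \<delta> \<alpha> \<beta> A B,
              rel_entropy (jc_alg \<A> e) \<alpha> \<beta> A B,
              bound_III' (jc_alg \<A> e) \<delta> \<alpha> \<beta> A B,
              bound_V' (jc_alg \<A> e) \<delta> \<alpha> \<beta> A B,
              bound_V (jc_alg \<A> e) \<alpha> \<beta> A B]) \<and>
         (0 < \<delta> \<and> \<delta> \<le> 1 \<and> op_le (jc_alg \<A> e) B (\<delta> *\<^sub>R op_powr (jc_alg \<A> e) A \<beta>) \<longrightarrow>
            successively (op_le (jc_alg \<A> e))
             [bound_V (jc_alg \<A> e) \<alpha> \<beta> A B,
              bound_V' (jc_alg \<A> e) \<delta> \<alpha> \<beta> A B,
              bound_III' (jc_alg \<A> e) \<delta> \<alpha> \<beta> A B,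
              rel_entropy (jc_alg \<A> e) \<alpha> \<beta> A B,
              bound_II' (jc_alg \<A> e) \<delta> \<alpha> \<beta> A B,
              bound_II (jc_alg \<A> e) \<alpha> \<beta> A B,
              bound_I (jc_alg \<A> e) \<alpha> \<beta> A B])))"
  by (intro conjI allI impI; elim conjE)
    ((rule op_alg_chain_ge[OF op_alg_cstar] op_alg_chain_le[OF op_alg_cstar]
        op_alg_chain_ge[OF op_alg_real_cstar] op_alg_chain_le[OF op_alg_real_cstar]
        op_alg_chain_ge[OF op_alg_jc_alg] op_alg_chain_le[OF op_alg_jc_alg]; assumption)+)

end
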